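(* Let $d\ge2$, $p\in(d,\infty)$ and $\widetilde{\mathbf G}\in L^p_{loc}(\mathbb R^d,\mathbb R^d)$. Suppose that $(L^{\widetilde{\mathbf G}},C_0^\infty(\mathbb R^d))$, where $L^{\widetilde{\mathbf G}}f=\frac12\Delta f+\langle\widetilde{\mathbf G},\nabla f\rangle$, admits an infinitesimally invariant measure $\mu$ which is unique up to a multiplicative constant. Write $\mu=e^{2\Phi}dx$ with $\Phi\in H^{1,p}_{loc}(\mathbb R^d)$ (such a representation exists), and set $\mathbf B:=\widetilde{\mathbf G}-\nabla\Phi$. Then: (i) $\widetilde{\mathbf G}=\nabla\Phi+\mathbf B$ is the unique WHHD for $\widetilde{\mathbf G}$ (uniqueness meaning that any WHHD $\widetilde{\mathbf G}=\nabla\widetilde\Phi+\widetilde{\mathbf B}$ has $\nabla\widetilde\Phi=\nabla\Phi$); (ii) if an OHHD for $\widetilde{\mathbf G}$ exists, then it is unique and $\widetilde{\mathbf G}=\nabla\Phi+\mathbf B$ is this unique OHHD; (iii) an OHHD for $\widetilde{\mathbf G}$ exists if and only if $\mathrm{div}_{dx}(\mathbf B)=0$ or $\langle\nabla\Phi,\mathbf B\rangle=0$ a.e. In particular, if $\langle\nabla\Phi,\mathbf B\rangle\neq0$ on a set of positive Lebesgue measure, or if $\mathrm{div}_{dx}(\mathbf B)\neq0$, there is no OHHD for $\widetilde{\mathbf G}$.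
   Context: A positive locally finite Borel measure $\hat\mu$ on $\mathbb R^d$ is an infinitesimally invariant measure for $(L,C_0^\infty(\mathbb R^d))$ if $Lf\in L^1(\hat\mu)$ and $\int Lf\,d\hat\mu=0$ for all $f\in C_0^\infty(\mathbb R^d)$. For a measure $\nu$, $\mathrm{div}_\nu(\mathbf B)=0$ means $\int\langle\mathbf B,\nabla f\rangle d\nu=0$ for all $f\in C_0^\infty(\mathbb R^d)$; $\mathrm{div}_{dx}$ refers to Lebesgue measure. For $\widetilde{\mathbf G}\in L^2_{loc}$: a decomposition $\widetilde{\mathbf G}=\nabla\Phi+\mathbf B$ a.e. with $\Phi\in H^{1,2}_{loc}\cap L^\infty_{loc}$, $\mathbf B\in L^2_{loc}$ is an HHD if $\mathrm{div}_{dx}(\mathbf B)=0$; an OHHD if it is an HHD and $\langle\nabla\Phi,\mathbf B\rangle=0$ a.e.; a WHHD if $\mathrm{div}_{e^{2\Phi}dx}(\mathbf B)=0$. *)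

theory Defs
  imports "HOL-Analysis.Analysis"
begin

fun Ck :: "nat \<Rightarrow> ('a::euclidean_space \<Rightarrow> real) \<Rightarrow> bool" where
  "Ck 0 f = continuous_on UNIV f"
| "Ck (Suc k) f = (continuous_on UNIV f \<and> (\<forall>x. f differentiable (at x)) \<and>
       (\<forall>v. Ck k (\<lambda>x. frechet_derivative f (at x) v)))"

definition smooth_fun :: "('a::euclidean_space \<Rightarrow> real) \<Rightarrow> bool" where
  "smooth_fun f \<longleftrightarrow> (\<forall>k. Ck k f)"

definition test_fun :: "('a::euclidean_space \<Rightarrow> real) \<Rightarrow> bool" where
  "test_fun f \<longleftrightarrow> smooth_fun f \<and> compact (closure {x. f x \<noteq> 0})"

definition pderiv_dir :: "'a::euclidean_space \<Rightarrow> ('a \<Rightarrow> real) \<Rightarrow> 'a \<Rightarrow> real" where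
  "pderiv_dir i f x = frechet_derivative f (at x) i"

definition grad :: "('a::euclidean_space \<Rightarrow> real) \<Rightarrow> 'a \<Rightarrow> 'a" where
  "grad f x = (\<Sum>i\<in>Basis. pderiv_dir i f x *\<^sub>R i)"

definition laplacian :: "('a::euclidean_space \<Rightarrow> real) \<Rightarrow> 'a \<Rightarrow> real" where
  "laplacian f x = (\<Sum>i\<in>Basis. pderiv_dir i (pderiv_dir i f) x)"

definition Lp_loc :: "real \<Rightarrow> ('a::euclidean_space \<Rightarrow> 'b::euclidean_space) \<Rightarrow> bool" where
  "Lp_loc p f \<longleftrightarrow> f \<in> borel_measurable lborel \<and>
     (\<forall>K. compact K \<longrightarrow> set_integrable lborel K (\<lambda>x. norm (f x) powr p))"

definition Linf_loc :: "('a::euclidean_space \<Rightarrow> real) \<Rightarrow> bool" where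
  "Linf_loc f \<longleftrightarrow> f \<in> borel_measurable lborel \<and>
     (\<forall>K. compact K \<longrightarrow> (\<exists>C. AE x in lborel. x \<in> K \<longrightarrow> \<bar>f x\<bar> \<le> C))"

definition weak_grad :: "('a::euclidean_space \<Rightarrow> real) \<Rightarrow> ('a \<Rightarrow> 'a) \<Rightarrow> bool" where
  "weak_grad \<Phi> g \<longleftrightarrow> Lp_loc 1 \<Phi> \<and> Lp_loc 1 g \<and>
     (\<forall>f. test_fun f \<longrightarrow> (\<forall>i\<in>Basis.
        (\<integral>x. \<Phi> x * pderiv_dir i f x \<partial>lborel) = - (\<integral>x. (g x \<bullet> i) * f x \<partial>lborel)))"

definition H1p_loc :: "real \<Rightarrow> ('a::euclidean_space \<Rightarrow> real) \<Rightarrow> ('a \<Rightarrow> 'a) \<Rightarrow> bool" where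
  "H1p_loc p \<Phi> g \<longleftrightarrow> Lp_loc p \<Phi> \<and> Lp_loc p g \<and> weak_grad \<Phi> g"

definition div_free :: "'a::euclidean_space measure \<Rightarrow> ('a \<Rightarrow> 'a) \<Rightarrow> bool" where
  "div_free \<nu> B \<longleftrightarrow> (\<forall>f. test_fun f \<longrightarrow> (\<integral>x. B x \<bullet> grad f x \<partial>\<nu>) = 0)"

definition decomp :: "('a::euclidean_space \<Rightarrow> 'a) \<Rightarrow> ('a \<Rightarrow> real) \<Rightarrow> ('a \<Rightarrow> 'a) \<Rightarrow> ('a \<Rightarrow> 'a) \<Rightarrow> bool" where
  "decomp G \<Phi> g B \<longleftrightarrow> H1p_loc 2 \<Phi> g \<and> Linf_loc \<Phi> \<and> Lp_loc 2 B \<and>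
     (AE x in lborel. G x = g x + B x)"

definition HHD :: "('a::euclidean_space \<Rightarrow> 'a) \<Rightarrow> ('a \<Rightarrow> real) \<Rightarrow> ('a \<Rightarrow> 'a) \<Rightarrow> ('a \<Rightarrow> 'a) \<Rightarrow> bool" where
  "HHD G \<Phi> g B \<longleftrightarrow> decomp G \<Phi> g B \<and> div_free lborel B"

definition OHHD :: "('a::euclidean_space \<Rightarrow> 'a) \<Rightarrow> ('a \<Rightarrow> real) \<Rightarrow> ('a \<Rightarrow> 'a) \<Rightarrow> ('a \<Rightarrow> 'a) \<Rightarrow> bool" where
  "OHHD G \<Phi> g B \<longleftrightarrow> HHD G \<Phi> g B \<and> (AE x in lborel. g x \<bullet> B x = 0)"

definition WHHD :: "('a::euclidean_space \<Rightarrow> 'a) \<Rightarrow> ('a \<Rightarrow> real) \<Rightarrow> ('a \<Rightarrow> 'a) \<Rightarrow> ('a \<Rightarrow> 'a) \<Rightarrow> bool" where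
  "WHHD G \<Phi> g B \<longleftrightarrow> decomp G \<Phi> g B \<and>
     div_free (density lborel (\<lambda>x. ennreal (exp (2 * \<Phi> x)))) B"

definition gen_L :: "('a::euclidean_space \<Rightarrow> 'a) \<Rightarrow> ('a \<Rightarrow> real) \<Rightarrow> 'a \<Rightarrow> real" where
  "gen_L G f x = laplacian f x / 2 + G x \<bullet> grad f x"

definition inf_invariant :: "('a::euclidean_space \<Rightarrow> 'a) \<Rightarrow> 'a measure \<Rightarrow> bool" where
  "inf_invariant G \<mu> \<longleftrightarrow> sets \<mu> = sets borel \<and> emeasure \<mu> (space \<mu>) \<noteq> 0 \<and>
     (\<forall>K. compact K \<longrightarrow> emeasure \<mu> K < \<infinity>) \<and>
     (\<forall>f. test_fun f \<longrightarrow> integrable \<mu> (gen_L G f) \<and> (\<integral>x. gen_L G f x \<partial>\<mu>) = 0)"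

end

theory Submission
  imports Defs
begin

text \<open>
  Everything reduces to one identity: if \<open>B \<in> L\<^sup>2\<close> locally is divergence free with respect to
  Lebesgue measure and \<open>\<Phi>\<close> is locally bounded with weak gradient \<open>g \<in> L\<^sup>2\<close> locally, then \<open>f e\<^bsup>c\<Phi>\<^esup>\<close> is an
  admissible test function, that is \<open>\<integral> e\<^bsup>c\<Phi>\<^esup> \<langle>B, \<nabla>f + c f g\<rangle> dx = 0\<close>; this follows by mollifying \<open>\<Phi>\<close>.
  With \<open>B\<close> constant it is the chain rule, which says that a decomposition of \<open>G\<close> is a WHHD iff
  \<open>e\<^bsup>2\<Phi>\<^esup> dx\<close> is infinitesimally invariant, so uniqueness of the invariant measure determines \<open>\<Phi>\<close>
  up to a constant. With \<open>B\<close> an orthogonal divergence-free part and \<open>c = 2\<close> it shows that every OHHD is a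
  WHHD; applied to \<open>B\<close> with \<open>c = 2\<close> and to \<open>e\<^bsup>2\<Phi>\<^esup> B\<close> with \<open>c = -2\<close> it shows that for a WHHD the
  conditions \<open>div B = 0\<close> and \<open>\<langle>g, B\<rangle> = 0\<close> are equivalent. Local boundedness of \<open>\<Phi>\<close> is Morrey's
  estimate, obtained by differentiating the mollification with respect to its scale.
\<close>

section \<open>Smooth functions and test functions\<close>

text \<open>The 2 in the weight answers the 1/2 before the Laplacian:
  \<open>exp (2 * \<Phi>) g\<close> is half the weak gradient of \<open>exp (2 * \<Phi>)\<close>, so
  in the integral of \<open>gen_L G f\<close> against that weight the Laplacian cancels the
  \<open>g\<close> part of the drift and only \<open>B\<close> is left. The value
  \<open>c = -2\<close> removes the same weight again. The obstacle in the key identity is that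
  \<open>B\<close> and \<open>g\<close> are both merely locally square integrable, so the products
  of \<open>B\<close> with the mollified gradients have no evident fixed majorant. By Jensen, the
  squared norm of a mollified gradient is at most the mollification of \<open>|g|^2\<close>; these
  majorants vary with the scale but converge locally in L1, and dominated convergence with varying
  majorants applies. Local boundedness of \<open>\<Phi>\<close> has two uses: it keeps the
  exponentials of the mollified potentials bounded on the support of \<open>f\<close>, and it leaves
  \<open>exp (2 * \<Phi>) B\<close> locally square integrable, so that the identity may be applied
  to this field as well. A gradient is only determined almost everywhere, hence each decomposition
  carries its weak gradient \<open>g\<close> explicitly and uniqueness means almost everywhere
  equality of these fields.\<close>

lemma Ck_continuous: "Ck k f \<Longrightarrow> continuous_on UNIV f"
  by (cases k) auto

lemma Ck_Suc_has_derivative: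
  "Ck (Suc k) f \<Longrightarrow> (f has_derivative frechet_derivative f (at x)) (at x)"
  by (simp add: frechet_derivative_works)

text \<open>Any explicit derivative will do here, so \<open>frechet_derivative\<close> never has to
  be evaluated in the closure properties below.\<close>

lemma Ck_SucI:
  assumes "\<And>x. (f has_derivative D x) (at x)" "\<And>v. Ck k (\<lambda>x. D x v)"
  shows "Ck (Suc k) f"
proof -
  have "frechet_derivative f (at x) = D x" for x
    using frechet_derivative_at[OF assms(1)] by simp
  moreover have "continuous_on UNIV f"
    using assms(1) by (meson has_derivative_continuous continuous_at_imp_continuous_on)
  ultimately show ?thesis
    using assms by (auto simp: differentiable_def)
qed

lemma Ck_SucD: "Ck (Suc k) f \<Longrightarrow> Ck k f"
  by (induction k arbitrary: f) auto

lemma Ck_const [intro, simp]: "Ck k (\<lambda>x. c)"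
  by (induction k arbitrary: c) (auto intro!: Ck_SucI[where D="\<lambda>x v. 0"])

lemma Ck_linear: "bounded_linear f \<Longrightarrow> Ck k f"
proof (cases k)
  case (Suc j)
  assume "bounded_linear f"
  then show ?thesis
    unfolding Suc by (intro Ck_SucI[where D="\<lambda>x. f"] bounded_linear_imp_has_derivative Ck_const)
qed (auto simp: linear_continuous_on)

lemma Ck_add: "Ck k f \<Longrightarrow> Ck k g \<Longrightarrow> Ck k (\<lambda>x. f x + g x)"
proof (induction k arbitrary: f g)
  case (Suc k)
  show ?case
    by (rule Ck_SucI[OF has_derivative_add[OF Ck_Suc_has_derivative[OF Suc.prems(1)]
            Ck_Suc_has_derivative[OF Suc.prems(2)]]]) (use Suc in auto)
qed (auto intro: continuous_intros)

lemma Ck_mult: "Ck k f \<Longrightarrow> Ck k g \<Longrightarrow> Ck k (\<lambda>x. f x * g x)"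
proof (induction k arbitrary: f g)
  case (Suc k)
  note Ck_SucD[OF Suc.prems(1)] Ck_SucD[OF Suc.prems(2)]
  then show ?case
    by (intro Ck_SucI[OF has_derivative_mult[OF Ck_Suc_has_derivative[OF Suc.prems(1)]
            Ck_Suc_has_derivative[OF Suc.prems(2)]]] Ck_add Suc.IH) (use Suc in auto)
qed (auto intro: continuous_intros)

lemma Ck_sum: "(\<And>i. i \<in> I \<Longrightarrow> Ck k (f i)) \<Longrightarrow> Ck k (\<lambda>x. \<Sum>i\<in>I. f i x)"
  by (induction I rule: infinite_finite_induct) (auto intro!: Ck_add)

text \<open>The outer functions form a family closed under differentiation, with \<open>D\<close>
  giving the index of the derivative. The induction on \<open>k\<close> needs all indices at once,
  since the chain rule passes from \<open>q\<close> to \<open>D q\<close>. The instances are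
  \<open>q * exp (c * t)\<close> and \<open>flat q t\<close>.\<close>

lemma Ck_compose:
  fixes H :: "'i \<Rightarrow> real \<Rightarrow> real"
  assumes H: "\<And>q t. (H q has_real_derivative H (D q) t) (at t)"
  shows "Ck k f \<Longrightarrow> Ck k (\<lambda>x. H q (f x))"
proof (induction k arbitrary: f q)
  case 0
  have "continuous_on UNIV (H q)"
    using H by (meson DERIV_isCont continuous_at_imp_continuous_on)
  with 0 show ?case
    by (auto intro: continuous_on_compose2)
next
  case (Suc k)
  have "((\<lambda>x. H q (f x)) has_derivative (\<lambda>v. H (D q) (f x) * frechet_derivative f (at x) v)) (at x)" for x
    using has_derivative_compose[OF Ck_Suc_has_derivative[OF Suc.prems]
       H[unfolded has_field_derivative_def, of q "f x"]] by simp
  then show ?case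
    by (rule Ck_SucI) (use Suc Ck_SucD[OF Suc.prems] in \<open>auto intro!: Ck_mult Suc.IH\<close>)
qed

lemma Ck_affine: "Ck k f \<Longrightarrow> Ck k (\<lambda>x. f (a + c *\<^sub>R x))"
proof (induction k arbitrary: f)
  case 0
  then show ?case
    by (auto intro!: continuous_intros intro: continuous_on_compose2)
next
  case (Suc k)
  have "((\<lambda>x. f (a + c *\<^sub>R x)) has_derivative
      (\<lambda>v. frechet_derivative f (at (a + c *\<^sub>R x)) (c *\<^sub>R v))) (at x)" for x
    by (rule has_derivative_compose[OF _ Ck_Suc_has_derivative[OF Suc.prems]])
      (auto intro!: derivative_eq_intros)
  then show ?case
    by (rule Ck_SucI) (use Suc in auto)
qed

lemma smooth_has_derivative:
  "smooth_fun f \<Longrightarrow> (f has_derivative frechet_derivative f (at x)) (at x)"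
  using Ck_Suc_has_derivative unfolding smooth_fun_def by blast

lemma smooth_continuous: "smooth_fun f \<Longrightarrow> continuous_on A f"
  unfolding smooth_fun_def by (meson Ck_continuous continuous_on_subset subset_UNIV)

lemma smooth_frechet_derivative:
  "smooth_fun f \<Longrightarrow> smooth_fun (\<lambda>x. frechet_derivative f (at x) v)"
  unfolding smooth_fun_def by (metis Ck.simps(2))

lemma smooth_mult: "smooth_fun f \<Longrightarrow> smooth_fun g \<Longrightarrow> smooth_fun (\<lambda>x. f x * g x)"
  by (simp add: smooth_fun_def Ck_mult)

lemma smooth_exp: "smooth_fun f \<Longrightarrow> smooth_fun (\<lambda>x. exp (c * f x))"
  unfolding smooth_fun_def
proof
  fix k assume f: "\<forall>k. Ck k f"
  have "Ck k (\<lambda>x. 1 * exp (c * f x))"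
    by (rule Ck_compose[where H="\<lambda>q t. q * exp (c * t)" and D="\<lambda>q. q * c"])
      (use f in \<open>auto intro!: derivative_eq_intros\<close>)
  then show "Ck k (\<lambda>x. exp (c * f x))" by simp
qed

lemma smooth_affine: "smooth_fun f \<Longrightarrow> smooth_fun (\<lambda>x. f (a + c *\<^sub>R x))"
  by (simp add: smooth_fun_def Ck_affine)

text \<open>By Heine-Borel, compactness of the closure of the support is boundedness of the support.
  The radius form is the one that survives differentiation and products without any
  topology.\<close>

lemma test_fun_iff: "test_fun f \<longleftrightarrow> smooth_fun f \<and> (\<exists>R. \<forall>x. norm x > R \<longrightarrow> f x = 0)"
proof -
  have "compact (closure {x. f x \<noteq> 0}) \<longleftrightarrow> (\<exists>R. \<forall>x. norm x > R \<longrightarrow> f x = 0)"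
    unfolding compact_closure bounded_iff mem_Collect_eq Ball_def by (meson not_le)
  then show ?thesis
    by (simp add: test_fun_def)
qed

lemma frechet_derivative_eq_0_outside:
  assumes "\<And>x. norm x > R \<Longrightarrow> f x = 0" and "norm x > R"
  shows "frechet_derivative f (at x) = (\<lambda>v. 0)"
proof -
  have "open {x::'a. R < norm x}"
    by (intro open_Collect_less continuous_intros)
  then have "(f has_derivative (\<lambda>v. 0)) (at x)"
    using has_derivative_transform_within_open[OF has_derivative_const[of 0 "at x"]] assms by auto
  then show ?thesis
    using frechet_derivative_at by metis
qed

lemma test_fun_frechet_derivative:
  "test_fun f \<Longrightarrow> test_fun (\<lambda>x. frechet_derivative f (at x) v)"
  unfolding test_fun_iff using smooth_frechet_derivative frechet_derivative_eq_0_outside by metis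

lemma test_fun_pderiv: "test_fun f \<Longrightarrow> test_fun (pderiv_dir i f)"
  using test_fun_frechet_derivative[of f i] by (simp add: pderiv_dir_def[abs_def])

lemma test_fun_mult_smooth:
  "test_fun f \<Longrightarrow> smooth_fun g \<Longrightarrow> test_fun (\<lambda>x. f x * g x)"
  unfolding test_fun_iff by (metis smooth_mult mult_zero_left)

lemma test_fun_affine:
  assumes f: "test_fun f" and "c \<noteq> 0"
  shows "test_fun (\<lambda>x. f (a + c *\<^sub>R x))"
proof -
  from f obtain R where R: "\<And>x. norm x > R \<Longrightarrow> f x = 0"
    unfolding test_fun_iff by blast
  have "f (a + c *\<^sub>R x) = 0" if "norm x > (R + norm a) / \<bar>c\<bar>" for x
  proof (rule R)
    have "R + norm a < \<bar>c\<bar> * norm x"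
      using that \<open>c \<noteq> 0\<close> by (simp add: field_simps)
    then show "R < norm (a + c *\<^sub>R x)"
      using norm_triangle_ineq2[of "c *\<^sub>R x" "- a"] by (simp add: add.commute)
  qed
  then show ?thesis
    using f smooth_affine unfolding test_fun_iff by blast
qed

lemma smooth_grad_inner:
  assumes "smooth_fun f"
  shows "grad f x \<bullet> v = frechet_derivative f (at x) v"
proof -
  interpret linear "frechet_derivative f (at x)"
    using smooth_has_derivative[OF assms] has_derivative_linear by blast
  have "frechet_derivative f (at x) v = frechet_derivative f (at x) (\<Sum>i\<in>Basis. (v \<bullet> i) *\<^sub>R i)"
    by (simp add: euclidean_representation)
  also have "\<dots> = grad f x \<bullet> v"
    by (simp add: sum scale grad_def pderiv_dir_def inner_sum_left inner_commute[of v] mult.commute)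
  finally show ?thesis by simp
qed

lemma grad_eqI:
  assumes "(f has_derivative (\<lambda>v. G \<bullet> v)) (at x)"
  shows "grad f x = G"
proof -
  have "frechet_derivative f (at x) = (\<lambda>v. G \<bullet> v)"
    using frechet_derivative_at[OF assms] by simp
  then show ?thesis
    by (simp add: grad_def pderiv_dir_def euclidean_representation)
qed

lemma smooth_has_derivative_grad:
  "smooth_fun f \<Longrightarrow> (f has_derivative (\<lambda>v. grad f x \<bullet> v)) (at x)"
  using smooth_has_derivative[of f x] by (simp add: smooth_grad_inner)

lemma continuous_grad: "smooth_fun f \<Longrightarrow> continuous_on A (grad f)"
  unfolding grad_def[abs_def] pderiv_dir_def
  by (intro continuous_intros smooth_continuous smooth_frechet_derivative)

lemma grad_eq_0_outside:
  "(\<And>x. norm x > R \<Longrightarrow> f x = 0) \<Longrightarrow> norm x > R \<Longrightarrow> grad f x = 0"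
  by (simp add: grad_def pderiv_dir_def frechet_derivative_eq_0_outside[of R])

lemma bounded_of_continuous_vanishing:
  fixes f :: "'a::euclidean_space \<Rightarrow> 'b::real_normed_vector"
  assumes "continuous_on UNIV f" "\<And>x. norm x > R \<Longrightarrow> f x = 0"
  obtains M where "M \<ge> 0" "\<And>x. norm (f x) \<le> M"
proof -
  have "compact (f ` cball 0 R)"
    using assms(1) by (intro compact_continuous_image) (auto intro: continuous_on_subset)
  then obtain M where M: "\<And>y. y \<in> f ` cball 0 R \<Longrightarrow> norm y \<le> M"
    using compact_imp_bounded bounded_iff by metis
  have "norm (f x) \<le> max M 0" for x
    using assms(2)[of x] M[of "f x"] by (cases "norm x \<le> R") auto
  then show ?thesis
    using that[of "max M 0"] by auto
qed

lemma test_fun_bounds: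
  assumes "test_fun f"
  obtains R M where "R > 0" "M \<ge> 0" "\<And>x. norm x > R \<Longrightarrow> f x = 0" "\<And>x. norm x > R \<Longrightarrow> grad f x = 0"
    "\<And>x. \<bar>f x\<bar> \<le> M" "\<And>x. norm (grad f x) \<le> M"
proof -
  from assms obtain R where s: "smooth_fun f" and R: "\<And>x. norm x > R \<Longrightarrow> f x = 0"
    unfolding test_fun_iff by blast
  obtain M where M: "M \<ge> 0" "\<And>x. norm (f x) \<le> M"
    using bounded_of_continuous_vanishing[OF smooth_continuous[OF s] R] by blast
  obtain N where N: "N \<ge> 0" "\<And>x. norm (grad f x) \<le> N"
    using bounded_of_continuous_vanishing[OF continuous_grad[OF s] grad_eq_0_outside[where R=R]] R by blast
  show ?thesis
    by (rule that[of "max R 1" "max M N"])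
      (use M N R grad_eq_0_outside[where R=R and f=f] in \<open>auto simp: le_max_iff_disj\<close>)
qed

lemma smooth_fun_lipschitz:
  assumes "smooth_fun f" "\<And>x. norm (grad f x) \<le> M"
  shows "\<bar>f x - f y\<bar> \<le> M * norm (x - y)"
proof -
  have *: "onorm (\<lambda>v. grad f z \<bullet> v) \<le> M" for z
  proof (rule onorm_le)
    fix v
    have "norm (grad f z \<bullet> v) \<le> norm (grad f z) * norm v"
      using Cauchy_Schwarz_ineq2 by simp
    also have "\<dots> \<le> M * norm v"
      by (intro mult_right_mono assms) simp
    finally show "norm (grad f z \<bullet> v) \<le> M * norm v" .
  qed
  have "norm (f x - f y) \<le> M * norm (x - y)"
    by (rule differentiable_bound[of UNIV f "\<lambda>z v. grad f z \<bullet> v"])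
      (use smooth_has_derivative_grad[OF assms(1)] * in \<open>auto intro: has_derivative_at_withinI\<close>)
  then show ?thesis by simp
qed

section \<open>A smooth bump function built from \<open>exp (- 1 / t)\<close>\<close>

definition flat :: "real poly \<Rightarrow> real \<Rightarrow> real" where
  "flat q t = (if t > 0 then poly q (1 / t) * exp (- (1 / t)) else 0)"

lemma poly_exp_tendsto_0: "((\<lambda>s. poly q s * exp (- s)) \<longlongrightarrow> 0) (at_top :: real filter)"
proof -
  have "((\<lambda>s::real. coeff q i * (s ^ i / exp s)) \<longlongrightarrow> coeff q i * 0) at_top" for i
    by (intro tendsto_intros tendsto_power_div_exp_0)
  then have "((\<lambda>s::real. \<Sum>i\<le>degree q. coeff q i * (s ^ i / exp s)) \<longlongrightarrow> (\<Sum>i\<le>degree q. 0)) at_top"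
    by (intro tendsto_sum) simp
  then show ?thesis
    by (simp add: poly_altdef sum_distrib_right exp_minus divide_inverse mult.assoc)
qed

lemma flat_at_right_0: "(flat q \<longlongrightarrow> 0) (at_right 0)"
proof -
  have "((\<lambda>t. poly q (inverse t) * exp (- inverse t)) \<longlongrightarrow> 0) (at_right 0)"
    by (rule filterlim_compose[OF poly_exp_tendsto_0 filterlim_inverse_at_top_right])
  then show ?thesis
    by (rule Lim_transform_eventually)
      (auto simp: flat_def eventually_at_right_field field_simps intro!: exI[of _ 1])
qed

text \<open>With \<open>s = 1 / t\<close>, the derivative of \<open>q(s) exp(-s)\<close> is
  \<open>s^2 (q(s) - q'(s)) exp(-s)\<close>, which has the same shape with another polynomial. The
  factor \<open>q\<close> in \<open>flat\<close> is there to make the family closed under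
  differentiation.\<close>

lemma flat_has_derivative:
  "(flat q has_real_derivative flat ([:0, 0, 1:] * (q - pderiv q)) t) (at t)"
proof -
  consider "t > 0" | "t < 0" | "t = 0" by linarith
  then show ?thesis
  proof cases
    case 1
    have "((\<lambda>t. poly q (1 / t) * exp (- (1 / t))) has_real_derivative
        flat ([:0, 0, 1:] * (q - pderiv q)) t) (at t)"
      using 1 by (auto intro!: derivative_eq_intros simp: flat_def field_simps power2_eq_square)
    then show ?thesis
      by (rule has_field_derivative_transform_within_open[of _ _ _ "{0<..}"]) (use 1 in \<open>auto simp: flat_def\<close>)
  next
    case 2
    have "((\<lambda>t. 0) has_real_derivative 0) (at t)" by simp
    then have "(flat q has_real_derivative 0) (at t)"
      by (rule has_field_derivative_transform_within_open[of _ _ _ "{..<0}"]) (use 2 in \<open>auto simp: flat_def\<close>)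
    then show ?thesis using 2 by (simp add: flat_def)
  next
    case 3
    \<comment> \<open>For \<open>h > 0\<close> the difference quotient at 0 is itself a member of
      the family, with polynomial \<open>[:0,1:] * q\<close>, so the known right limit
      applies.\<close>
    have "((\<lambda>h. flat q h / h) \<longlongrightarrow> 0) (at_right 0)"
      by (rule Lim_transform_eventually[OF flat_at_right_0[of "[:0,1:] * q"]])
        (auto simp: flat_def eventually_at_right_field field_simps intro!: exI[of _ 1])
    moreover have "((\<lambda>h. flat q h / h) \<longlongrightarrow> 0) (at_left 0)"
      by (rule Lim_transform_eventually[OF tendsto_const])
        (auto simp: flat_def eventually_at_left_field intro!: exI[of _ "-1"])
    ultimately have "((\<lambda>h. flat q h / h) \<longlongrightarrow> 0) (at 0)"
      by (simp add: filterlim_at_split)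
    then show ?thesis
      using 3 by (simp add: DERIV_def flat_def)
  qed
qed

text \<open>The squared norm keeps the inner function polynomial in the coordinates, hence smooth at
  the origin too.\<close>

definition bump :: "'a::euclidean_space \<Rightarrow> real" where
  "bump x = flat 1 (1 - x \<bullet> x)"

lemma bump_nonneg: "bump x \<ge> 0"
  by (simp add: bump_def flat_def)

lemma bump_eq_0: "norm x \<ge> 1 \<Longrightarrow> bump x = 0"
  using power_mono[of 1 "norm x" 2] by (simp add: bump_def flat_def not_less flip: power2_norm_eq_inner)

lemma test_fun_bump: "test_fun bump"
proof -
  have "Ck k (\<lambda>x::'a. 1 + (\<Sum>i\<in>Basis. (- 1) * ((x \<bullet> i) * (x \<bullet> i))))" for k
    by (intro Ck_add Ck_sum Ck_mult Ck_const Ck_linear bounded_linear_inner_left)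
  moreover have "1 - x \<bullet> x = 1 + (\<Sum>i\<in>Basis. (- 1) * ((x \<bullet> i) * (x \<bullet> i)))" for x :: 'a
    by (subst euclidean_inner) (simp add: sum_negf)
  ultimately have "Ck k (\<lambda>x::'a. 1 - x \<bullet> x)" for k
    by (simp only:)
  then have "smooth_fun (bump :: 'a \<Rightarrow> real)"
    unfolding smooth_fun_def bump_def[abs_def] by (intro allI Ck_compose[where H=flat, OF flat_has_derivative])
  then show ?thesis
    unfolding test_fun_iff using bump_eq_0 by (metis less_imp_le)
qed

section \<open>Convolution with test functions\<close>

text \<open>Differentiation under the integral sign: the remainder quotients tend to 0 pointwise and
  are dominated by \<open>2 * H\<close>, once from the Lipschitz bound and once from the bound on
  \<open>D\<close>. The parameter space is an arbitrary Euclidean space because the lemma serves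
  both the space variable and the scale of a mollifier.\<close>

lemma has_derivative_integral:
  fixes k :: "'b::euclidean_space \<Rightarrow> 'a \<Rightarrow> real"
  assumes "r > 0"
    and k: "\<And>s. s \<in> ball s0 r \<Longrightarrow> integrable M (k s)"
    and der: "\<And>y. ((\<lambda>s. k s y) has_derivative D y) (at s0)"
    and lip: "\<And>s y. s \<in> ball s0 r \<Longrightarrow> \<bar>k s y - k s0 y\<bar> \<le> H y * norm (s - s0)"
    and D: "\<And>v y. \<bar>D y v\<bar> \<le> H y * norm v"
    and meas: "\<And>v. (\<lambda>y. D y v) \<in> borel_measurable M"
    and H: "integrable M H"
  shows "((\<lambda>s. \<integral>y. k s y \<partial>M) has_derivative (\<lambda>v. \<integral>y. D y v \<partial>M)) (at s0)"
proof -
  have lin: "linear (D y)" for y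
    using der has_derivative_linear by blast
  have intD: "integrable M (\<lambda>y. D y v)" for v
    by (rule Bochner_Integration.integrable_bound[of _ "\<lambda>y. H y * norm v"])
      (use meas H D in \<open>auto intro!: AE_I2 order_trans[OF D] mult_right_mono\<close>)
  have bl: "bounded_linear (\<lambda>v. \<integral>y. D y v \<partial>M)"
  proof (rule bounded_linear_intro[where K="\<integral>y. H y \<partial>M"])
    show "(\<integral>y. D y (v + w) \<partial>M) = (\<integral>y. D y v \<partial>M) + (\<integral>y. D y w \<partial>M)" for v w
      by (simp add: linear_add[OF lin] intD)
    show "(\<integral>y. D y (c *\<^sub>R v) \<partial>M) = c *\<^sub>R (\<integral>y. D y v \<partial>M)" for v c
      by (simp add: linear_scale[OF lin] intD)
    show "norm (\<integral>y. D y v \<partial>M) \<le> norm v * (\<integral>y. H y \<partial>M)" for v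
    proof -
      have "norm (\<integral>y. D y v \<partial>M) \<le> (\<integral>y. H y * norm v \<partial>M)"
        by (rule order_trans[OF integral_norm_bound integral_mono]) (use intD H D in auto)
      then show ?thesis by (simp add: mult.commute)
    qed
  qed
  let ?q = "\<lambda>s y. (k s y - k s0 y - D y (s - s0)) / norm (s - s0)"
  have s0: "s0 \<in> ball s0 r" using \<open>r > 0\<close> by simp
  have q: "(\<integral>y. ?q s y \<partial>M) = ((\<integral>y. k s y \<partial>M) - (\<integral>y. k s0 y \<partial>M) - (\<integral>y. D y (s - s0) \<partial>M)) / norm (s - s0)"
    if "s \<in> ball s0 r" for s
    using k[OF that] k[OF s0] intD by simp
  have "((\<lambda>s. \<integral>y. ?q s y \<partial>M) \<longlongrightarrow> 0) (at s0)"
    unfolding tendsto_at_iff_sequentially comp_def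
  proof (intro allI impI)
    fix X :: "nat \<Rightarrow> 'b"
    assume X: "\<forall>i. X i \<in> UNIV - {s0}" "X \<longlonglongrightarrow> s0"
    have "\<forall>\<^sub>F n in sequentially. X n \<in> ball s0 r"
      by (rule topological_tendstoD[OF X(2) open_ball s0])
    then obtain N where N: "\<And>n. n \<ge> N \<Longrightarrow> X n \<in> ball s0 r"
      unfolding eventually_sequentially by blast
    \<comment> \<open>Dropping the first \<open>N\<close> terms keeps every point of the sequence in
      the ball where integrability and the Lipschitz bound are available; the shift is undone at the
      end.\<close>
    have "(\<lambda>n. \<integral>y. ?q (X (n + N)) y \<partial>M) \<longlonglongrightarrow> (\<integral>y. 0 \<partial>M)"
    proof (rule integral_dominated_convergence[where w="\<lambda>y. 2 * H y"])
      fix n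
      have b: "X (n + N) \<in> ball s0 r" using N by simp
      show "?q (X (n + N)) \<in> borel_measurable M"
        using borel_measurable_integrable[OF k[OF b]] borel_measurable_integrable[OF k[OF s0]] meas by measurable
      have "norm (?q (X (n + N)) y) \<le> 2 * H y" for y
      proof -
        have "\<bar>k (X (n + N)) y - k s0 y - D y (X (n + N) - s0)\<bar> \<le> 2 * H y * norm (X (n + N) - s0)"
          using lip[OF b, of y] D[of y "X (n + N) - s0"] by linarith
        moreover have "norm (X (n + N) - s0) > 0" using X by simp
        ultimately show ?thesis by (simp add: divide_le_eq)
      qed
      then show "AE y in M. norm (?q (X (n + N)) y) \<le> 2 * H y" by simp
    next
      have "(\<lambda>n. ?q (X (n + N)) y) \<longlonglongrightarrow> 0" for y
      proof -
        have "((\<lambda>s. ?q s y) \<longlongrightarrow> 0) (at s0)"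
          using der[of y] unfolding has_derivative_at_within
          by (auto simp: divide_inverse mult.commute diff_diff_eq)
        then have "((\<lambda>s. ?q s y) \<longlongrightarrow> 0) (at s0)" by simp
        moreover have "filterlim (\<lambda>n. X (n + N)) (at s0) sequentially"
          using X LIMSEQ_ignore_initial_segment[OF X(2), of N] by (auto simp: filterlim_at)
        ultimately show ?thesis
          by (rule filterlim_compose)
      qed
      then show "AE y in M. (\<lambda>n. ?q (X (n + N)) y) \<longlonglongrightarrow> 0" by simp
    qed (use H in auto)
    then show "(\<lambda>n. \<integral>y. ?q (X n) y \<partial>M) \<longlonglongrightarrow> 0"
      by (simp only: integral_zero) (rule LIMSEQ_offset)
  qed
  then have "((\<lambda>s. ((\<integral>y. k s y \<partial>M) - (\<integral>y. k s0 y \<partial>M) - (\<integral>y. D y (s - s0) \<partial>M)) / norm (s - s0)) \<longlongrightarrow> 0) (at s0)"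
    by (rule Lim_transform_within_open[OF _ open_ball s0]) (use q in auto)
  then show ?thesis
    unfolding has_derivative_at_within using bl
    by (auto simp: divide_inverse mult.commute diff_diff_eq)
qed

section \<open>Locally integrable functions\<close>

lemma Lp_loc_measurable: "Lp_loc p f \<Longrightarrow> f \<in> borel_measurable borel"
  by (simp add: Lp_loc_def)

text \<open>Centred balls exhaust all compact sets, and for exponent 1 integrability of the norm is
  integrability of the function.\<close>

lemma Lp_loc_1_iff:
  "Lp_loc 1 f \<longleftrightarrow> f \<in> borel_measurable borel \<and> (\<forall>R. integrable lborel (\<lambda>x. indicator (cball 0 R) x *\<^sub>R f x))"
proof -
  have *: "set_integrable lborel K (\<lambda>x. norm (f x) powr 1) \<longleftrightarrow> set_integrable lborel K f"
    if "f \<in> borel_measurable borel" "K \<in> sets borel" for K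
    using integrable_norm_iff[of "\<lambda>x. indicator K x *\<^sub>R f x" lborel] that
    by (simp add: set_integrable_def mult.commute)
  show ?thesis
  proof (intro iffI conjI allI)
    fix R assume "Lp_loc 1 f"
    then show "integrable lborel (\<lambda>x. indicator (cball 0 R) x *\<^sub>R f x)"
      using *[of "cball 0 R"] by (auto simp: Lp_loc_def set_integrable_def)
  next
    assume f: "f \<in> borel_measurable borel \<and> (\<forall>R. integrable lborel (\<lambda>x. indicator (cball 0 R) x *\<^sub>R f x))"
    have "set_integrable lborel K f" if "compact K" for K
    proof -
      have "bounded K" by (rule compact_imp_bounded[OF that])
      then obtain R where "K \<subseteq> cball 0 R"
        unfolding bounded_iff by (auto simp: subset_iff)
      then show ?thesis
        using set_integrable_subset[of lborel "cball 0 R" f K] f that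
        by (auto simp: set_integrable_def borel_compact)
    qed
    then show "Lp_loc 1 f"
      using f * by (auto simp: Lp_loc_def borel_compact)
  qed (auto simp: Lp_loc_def)
qed

lemma Lp_loc_1_integrable:
  "Lp_loc 1 f \<Longrightarrow> integrable lborel (\<lambda>x. indicator (cball 0 R) x *\<^sub>R f x)"
  by (simp add: Lp_loc_1_iff)

lemma integrable_Lp_loc_1: "integrable lborel f \<Longrightarrow> Lp_loc 1 f"
  unfolding Lp_loc_1_iff by (auto intro!: integrable_mult_indicator)

lemma integrable_dominated_Lp_loc:
  fixes X :: "'a::euclidean_space \<Rightarrow> 'c::euclidean_space"
  assumes f: "Lp_loc 1 f" and [measurable]: "X \<in> borel_measurable borel"
    and bound: "AE x in lborel. norm x \<le> R \<longrightarrow> norm (X x) \<le> M * norm (f x)"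
    and zero: "AE x in lborel. norm x > R \<longrightarrow> X x = 0"
  shows "integrable lborel X"
proof (rule Bochner_Integration.integrable_bound)
  show "integrable lborel (\<lambda>x. M * norm (indicator (cball 0 R) x *\<^sub>R f x))"
    by (intro integrable_mult_right integrable_norm Lp_loc_1_integrable[OF f])
  show "AE x in lborel. norm (X x) \<le> norm (M * norm (indicator (cball 0 R) x *\<^sub>R f x))"
    using bound zero
  proof eventually_elim
    case (elim x)
    then show ?case by (cases "norm x \<le> R") auto
  qed
qed simp

lemma Lp_loc_1_scaleR:
  assumes f: "Lp_loc 1 f" and [measurable]: "w \<in> borel_measurable borel"
    and bound: "\<And>R. \<exists>M. AE x in lborel. norm x \<le> R \<longrightarrow> \<bar>w x\<bar> \<le> M"
  shows "Lp_loc 1 (\<lambda>x. w x *\<^sub>R f x)"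
  unfolding Lp_loc_1_iff
proof (intro conjI allI)
  have [measurable]: "f \<in> borel_measurable borel" by (rule Lp_loc_measurable[OF f])
  show "(\<lambda>x. w x *\<^sub>R f x) \<in> borel_measurable borel" by measurable
  fix R
  obtain M where M: "AE x in lborel. norm x \<le> R \<longrightarrow> \<bar>w x\<bar> \<le> M" using bound by blast
  show "integrable lborel (\<lambda>x. indicator (cball 0 R) x *\<^sub>R (w x *\<^sub>R f x))"
  proof (rule integrable_dominated_Lp_loc[OF f, where R=R and M=M])
    show "(\<lambda>x. indicator (cball 0 R) x *\<^sub>R (w x *\<^sub>R f x)) \<in> borel_measurable borel"
      using borel_closed[OF closed_cball, of 0 R] by measurable
  qed (use M in \<open>auto elim!: eventually_mono intro!: mult_right_mono\<close>)
qed

lemma test_fun_measurable: "test_fun k \<Longrightarrow> k \<in> borel_measurable borel"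
  using smooth_continuous borel_measurable_continuous_onI unfolding test_fun_def by blast

lemma integrable_test_fun_scaleR:
  assumes "Lp_loc 1 f" "test_fun k"
  shows "integrable lborel (\<lambda>x. k x *\<^sub>R f x)"
proof -
  obtain R M where R: "\<And>x. norm x > R \<Longrightarrow> k x = 0" "\<And>x. \<bar>k x\<bar> \<le> M"
    by (rule test_fun_bounds[OF assms(2)]) (rule that)
  have [measurable]: "f \<in> borel_measurable borel" by (rule Lp_loc_measurable[OF assms(1)])
  have [measurable]: "k \<in> borel_measurable borel" by (rule test_fun_measurable[OF assms(2)])
  show ?thesis
    by (rule integrable_dominated_Lp_loc[OF assms(1), where R=R and M=M])
      (use R in \<open>auto intro!: mult_right_mono\<close>)
qed

text \<open>Values in any Euclidean space are allowed, so that one operator mollifies the potential,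
  its gradient field and the square of the norm of that field.\<close>

definition conv :: "('a::euclidean_space \<Rightarrow> real) \<Rightarrow> ('a \<Rightarrow> 'b::euclidean_space) \<Rightarrow> 'a \<Rightarrow> 'b" where
  "conv k h x = (\<integral>y. k (x - y) *\<^sub>R h y \<partial>lborel)"

lemma test_fun_reflect: "test_fun k \<Longrightarrow> test_fun (\<lambda>y. k (x - y))"
  using test_fun_affine[of k "-1" x] by simp

lemma conv_integrable:
  "test_fun k \<Longrightarrow> Lp_loc 1 h \<Longrightarrow> integrable lborel (\<lambda>y. k (x - y) *\<^sub>R h y)"
  by (simp add: integrable_test_fun_scaleR test_fun_reflect)

lemma conv_has_derivative:
  fixes h :: "'a::euclidean_space \<Rightarrow> real"
  assumes k: "test_fun k" and h: "Lp_loc 1 h"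
  shows "(conv k h has_derivative (\<lambda>v. conv (\<lambda>z. frechet_derivative k (at z) v) h x)) (at x)"
proof -
  obtain R M where R: "R > 0" "M \<ge> 0" "\<And>x. norm x > R \<Longrightarrow> k x = 0" "\<And>x. norm x > R \<Longrightarrow> grad k x = 0"
    "\<And>x. \<bar>k x\<bar> \<le> M" "\<And>x. norm (grad k x) \<le> M"
    using test_fun_bounds[OF k] by blast
  have sk: "smooth_fun k" using k by (simp add: test_fun_def)
  note Dk = smooth_grad_inner[OF sk, symmetric]
  \<comment> \<open>For \<open>s\<close> within distance 1 of \<open>x\<close>, the kernel at
    \<open>s - y\<close> vanishes unless \<open>y\<close> lies in this ball; there the gradient
    bound \<open>M\<close> is a Lipschitz constant for the kernel.\<close>
  let ?H = "\<lambda>y. M * (indicator (cball 0 (norm x + 1 + R)) y *\<^sub>R \<bar>h y\<bar>)"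
  have [measurable]: "h \<in> borel_measurable borel" by (rule Lp_loc_measurable[OF h])
  have bd: "R < norm (s - y)" if "norm x + 1 + R < norm y" "norm (s - x) < 1" for s y
    using that norm_triangle_ineq4[of s "s - y"] norm_triangle_ineq[of "s - x" x] by simp
  have D: "((\<lambda>s. \<integral>y. k (s - y) *\<^sub>R h y \<partial>lborel) has_derivative
     (\<lambda>v. \<integral>y. frechet_derivative k (at (x - y)) v *\<^sub>R h y \<partial>lborel)) (at x)"
  proof (rule has_derivative_integral[where r=1 and H="?H"])
    show "integrable lborel ?H"
      using integrable_norm[OF Lp_loc_1_integrable[OF h]] by (simp add: abs_mult)
    show "integrable lborel (\<lambda>y. k (s - y) *\<^sub>R h y)" for s
      by (rule conv_integrable[OF k h])
    show "((\<lambda>s. k (s - y) *\<^sub>R h y) has_derivative (\<lambda>v. frechet_derivative k (at (x - y)) v *\<^sub>R h y)) (at x)" for y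
    proof -
      have "((\<lambda>s. k (s - y)) has_derivative (\<lambda>v. frechet_derivative k (at (x - y)) v)) (at x)"
        by (rule has_derivative_compose[OF _ smooth_has_derivative[OF sk]])
          (auto intro!: derivative_eq_intros)
      then show ?thesis
        by (rule has_derivative_scaleR_left)
    qed
    show "\<bar>k (s - y) *\<^sub>R h y - k (x - y) *\<^sub>R h y\<bar> \<le> ?H y * norm (s - x)" if "s \<in> ball x 1" for s y
    proof (cases "norm y \<le> norm x + 1 + R")
      case True
      have "\<bar>k (s - y) - k (x - y)\<bar> \<le> M * norm (s - x)"
        using smooth_fun_lipschitz[OF sk R(6), of "s - y" "x - y"] by simp
      then have "\<bar>k (s - y) - k (x - y)\<bar> * \<bar>h y\<bar> \<le> M * norm (s - x) * \<bar>h y\<bar>"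
        by (rule mult_right_mono) simp
      moreover have "\<bar>k (s - y) *\<^sub>R h y - k (x - y) *\<^sub>R h y\<bar> = \<bar>k (s - y) - k (x - y)\<bar> * \<bar>h y\<bar>"
        by (simp add: abs_mult flip: left_diff_distrib)
      ultimately show ?thesis
        using True by (simp add: mult_ac)
    next
      case False
      then have "k (s - y) = 0" "k (x - y) = 0"
        using that by (auto simp: dist_norm norm_minus_commute intro!: R(3) bd)
      then show ?thesis using R by simp
    qed
    show "\<bar>frechet_derivative k (at (x - y)) v *\<^sub>R h y\<bar> \<le> ?H y * norm v" for v y
    proof (cases "norm y \<le> norm x + 1 + R")
      case True
      have "\<bar>grad k (x - y) \<bullet> v\<bar> \<le> M * norm v"
        by (rule order_trans[OF Cauchy_Schwarz_ineq2]) (simp add: mult_right_mono R)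
      then have "\<bar>grad k (x - y) \<bullet> v\<bar> * \<bar>h y\<bar> \<le> M * norm v * \<bar>h y\<bar>"
        by (rule mult_right_mono) simp
      then show ?thesis
        using True by (simp add: abs_mult mult_ac Dk)
    next
      case False
      then have "grad k (x - y) = 0"
        by (intro R(4) bd) auto
      then show ?thesis using R by (simp add: Dk)
    qed
    show "(\<lambda>y. frechet_derivative k (at (x - y)) v *\<^sub>R h y) \<in> borel_measurable lborel" for v
      using test_fun_measurable[OF test_fun_reflect[OF test_fun_frechet_derivative[OF k]]] by measurable
  qed simp
  have eq: "conv k h = (\<lambda>s. \<integral>y. k (s - y) *\<^sub>R h y \<partial>lborel)" for k
    by (rule ext) (rule conv_def)
  show ?thesis
    unfolding eq by (rule D)
qed

text \<open>The derivative of a convolution is the convolution with the derivative of the kernel,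
  again a test function. The induction therefore generalises over the kernel while \<open>h\<close>
  stays fixed.\<close>

lemma conv_smooth:
  fixes h :: "'a::euclidean_space \<Rightarrow> real"
  assumes k: "test_fun k" and h: "Lp_loc 1 h"
  shows "smooth_fun (conv k h)"
proof -
  have "Ck n (conv k h)" for n
    using k
  proof (induction n arbitrary: k)
    case 0
    show ?case
      using has_derivative_continuous[OF conv_has_derivative[OF 0 h]]
      by (simp add: continuous_at_imp_continuous_on)
  next
    case (Suc n)
    show ?case
      by (rule Ck_SucI[OF conv_has_derivative[OF Suc.prems h]])
        (intro Suc.IH test_fun_frechet_derivative Suc.prems)
  qed
  then show ?thesis by (simp add: smooth_fun_def)
qed

lemma inner_integral_right: "integrable M f \<Longrightarrow> (\<integral>y. f y \<bullet> i \<partial>M) = (\<integral>y. f y \<partial>M) \<bullet> i"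
  by simp

text \<open>The reflected kernel \<open>y \<mapsto> k (x - y)\<close> is admissible in the
  definition of the weak gradient, and the sign from the reflection cancels the sign from
  integration by parts.\<close>

lemma grad_conv:
  assumes k: "test_fun k" and w: "weak_grad \<Phi> g"
  shows "grad (conv k \<Phi>) x = conv k g x"
proof (rule euclidean_eqI)
  fix i :: 'a assume i: "i \<in> Basis"
  have L: "Lp_loc 1 \<Phi>" "Lp_loc 1 g"
    and wk: "\<And>f. test_fun f \<Longrightarrow>
        (\<integral>x. \<Phi> x * pderiv_dir i f x \<partial>lborel) = - (\<integral>x. (g x \<bullet> i) * f x \<partial>lborel)"
    using w i by (auto simp: weak_grad_def)
  have sk: "smooth_fun k" using k by (simp add: test_fun_def)
  have *: "pderiv_dir i (\<lambda>y. k (x - y)) y = - frechet_derivative k (at (x - y)) i" for y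
  proof -
    have "((\<lambda>y. k (x - y)) has_derivative (\<lambda>v. frechet_derivative k (at (x - y)) (- v))) (at y)"
      by (rule has_derivative_compose[OF _ smooth_has_derivative[OF sk]])
        (auto intro!: derivative_eq_intros)
    from frechet_derivative_at[OF this, symmetric] show ?thesis
      unfolding pderiv_dir_def by (simp flip: smooth_grad_inner[OF sk])
  qed
  have "grad (conv k \<Phi>) x \<bullet> i = conv (\<lambda>z. frechet_derivative k (at z) i) \<Phi> x"
    unfolding smooth_grad_inner[OF conv_smooth[OF k L(1)]]
      frechet_derivative_at[OF conv_has_derivative[OF k L(1)], symmetric] ..
  also have "\<dots> = - (\<integral>y. \<Phi> y * pderiv_dir i (\<lambda>y. k (x - y)) y \<partial>lborel)"
    by (simp add: conv_def * mult.commute)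
  also have "\<dots> = (\<integral>y. (g y \<bullet> i) * k (x - y) \<partial>lborel)"
    using wk[OF test_fun_reflect[OF k]] by simp
  also have "\<dots> = (\<integral>y. (k (x - y) *\<^sub>R g y) \<bullet> i \<partial>lborel)"
    by (simp add: mult.commute)
  also have "\<dots> = conv k g x \<bullet> i"
    unfolding conv_def by (rule inner_integral_right[OF conv_integrable[OF k L(2)]])
  finally show "grad (conv k \<Phi>) x \<bullet> i = conv k g x \<bullet> i" .
qed

section \<open>Mollifiers\<close>

lemma bump_measurable [measurable]: "bump \<in> borel_measurable borel"
  by (rule test_fun_measurable[OF test_fun_bump])

lemma nn_integral_affine:
  fixes t :: "'a::euclidean_space"
  assumes [measurable]: "f \<in> borel_measurable borel" and "c \<noteq> 0"
  shows "(\<integral>\<^sup>+x. f x \<partial>lborel) = ennreal (\<bar>c\<bar> ^ DIM('a)) * (\<integral>\<^sup>+x. f (t + c *\<^sub>R x) \<partial>lborel)"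
  by (subst lborel_affine[OF \<open>c \<noteq> 0\<close>, of t])
    (simp add: nn_integral_density nn_integral_distr nn_integral_cmult ennreal_power[symmetric])

lemma nn_integral_reflect:
  fixes x :: "'a::euclidean_space"
  assumes "f \<in> borel_measurable borel"
  shows "(\<integral>\<^sup>+y. f (x - y) \<partial>lborel) = (\<integral>\<^sup>+y. f y \<partial>lborel)"
  using nn_integral_affine[OF assms, of "-1" x] by simp

lemma nn_integral_translate:
  fixes x :: "'a::euclidean_space"
  assumes "f \<in> borel_measurable borel"
  shows "(\<integral>\<^sup>+y. f (y - x) \<partial>lborel) = (\<integral>\<^sup>+y. f y \<partial>lborel)"
  using nn_integral_affine[OF assms, of 1 "-x"] by simp

lemma integrable_indicator_cball: "integrable lborel (indicator (cball c R) :: 'a::euclidean_space \<Rightarrow> real)"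
  by (auto intro!: integrable_real_indicator emeasure_lborel_cball_finite[simplified])

lemma integrable_test_fun: "test_fun k \<Longrightarrow> integrable lborel k"
proof -
  assume k: "test_fun k"
  have "Lp_loc 1 (\<lambda>x. 1::real)"
    unfolding Lp_loc_1_iff
    by (auto simp: integrable_indicator_cball)
  from integrable_test_fun_scaleR[OF this k] show ?thesis by simp
qed

lemma bump_pos: "norm x < 1 \<Longrightarrow> bump x > 0"
proof -
  assume "norm x < 1"
  then have "(norm x)\<^sup>2 < 1\<^sup>2" by (intro power_strict_mono) auto
  then show ?thesis by (simp add: bump_def flat_def flip: power2_norm_eq_inner)
qed

text \<open>The normalising constant depends on the space alone; the \<open>itself\<close> argument
  makes that space explicit.\<close>

definition bump_mass :: "'a::euclidean_space itself \<Rightarrow> real" where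
  "bump_mass _ = (\<integral>x. bump (x :: 'a) \<partial>lborel)"

lemma bump_mass_pos: "bump_mass TYPE('a::euclidean_space) > 0"
proof -
  have "\<not> (AE x::'a in lborel. bump x = 0)"
  proof
    assume "AE x::'a in lborel. bump x = 0"
    then have "AE x::'a in lborel. x \<notin> ball 0 1"
      by eventually_elim (use bump_pos in \<open>auto simp: less_le\<close>)
    then have "measure lborel (ball (0::'a) 1) = 0"
      by (subst (asm) AE_iff_measurable[OF _ refl]) (auto simp: measure_def ball_def)
    then show False
      using content_ball_pos[of 1 "0::'a"] by simp
  qed
  then show ?thesis
    using integral_nonneg_eq_0_iff_AE[OF integrable_test_fun[OF test_fun_bump[where 'a='a]]] bump_nonneg
      integral_nonneg_AE[of "bump :: 'a \<Rightarrow> real" lborel]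
    by (auto simp: bump_mass_def less_le)
qed

text \<open>The scale is a continuous parameter because Morrey's estimate differentiates with
  respect to it.\<close>

definition mollifier :: "real \<Rightarrow> 'a::euclidean_space \<Rightarrow> real" where
  "mollifier t z = bump (z /\<^sub>R t) / (t ^ DIM('a) * bump_mass TYPE('a))"

lemma mollifier_nonneg: "t > 0 \<Longrightarrow> mollifier t z \<ge> 0"
  using bump_mass_pos[where 'a='a] by (simp add: mollifier_def bump_nonneg less_imp_le)

lemma mollifier_eq_0: "t > 0 \<Longrightarrow> norm z \<ge> t \<Longrightarrow> mollifier t z = 0"
  by (simp add: mollifier_def bump_eq_0 field_simps)

lemma test_fun_mollifier: "t > 0 \<Longrightarrow> test_fun (mollifier t :: 'a::euclidean_space \<Rightarrow> real)"
proof -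
  assume t: "t > 0"
  have "test_fun (\<lambda>z::'a. bump (0 + inverse t *\<^sub>R z) * (1 / (t ^ DIM('a) * bump_mass TYPE('a))))"
    using t by (intro test_fun_mult_smooth test_fun_affine test_fun_bump) (auto simp: smooth_fun_def)
  then show ?thesis
    by (simp add: mollifier_def[abs_def])
qed

lemma nn_integral_mollifier: "t > 0 \<Longrightarrow> (\<integral>\<^sup>+z. ennreal (mollifier t (z :: 'a::euclidean_space)) \<partial>lborel) = 1"
proof -
  assume t: "t > 0"
  have meas: "(\<lambda>z::'a. ennreal (mollifier t z)) \<in> borel_measurable borel"
    using test_fun_measurable[OF test_fun_mollifier[OF t]] by measurable
  have m: "bump_mass TYPE('a) > 0" by (rule bump_mass_pos)
  have "(\<integral>\<^sup>+z. ennreal (mollifier t (z :: 'a)) \<partial>lborel)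
      = ennreal (t ^ DIM('a)) * (\<integral>\<^sup>+x. ennreal (mollifier t (t *\<^sub>R x :: 'a)) \<partial>lborel)"
    using nn_integral_affine[OF meas, of t 0] t by simp
  also have "\<dots> = ennreal (t ^ DIM('a)) * (\<integral>\<^sup>+x. ennreal (1 / (t ^ DIM('a) * bump_mass TYPE('a))) * ennreal (bump (x :: 'a)) \<partial>lborel)"
    using t m by (simp add: mollifier_def ennreal_mult'[symmetric])
  also have "(\<integral>\<^sup>+x. ennreal (1 / (t ^ DIM('a) * bump_mass TYPE('a))) * ennreal (bump (x :: 'a)) \<partial>lborel)
     = ennreal (1 / (t ^ DIM('a) * bump_mass TYPE('a))) * ennreal (bump_mass TYPE('a))"
    by (subst nn_integral_cmult)
      (auto simp: bump_mass_def bump_nonneg nn_integral_eq_integral integrable_test_fun test_fun_bump)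
  finally show ?thesis
    using t m by (simp add: ennreal_mult'[symmetric] field_simps)
qed

lemma integrable_reflect:
  fixes f :: "'a::euclidean_space \<Rightarrow> real"
  shows "test_fun f \<Longrightarrow> integrable lborel (\<lambda>y. f (x - y))"
  by (simp add: integrable_test_fun test_fun_reflect)

lemma integral_mollifier_reflect:
  assumes "t > 0" shows "(\<integral>y. mollifier t (x - y :: 'a::euclidean_space) \<partial>lborel) = 1"
proof -
  have tf: "test_fun (mollifier t :: 'a \<Rightarrow> real)" by (rule test_fun_mollifier[OF assms])
  have [measurable]: "mollifier t \<in> borel_measurable (borel :: 'a measure)"
    by (rule test_fun_measurable[OF tf])
  have "ennreal (\<integral>y. mollifier t (x - y) \<partial>lborel) = (\<integral>\<^sup>+y. ennreal (mollifier t (x - y)) \<partial>lborel)"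
    by (subst nn_integral_eq_integral) (auto simp: integrable_reflect tf assms mollifier_nonneg)
  also have "\<dots> = 1"
    using nn_integral_reflect[of "\<lambda>z. ennreal (mollifier t z)" x] nn_integral_mollifier[OF assms, where 'a='a]
    by simp
  finally show ?thesis by simp
qed

lemma conv_measurable:
  fixes h :: "'a::euclidean_space \<Rightarrow> 'b::euclidean_space"
  assumes [measurable]: "k \<in> borel_measurable borel" "h \<in> borel_measurable borel"
  shows "conv k h \<in> borel_measurable borel"
proof -
  have "conv k h \<in> borel_measurable lborel"
    unfolding conv_def[abs_def] by (rule lborel.borel_measurable_lebesgue_integral) simp
  then show ?thesis by simp
qed

lemma conv_diff:
  assumes "test_fun k" "Lp_loc 1 f" "Lp_loc 1 g"
  shows "conv k (\<lambda>x. f x - g x) x = conv k f x - conv k g x"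
  unfolding conv_def scaleR_diff_right by (intro Bochner_Integration.integral_diff conv_integrable assms)

text \<open>Young's inequality for a kernel of mass 1: after exchanging the order of integration,
  the kernel is integrated out first.\<close>

lemma conv_mollifier_L1:
  fixes h :: "'a::euclidean_space \<Rightarrow> 'b::euclidean_space"
  assumes t: "t > 0" and h: "integrable lborel h"
  shows "integrable lborel (conv (mollifier t) h)"
    and "(\<integral>x. norm (conv (mollifier t) h x) \<partial>lborel) \<le> (\<integral>x. norm (h x) \<partial>lborel)"
proof -
  let ?k = "mollifier t :: 'a \<Rightarrow> real"
  have tf: "test_fun ?k" by (rule test_fun_mollifier[OF t])
  have [measurable]: "?k \<in> borel_measurable borel" "h \<in> borel_measurable borel"
    using test_fun_measurable[OF tf] borel_measurable_integrable[OF h] by auto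
  note [measurable] = conv_measurable[of ?k h]
  have "(\<integral>\<^sup>+x. norm (conv ?k h x) \<partial>lborel) \<le> (\<integral>\<^sup>+x. \<integral>\<^sup>+y. ennreal (?k (x - y)) * norm (h y) \<partial>lborel \<partial>lborel)"
  proof (rule nn_integral_mono)
    fix x
    have "ennreal (norm (conv ?k h x)) \<le> (\<integral>\<^sup>+y. norm (?k (x - y) *\<^sub>R h y) \<partial>lborel)"
      unfolding conv_def by (rule integral_norm_bound_ennreal[OF conv_integrable[OF tf integrable_Lp_loc_1[OF h]]])
    then show "ennreal (norm (conv ?k h x)) \<le> (\<integral>\<^sup>+y. ennreal (?k (x - y)) * norm (h y) \<partial>lborel)"
      by (simp add: mollifier_nonneg t ennreal_mult')
  qed
  also have "\<dots> = (\<integral>\<^sup>+y. \<integral>\<^sup>+x. ennreal (?k (x - y)) * norm (h y) \<partial>lborel \<partial>lborel)"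
    by (rule lborel_pair.Fubini') measurable
  also have "\<dots> = (\<integral>\<^sup>+y. norm (h y) \<partial>lborel)"
    by (subst nn_integral_multc)
      (auto simp: nn_integral_mollifier[OF t] nn_integral_translate[where f="\<lambda>z. ennreal (?k z)"])
  finally have le: "(\<integral>\<^sup>+x. norm (conv ?k h x) \<partial>lborel) \<le> (\<integral>\<^sup>+y. norm (h y) \<partial>lborel)" .
  show i: "integrable lborel (conv ?k h)"
    using le_less_trans[OF le] h by (auto simp: integrable_iff_bounded)
  show "(\<integral>x. norm (conv ?k h x) \<partial>lborel) \<le> (\<integral>x. norm (h x) \<partial>lborel)"
    using le by (simp add: nn_integral_eq_integral integrable_norm i h)
qed

text \<open>The mollification is a mean with total weight 1 of values within \<open>e\<close> of
  \<open>c\<close>. For \<open>c = 0\<close> and \<open>e = 0\<close> this also locates the support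
  of a mollification.\<close>

lemma norm_conv_mollifier_diff_le:
  fixes h :: "'a::euclidean_space \<Rightarrow> 'b::euclidean_space"
  assumes t: "t > 0" and h: "Lp_loc 1 h"
    and e: "\<And>y. norm (x - y) < t \<Longrightarrow> norm (h y - c) \<le> e"
  shows "norm (conv (mollifier t) h x - c) \<le> e"
proof -
  let ?k = "mollifier t :: 'a \<Rightarrow> real"
  have tf: "test_fun ?k" by (rule test_fun_mollifier[OF t])
  note I = conv_integrable[OF tf h, of x] integrable_reflect[OF tf, of x]
  have "conv ?k h x - c = (\<integral>y. ?k (x - y) *\<^sub>R h y \<partial>lborel) - (\<integral>y. ?k (x - y) *\<^sub>R c \<partial>lborel)"
    using I by (simp add: conv_def integral_mollifier_reflect[OF t])
  also have "\<dots> = (\<integral>y. ?k (x - y) *\<^sub>R h y - ?k (x - y) *\<^sub>R c \<partial>lborel)"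
    by (rule Bochner_Integration.integral_diff[symmetric]) (use I in auto)
  also have "norm \<dots> \<le> (\<integral>y. norm (?k (x - y) *\<^sub>R h y - ?k (x - y) *\<^sub>R c) \<partial>lborel)"
    by (rule integral_norm_bound)
  also have "\<dots> \<le> (\<integral>y. ?k (x - y) * e \<partial>lborel)"
  proof (rule integral_mono)
    show "norm (?k (x - y) *\<^sub>R h y - ?k (x - y) *\<^sub>R c) \<le> ?k (x - y) * e" for y
      using e[of y] mollifier_eq_0[OF t, of "x - y"] mollifier_nonneg[OF t, of "x - y"]
      by (cases "norm (x - y) < t") (auto simp flip: scaleR_diff_right intro!: mult_left_mono)
  qed (use I in auto)
  also have "\<dots> = e"
    using I by (simp add: integral_mollifier_reflect[OF t])
  finally show ?thesis .
qed

text \<open>Density of compactly supported continuous functions in L1, by the induction principle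
  for integrable functions. Its core is the indicator of a set of finite measure: enclose the set in
  an open set of nearly the same measure and approximate the indicator of the latter by continuous
  cut-offs.\<close>

lemma integrable_approx_continuous:
  fixes f :: "'a::euclidean_space \<Rightarrow> 'b::euclidean_space"
  assumes "integrable lborel f" and "e > 0"
  shows "\<exists>g R. continuous_on UNIV g \<and> (\<forall>x. norm x > R \<longrightarrow> g x = 0) \<and> integrable lborel g \<and>
           (\<integral>x. norm (f x - g x) \<partial>lborel) < e"
  using assms
proof (induction arbitrary: e rule: integrable_induct)
  case (base A c)
  then have A: "A \<in> sets borel" "emeasure lborel A < \<infinity>" by auto
  \<comment> \<open>The final error is at most \<open>d * (norm c + 1) = e / 2\<close>; the summand
    1 avoids division by zero when \<open>c = 0\<close>.\<close>
  define d where "d = e / (2 * (norm c + 1))"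
  have d: "d > 0" using base by (simp add: d_def add_nonneg_pos)
  obtain U where U: "open U" "A \<subseteq> U" "emeasure lborel (U - A) < ennreal d"
    using outer_regular_lborel[OF A(1) d] by blast
  have [measurable]: "A \<in> sets borel" "U \<in> sets borel" using A U by auto
  have fU: "emeasure lborel U < \<infinity>"
  proof -
    have "emeasure lborel U \<le> emeasure lborel A + emeasure lborel (U - A)"
      using U(2) by (subst plus_emeasure) (auto simp: Un_absorb1 Un_Diff_cancel)
    also have "\<dots> < \<infinity>" using A(2) U(3) by (simp add: less_top ennreal_add_eq_top) (metis ennreal_less_top order.strict_trans less_irrefl top.not_eq_extremum)
    finally show ?thesis .
  qed
  \<comment> \<open>The distance to the empty set is 0 by convention, which would make the cut-offs
    below vanish for \<open>U = UNIV\<close>. Finite measure excludes this case.\<close>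
  then have ne: "- U \<noteq> {}" by (metis Compl_empty_eq double_compl emeasure_lborel_UNIV less_irrefl infinity_ennreal_def)
  have cl: "closed (- U)" using U(1) by (rule closed_Compl)
  \<comment> \<open>The first factor tends to the indicator of \<open>U\<close> from inside; the
    second truncates at radius \<open>k\<close>, so that the function vanishes outside a ball
    although \<open>U\<close> may be unbounded.\<close>
  define g :: "nat \<Rightarrow> 'a \<Rightarrow> real" where
    "g k x = min 1 (real k * infdist x (- U)) * max 0 (min 1 (real k - norm x))" for k x
  have g_cont: "continuous_on UNIV (g k)" for k
    unfolding g_def by (intro continuous_intros continuous_on_infdist)
  have g_le: "\<bar>g k x\<bar> \<le> indicator U x" for k x
  proof (cases "x \<in> U")
    case True
    have "min 1 (real k * infdist x (- U)) * max 0 (min 1 (real k - norm x)) \<le> 1 * 1"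
      by (intro mult_mono) (auto simp: infdist_nonneg)
    moreover have "g k x \<ge> 0" by (simp add: g_def infdist_nonneg)
    ultimately show ?thesis using True by (simp add: g_def)
  next
    case False
    then show ?thesis by (simp add: g_def)
  qed
  have g_lim: "(\<lambda>k. g k x) \<longlonglongrightarrow> indicator U x" for x
  proof (cases "x \<in> U")
    case True
    then have i: "infdist x (- U) > 0"
      using in_closed_iff_infdist_zero[OF cl ne, of x] infdist_nonneg[of x "- U"] by (auto simp: less_le)
    obtain N where N: "real N \<ge> norm x + 1" "real N \<ge> 1 / infdist x (- U)"
      using real_arch_simple[of "max (norm x + 1) (1 / infdist x (- U))"] by auto
    have "g k x = 1" if "k \<ge> N" for k
    proof -
      have "real k \<ge> real N" using that by simp
      then have "real k \<ge> norm x + 1" "real k \<ge> 1 / infdist x (- U)" using N by linarith+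
      then show ?thesis using i by (simp add: g_def divide_le_eq)
    qed
    then have "\<forall>\<^sub>F k in sequentially. g k x = 1" by (auto simp: eventually_sequentially)
    then show ?thesis using True by (simp add: tendsto_eventually)
  next
    case False
    then show ?thesis by (simp add: g_def)
  qed
  have gm [measurable]: "g k \<in> borel_measurable borel" for k
    by (rule borel_measurable_continuous_onI[OF g_cont])
  have iU: "integrable lborel (indicator U :: 'a \<Rightarrow> real)" using fU by simp
  have iA: "integrable lborel (indicator A :: 'a \<Rightarrow> real)" using A by simp
  have ig: "integrable lborel (g k)" for k
    by (rule Bochner_Integration.integrable_bound[OF iU]) (use g_le in auto)
  have "(\<lambda>k. \<integral>x. \<bar>indicator A x - g k x\<bar> \<partial>lborel) \<longlonglongrightarrow> (\<integral>x. \<bar>indicator A x - indicator U x\<bar> \<partial>lborel)"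
  proof (rule integral_dominated_convergence[where w="\<lambda>x. 2 * indicator U x"])
    show "AE x in lborel. (\<lambda>k. \<bar>indicator A x - g k x\<bar>) \<longlonglongrightarrow> \<bar>indicator A x - indicator U x\<bar>"
      using g_lim by (auto intro!: AE_I2 tendsto_intros)
    show "AE x in lborel. norm \<bar>indicator A x - g k x\<bar> \<le> 2 * indicator U x" for k
    proof (rule AE_I2)
      fix x
      have "indicator A x \<le> (indicator U x :: real)" "0 \<le> (indicator A x :: real)"
        using U(2) by (auto simp: indicator_def)
      then show "norm \<bar>indicator A x - g k x\<bar> \<le> 2 * indicator U x"
        using g_le[of k x] unfolding real_norm_def by linarith
    qed
  qed (use iU in auto)
  moreover have "(\<integral>x. \<bar>indicator A x - indicator U x\<bar> \<partial>lborel) = measure lborel (U - A)"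
  proof -
    have "\<bar>indicator A x - indicator U x\<bar> = (indicator (U - A) x :: real)" for x
      using U(2) by (auto simp: indicator_def)
    then show ?thesis by simp
  qed
  moreover have "measure lborel (U - A) < d"
  proof -
    have "emeasure lborel (U - A) \<noteq> top" using U(3) less_trans ennreal_less_top by auto
    then have "ennreal (measure lborel (U - A)) < ennreal d"
      using U(3) by (simp add: emeasure_eq_ennreal_measure)
    then show ?thesis by (simp add: ennreal_less_iff)
  qed
  ultimately have "\<forall>\<^sub>F k in sequentially. (\<integral>x. \<bar>indicator A x - g k x\<bar> \<partial>lborel) < d"
    using order_tendstoD(2) by fastforce
  then obtain k where k: "(\<integral>x. \<bar>indicator A x - g k x\<bar> \<partial>lborel) < d"
    by (auto simp: eventually_sequentially)
  have "(\<integral>x. norm (indicator A x *\<^sub>R c - g k x *\<^sub>R c) \<partial>lborel) = (\<integral>x. \<bar>indicator A x - g k x\<bar> * norm c \<partial>lborel)"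
    by (simp flip: scaleR_diff_left)
  also have "\<dots> = (\<integral>x. \<bar>indicator A x - g k x\<bar> \<partial>lborel) * norm c"
    using iA ig by simp
  also have "\<dots> \<le> d * norm c" using k by (intro mult_right_mono) auto
  also have "\<dots> \<le> d * (norm c + 1)" using d by simp
  also have "\<dots> = e / 2" using norm_ge_zero[of c] by (simp add: d_def field_simps add_nonneg_eq_0_iff)
  also have "\<dots> < e" using base by simp
  finally have "(\<integral>x. norm (indicator A x *\<^sub>R c - g k x *\<^sub>R c) \<partial>lborel) < e" .
  moreover have "g k x *\<^sub>R c = 0" if "norm x > real k" for x using that by (simp add: g_def)
  ultimately show ?case
    using g_cont[of k] ig[of k]
    by (intro exI[of _ "\<lambda>x. g k x *\<^sub>R c"] exI[of _ "real k"]) (auto intro!: continuous_intros)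
next
  case (add f1 f2)
  have "e / 2 > 0" using add.prems by simp
  obtain g1 R1 where g1: "continuous_on UNIV g1" "\<And>x. norm x > R1 \<Longrightarrow> g1 x = 0" "integrable lborel g1"
      "(\<integral>x. norm (f1 x - g1 x) \<partial>lborel) < e / 2"
    using add.IH(1)[OF \<open>e / 2 > 0\<close>] by blast
  obtain g2 R2 where g2: "continuous_on UNIV g2" "\<And>x. norm x > R2 \<Longrightarrow> g2 x = 0" "integrable lborel g2"
      "(\<integral>x. norm (f2 x - g2 x) \<partial>lborel) < e / 2"
    using add.IH(2)[OF \<open>e / 2 > 0\<close>] by blast
  have "(\<integral>x. norm (f1 x + f2 x - (g1 x + g2 x)) \<partial>lborel) \<le> (\<integral>x. norm (f1 x - g1 x) + norm (f2 x - g2 x) \<partial>lborel)"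
    using add.hyps g1 g2 by (intro integral_mono) (auto simp: add_diff_add norm_triangle_ineq)
  also have "\<dots> < e"
    using add.hyps g1 g2 by simp
  finally show ?case
    using g1 g2 by (intro exI[of _ "\<lambda>x. g1 x + g2 x"] exI[of _ "max R1 R2"]) (auto intro!: continuous_intros)
next
  case (lim f s)
  have "(\<lambda>i. \<integral>x. norm (f x - s i x) \<partial>lborel) \<longlonglongrightarrow> (\<integral>x. 0 \<partial>(lborel :: 'a measure))"
  \<comment> \<open>The approximating sequence of the induction principle satisfies
    \<open>norm (s i x) \<le> 2 * norm (f x)\<close>; adding \<open>norm (f x)\<close> gives the
    factor 3.\<close>
  proof (rule integral_dominated_convergence[where w="\<lambda>x. 3 * norm (f x)"])
    have "(\<lambda>i. norm (f x - s i x)) \<longlonglongrightarrow> norm (f x - f x)" for x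
      using lim.hyps(2)[of x] by (intro tendsto_intros) simp
    then show "AE x in lborel. (\<lambda>i. norm (f x - s i x)) \<longlonglongrightarrow> 0" by simp
    show "AE x in lborel. norm (norm (f x - s i x)) \<le> 3 * norm (f x)" for i
    proof (rule AE_I2)
      fix x
      have "norm (f x - s i x) \<le> norm (f x) + norm (s i x)" by (rule norm_triangle_ineq4)
      then show "norm (norm (f x - s i x)) \<le> 3 * norm (f x)"
        using lim.hyps(3)[of x i] by simp
    qed
  qed (use lim.hyps in auto)
  then have "\<forall>\<^sub>F i in sequentially. (\<integral>x. norm (f x - s i x) \<partial>lborel) < e / 2"
    using order_tendstoD(2)[of _ 0 sequentially "e / 2"] lim.prems by simp
  then obtain i where i: "(\<integral>x. norm (f x - s i x) \<partial>lborel) < e / 2"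
    by (auto simp: eventually_sequentially)
  have "e / 2 > 0" using lim.prems by simp
  obtain g R where g: "continuous_on UNIV g" "\<And>x. norm x > R \<Longrightarrow> g x = 0" "integrable lborel g"
      "(\<integral>x. norm (s i x - g x) \<partial>lborel) < e / 2"
    using lim.IH[OF \<open>e / 2 > 0\<close>, of i] by blast
  have "(\<integral>x. norm (f x - g x) \<partial>lborel) \<le> (\<integral>x. norm (f x - s i x) + norm (s i x - g x) \<partial>lborel)"
  proof (rule integral_mono)
    show "norm (f x - g x) \<le> norm (f x - s i x) + norm (s i x - g x)" for x
      using norm_triangle_ineq[of "f x - s i x" "s i x - g x"] by simp
  qed (use lim.hyps g in auto)
  also have "\<dots> < e"
    using lim.hyps g i by simp
  finally show ?case
    using g by (intro exI[of _ g] exI[of _ R]) auto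
qed

section \<open>Convergence of mollifications\<close>

lemma uniformly_continuous_vanishing:
  fixes g :: "'a::euclidean_space \<Rightarrow> 'b::real_normed_vector"
  assumes g: "continuous_on UNIV g" "\<And>x. norm x > R \<Longrightarrow> g x = 0" and "e > 0"
  obtains d where "d > 0" "\<And>x y. norm (x - y) < d \<Longrightarrow> norm (g x - g y) \<le> e"
proof -
  have "uniformly_continuous_on (cball 0 (R + 2)) g"
    by (intro compact_uniformly_continuous continuous_on_subset[OF g(1)]) auto
  then obtain d where d: "d > 0"
    "\<And>x y. norm x \<le> R + 2 \<Longrightarrow> norm y \<le> R + 2 \<Longrightarrow> dist y x < d \<Longrightarrow> dist (g y) (g x) < e"
    unfolding uniformly_continuous_on_def using \<open>e > 0\<close> by (metis mem_cball_0)
  show ?thesis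
  \<comment> \<open>Two points at distance below 1 either both lie in the ball of radius
    \<open>R + 2\<close>, where uniform continuity holds, or both lie outside radius
    \<open>R\<close>, where \<open>g\<close> vanishes.\<close>
  proof (rule that[of "min d 1"])
    fix x y :: 'a assume xy: "norm (x - y) < min d 1"
    show "norm (g x - g y) \<le> e"
    proof (cases "norm x \<le> R + 2 \<and> norm y \<le> R + 2")
      case True
      then show ?thesis using d(2)[of y x] xy by (simp add: dist_norm less_imp_le)
    next
      case False
      then have "norm x > R" "norm y > R"
        using xy norm_triangle_ineq3[of x y] by auto
      then show ?thesis using g(2) \<open>e > 0\<close> by simp
    qed
  qed (use d in auto)
qed

text \<open>All scales are at most 1, so mollification never looks further than distance 1. This is
  the origin of the radii \<open>R + 1\<close> below.\<close>

definition unit_seq :: "nat \<Rightarrow> real" where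
  "unit_seq n = inverse (real (Suc n))"

lemma unit_seq: "unit_seq n > 0" "unit_seq n \<le> 1"
  by (auto simp: unit_seq_def inverse_le_1_iff)

lemma unit_seq_tendsto: "unit_seq \<longlonglongrightarrow> 0"
  unfolding unit_seq_def using LIMSEQ_inverse_real_of_nat .

abbreviation moll :: "nat \<Rightarrow> 'a::euclidean_space \<Rightarrow> real" where
  "moll n \<equiv> mollifier (unit_seq n)"

lemma test_fun_moll: "test_fun (moll n)"
  by (rule test_fun_mollifier[OF unit_seq(1)])

lemma moll_measurable [measurable]: "moll n \<in> borel_measurable borel"
  by (rule test_fun_measurable[OF test_fun_moll])

text \<open>Mollification contracts the L1 norm, so by density it is enough to treat a continuous
  function vanishing outside a ball. There uniform continuity gives a uniform error on a slightly
  larger ball and none outside it.\<close>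

lemma conv_moll_tendsto_L1:
  fixes h :: "'a::euclidean_space \<Rightarrow> 'b::euclidean_space"
  assumes h: "integrable lborel h"
  shows "(\<lambda>n. \<integral>x. norm (conv (moll n) h x - h x) \<partial>lborel) \<longlonglongrightarrow> 0"
proof (rule LIMSEQ_I)
  fix e :: real assume "e > 0"
  then have e3: "e / 3 > 0" by simp
  obtain g R where g: "continuous_on UNIV g" "\<And>x. norm x > R \<Longrightarrow> g x = 0" "integrable lborel g"
      "(\<integral>x. norm (h x - g x) \<partial>lborel) < e / 3"
    using integrable_approx_continuous[OF h e3] by blast
  define V where "V = measure lborel (cball (0::'a) (R + 1))"
  \<comment> \<open>A uniform error \<open>e'\<close> on a ball of volume \<open>V\<close>
    contributes \<open>V * e'\<close>, which is below \<open>e / 3\<close>.\<close>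
  define e' where "e' = e / (3 * (V + 1))"
  have V: "V \<ge> 0" by (simp add: V_def)
  have e': "e' > 0" using \<open>e > 0\<close> V by (simp add: e'_def)
  obtain d where d: "d > 0" "\<And>x y. norm (x - y) < d \<Longrightarrow> norm (g x - g y) \<le> e'"
    using uniformly_continuous_vanishing[OF g(1,2) e'] by blast
  obtain N where N: "\<And>n. n \<ge> N \<Longrightarrow> unit_seq n < d"
    using order_tendstoD(2)[OF unit_seq_tendsto d(1)] by (auto simp: eventually_sequentially)
  note Lg = integrable_Lp_loc_1[OF g(3)] and Lh = integrable_Lp_loc_1[OF h]
  show "\<exists>N. \<forall>n\<ge>N. norm ((\<integral>x. norm (conv (moll n) h x - h x) \<partial>lborel) - 0) < e"
  proof (intro exI[of _ N] allI impI)
    fix n assume "n \<ge> N"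
    let ?k = "moll n :: 'a \<Rightarrow> real"
    have tf: "test_fun ?k" by (rule test_fun_moll)
    have cg: "norm (conv ?k g x - g x) \<le> indicator (cball 0 (R + 1)) x * e'" for x
    proof (cases "norm x \<le> R + 1")
      case True
      have "norm (conv ?k g x - g x) \<le> e'"
        by (rule norm_conv_mollifier_diff_le[OF unit_seq(1) Lg])
          (use d(2) N[OF \<open>n \<ge> N\<close>] in \<open>force simp: norm_minus_commute\<close>)
      then show ?thesis using True by simp
    next
      case False
      have "norm (conv ?k g x - 0) \<le> 0"
      proof (rule norm_conv_mollifier_diff_le[OF unit_seq(1) Lg])
        fix y assume "norm (x - y) < unit_seq n"
        then have "norm y > R"
          using unit_seq(2)[of n] False norm_triangle_ineq2[of x y] by linarith
        then show "norm (g y - 0) \<le> 0" using g(2) by simp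
      qed
      then show ?thesis using False g(2)[of x] by simp
    qed
    note I = conv_mollifier_L1(1)[OF unit_seq(1) h, of n] conv_mollifier_L1(1)[OF unit_seq(1) g(3), of n]
    have fin: "integrable lborel (indicator (cball (0::'a) (R + 1)) :: 'a \<Rightarrow> real)"
      by (rule integrable_indicator_cball)
    have "(\<integral>x. norm (conv ?k g x - g x) \<partial>lborel) \<le> (\<integral>x. indicator (cball (0::'a) (R + 1)) x * e' \<partial>lborel)"
      by (rule integral_mono) (use cg I g fin in auto)
    also have "\<dots> = V * e'" using fin by (simp add: V_def)
    also have "\<dots> < e / 3" using V \<open>e > 0\<close> by (simp add: e'_def field_simps)
    finally have 1: "(\<integral>x. norm (conv ?k g x - g x) \<partial>lborel) < e / 3" .
    have hg: "integrable lborel (\<lambda>x. h x - g x)" using h g by simp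
    have 2: "(\<integral>x. norm (conv ?k h x - conv ?k g x) \<partial>lborel) < e / 3"
      using conv_mollifier_L1(2)[OF unit_seq(1) hg, of n] g(4) by (simp add: conv_diff[OF tf Lh Lg])
    have "(\<integral>x. norm (conv ?k h x - h x) \<partial>lborel) \<le>
       (\<integral>x. norm (conv ?k h x - conv ?k g x) + norm (conv ?k g x - g x) + norm (h x - g x) \<partial>lborel)"
    proof (rule integral_mono)
      fix x
      have eq: "conv ?k h x - h x = (conv ?k h x - conv ?k g x) + (conv ?k g x - g x) - (h x - g x)" by simp
      show "norm (conv ?k h x - h x) \<le>
          norm (conv ?k h x - conv ?k g x) + norm (conv ?k g x - g x) + norm (h x - g x)"
        by (subst eq) (rule order_trans[OF norm_triangle_ineq4 add_right_mono[OF norm_triangle_ineq]])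
    qed (use I h g in auto)
    also have "\<dots> = (\<integral>x. norm (conv ?k h x - conv ?k g x) \<partial>lborel) + (\<integral>x. norm (conv ?k g x - g x) \<partial>lborel)
        + (\<integral>x. norm (h x - g x) \<partial>lborel)"
      using I h g by simp
    also have "\<dots> < e" using 1 2 g(4) by simp
    finally show "norm ((\<integral>x. norm (conv ?k h x - h x) \<partial>lborel) - 0) < e"
      by (simp add: integral_nonneg_AE)
  qed
qed

lemma conv_mollifier_cong:
  assumes "t > 0" "\<And>y. norm (x - y) < t \<Longrightarrow> h y = h' y"
  shows "conv (mollifier t) h x = conv (mollifier t) h' x"
  unfolding conv_def
proof (rule Bochner_Integration.integral_cong[OF refl])
  show "mollifier t (x - y) *\<^sub>R h y = mollifier t (x - y) *\<^sub>R h' y" for y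
    using mollifier_eq_0[OF assms(1), of "x - y"] assms(2)[of y] by (cases "norm (x - y) < t") auto
qed

text \<open>On the ball of radius \<open>R\<close> the mollification sees \<open>h\<close> only
  within radius \<open>R + 1\<close>, so \<open>h\<close> may be cut off there and the global
  statement applies.\<close>

lemma conv_moll_tendsto_L1_loc:
  fixes h :: "'a::euclidean_space \<Rightarrow> 'b::euclidean_space"
  assumes h: "Lp_loc 1 h"
  shows "integrable lborel (\<lambda>x. indicator (cball 0 R) x * norm (conv (moll n) h x - h x))" (is "integrable _ (?f n)")
    and "(\<lambda>n. \<integral>x. indicator (cball 0 R) x * norm (conv (moll n) h x - h x) \<partial>lborel) \<longlonglongrightarrow> 0"
proof -
  let ?h = "\<lambda>x. indicator (cball 0 (R + 1)) x *\<^sub>R h x"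
  have [measurable]: "h \<in> borel_measurable borel" by (rule Lp_loc_measurable[OF h])
  have ih: "integrable lborel ?h" by (rule Lp_loc_1_integrable[OF h])
  have eq: "?f n x = indicator (cball 0 R) x * norm (conv (moll n) ?h x - ?h x)" for n x
  proof (cases "norm x \<le> R")
    case True
    have "conv (moll n) h x = conv (moll n) ?h x"
    proof (rule conv_mollifier_cong[OF unit_seq(1)])
      fix y assume "norm (x - y) < unit_seq n"
      then have "norm y \<le> R + 1"
        using unit_seq(2)[of n] True norm_triangle_ineq2[of y x] by (simp add: norm_minus_commute)
      then show "h y = ?h y" by simp
    qed
    then show ?thesis using True by simp
  qed simp
  have I: "integrable lborel (\<lambda>x. norm (conv (moll n) ?h x - ?h x))" for n
    using conv_mollifier_L1(1)[OF unit_seq(1) ih] ih by simp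
  have I2: "integrable lborel (\<lambda>x. indicator (cball 0 R) x * norm (conv (moll n) ?h x - ?h x))" for n
    using integrable_mult_indicator[OF _ I, of "cball 0 R"] by simp
  then show "integrable lborel (?f n)" for n unfolding eq .
  show "(\<lambda>n. \<integral>x. ?f n x \<partial>lborel) \<longlonglongrightarrow> 0"
    unfolding eq
  proof (rule tendsto_sandwich[OF _ _ tendsto_const conv_moll_tendsto_L1[OF ih]]; intro always_eventually allI)
    show "0 \<le> (\<integral>x. indicator (cball 0 R) x * norm (conv (moll n) ?h x - ?h x) \<partial>lborel)" for n
      by (rule integral_nonneg_AE) simp
    show "(\<integral>x. indicator (cball 0 R) x * norm (conv (moll n) ?h x - ?h x) \<partial>lborel)
        \<le> (\<integral>x. norm (conv (moll n) ?h x - ?h x) \<partial>lborel)" for n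
      by (rule integral_mono[OF I2 I]) (auto simp: indicator_def)
  qed
qed

lemma AE_all_balls:
  assumes "\<And>n::nat. AE x in lborel. norm (x :: 'a::euclidean_space) \<le> real n \<longrightarrow> P x"
  shows "AE x in lborel. P x"
proof -
  have "AE x in lborel. \<forall>n::nat. norm x \<le> real n \<longrightarrow> P x"
    by (intro AE_all_countable[THEN iffD2] allI assms)
  then show ?thesis
    by eventually_elim (metis real_arch_simple)
qed

text \<open>The reflected mollifier is a test function, so every mollification of \<open>h\<close>
  vanishes identically. As they converge to \<open>h\<close> in L1 on every ball, \<open>h\<close>
  is zero almost everywhere.\<close>

lemma fundamental_lemma:
  fixes h :: "'a::euclidean_space \<Rightarrow> real"
  assumes h: "Lp_loc 1 h" and z: "\<And>f. test_fun f \<Longrightarrow> (\<integral>x. h x * f x \<partial>lborel) = 0"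
  shows "AE x in lborel. h x = 0"
proof (rule AE_all_balls)
  fix m :: nat
  have "conv (moll n) h x = 0" for n x
    using z[OF test_fun_reflect[OF test_fun_moll[of n], of x]] by (simp add: conv_def mult.commute)
  then have I: "integrable lborel (\<lambda>x. indicator (cball 0 (real m)) x * \<bar>h x\<bar>)"
    and "(\<lambda>n::nat. \<integral>x. indicator (cball 0 (real m)) x * \<bar>h x\<bar> \<partial>lborel) \<longlonglongrightarrow> 0"
    using conv_moll_tendsto_L1_loc[OF h, of "real m"] by auto
  then have "(\<integral>x. indicator (cball 0 (real m)) x * \<bar>h x\<bar> \<partial>lborel) = 0"
    by (simp add: LIMSEQ_const_iff)
  then have "AE x in lborel. indicator (cball 0 (real m)) x * \<bar>h x\<bar> = 0"
    by (subst (asm) integral_nonneg_eq_0_iff_AE[OF I]) auto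
  then show "AE x in lborel. norm x \<le> real m \<longrightarrow> h x = 0"
    by eventually_elim (auto simp: indicator_def)
qed

text \<open>Dominated convergence with majorants that depend on \<open>n\<close> and converge in L1.
  It suffices to control the integral of \<open>|X n - Y|\<close>, which is at most
  \<open>D n + E\<close>, hence at most \<open>2 * E + |D n - E|\<close>.\<close>

lemma integral_tendsto_dominated_L1:
  fixes X :: "nat \<Rightarrow> 'a \<Rightarrow> real"
  assumes [measurable]: "\<And>n. X n \<in> borel_measurable M" "Y \<in> borel_measurable M"
    and lim: "AE x in M. (\<lambda>n. X n x) \<longlonglongrightarrow> Y x"
    and bound: "\<And>n. AE x in M. \<bar>X n x\<bar> \<le> D n x" "AE x in M. \<bar>Y x\<bar> \<le> E x"
    and D: "\<And>n. integrable M (D n)" and E: "integrable M E"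
    and DE: "(\<lambda>n. \<integral>x. \<bar>D n x - E x\<bar> \<partial>M) \<longlonglongrightarrow> 0"
  shows "(\<lambda>n. \<integral>x. X n x \<partial>M) \<longlonglongrightarrow> (\<integral>x. Y x \<partial>M)"
proof -
  have [measurable]: "E \<in> borel_measurable M" using E by auto
  have iX: "integrable M (X n)" for n
    by (rule Bochner_Integration.integrable_bound[OF D[of n]]) (use bound(1)[of n] in auto)
  have iY: "integrable M Y"
    by (rule Bochner_Integration.integrable_bound[OF E]) (use bound(2) in auto)
  \<comment> \<open>The truncated difference has the fixed majorant \<open>2 * E\<close>, so
    ordinary dominated convergence handles it; whatever the truncation removes is at most
    \<open>|D n - E|\<close>.\<close>
  let ?m = "\<lambda>n x. min \<bar>X n x - Y x\<bar> (2 * E x)"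
  have lim_m: "(\<lambda>n. \<integral>x. ?m n x \<partial>M) \<longlonglongrightarrow> (\<integral>x. 0 \<partial>M)"
  proof (rule integral_dominated_convergence[where w="\<lambda>x. 2 * E x"])
    show "AE x in M. (\<lambda>n. ?m n x) \<longlonglongrightarrow> 0"
      using lim bound(2)
    proof eventually_elim
      case (elim x)
      then have "E x \<ge> 0" by linarith
      have "(\<lambda>n. ?m n x) \<longlonglongrightarrow> min \<bar>Y x - Y x\<bar> (2 * E x)"
        by (intro tendsto_intros elim)
      then show ?case using \<open>E x \<ge> 0\<close> by simp
    qed
    show "AE x in M. norm (?m n x) \<le> 2 * E x" for n
      using bound(2) by eventually_elim auto
  qed (use E in auto)
  have im: "integrable M (?m n)" for n
    by (rule Bochner_Integration.integrable_bound[of _ "\<lambda>x. 2 * E x"]) (use E bound(2) in \<open>auto elim!: eventually_mono\<close>)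
  have "\<bar>(\<integral>x. X n x \<partial>M) - (\<integral>x. Y x \<partial>M)\<bar> \<le> (\<integral>x. ?m n x \<partial>M) + (\<integral>x. \<bar>D n x - E x\<bar> \<partial>M)" for n
  proof -
    have "\<bar>(\<integral>x. X n x \<partial>M) - (\<integral>x. Y x \<partial>M)\<bar> = \<bar>\<integral>x. X n x - Y x \<partial>M\<bar>"
      using iX iY by simp
    also have "\<dots> \<le> (\<integral>x. \<bar>X n x - Y x\<bar> \<partial>M)"
      by (rule integral_abs_bound)
    also have "\<dots> \<le> (\<integral>x. ?m n x + \<bar>D n x - E x\<bar> \<partial>M)"
    proof (rule integral_mono_AE)
      show "AE x in M. \<bar>X n x - Y x\<bar> \<le> ?m n x + \<bar>D n x - E x\<bar>"
        using bound(1)[of n] bound(2) by eventually_elim (simp add: min_def; linarith)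
    qed (use iX iY im D E in auto)
    also have "\<dots> = (\<integral>x. ?m n x \<partial>M) + (\<integral>x. \<bar>D n x - E x\<bar> \<partial>M)"
      using im D E by simp
    finally show ?thesis .
  qed
  then have le: "\<forall>\<^sub>F n in sequentially. norm ((\<integral>x. X n x \<partial>M) - (\<integral>x. Y x \<partial>M))
      \<le> (\<integral>x. ?m n x \<partial>M) + (\<integral>x. \<bar>D n x - E x\<bar> \<partial>M)"
    by (intro always_eventually allI) (simp only: real_norm_def)
  have "(\<lambda>n. (\<integral>x. ?m n x \<partial>M) + (\<integral>x. \<bar>D n x - E x\<bar> \<partial>M)) \<longlonglongrightarrow> 0"
    using tendsto_add[OF lim_m DE] by simp
  then have "(\<lambda>n. (\<integral>x. X n x \<partial>M) - (\<integral>x. Y x \<partial>M)) \<longlonglongrightarrow> 0"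
    by (rule Lim_null_comparison[OF le])
  then show ?thesis by (rule LIM_zero_cancel)
qed

section \<open>Calculus of the local Lp classes\<close>

lemma Lp_loc_iff_powr:
  "Lp_loc p f \<longleftrightarrow> f \<in> borel_measurable borel \<and> Lp_loc 1 (\<lambda>x. norm (f x) powr p)"
  by (auto simp: Lp_loc_def)

lemma Lp_loc_1_add: "Lp_loc 1 f \<Longrightarrow> Lp_loc 1 g \<Longrightarrow> Lp_loc 1 (\<lambda>x. f x + g x)"
  unfolding Lp_loc_1_iff scaleR_add_right by (auto intro: borel_measurable_add)

lemma Lp_loc_1_const: "Lp_loc 1 (\<lambda>x::'a::euclidean_space. c::'b::euclidean_space)"
proof -
  have "integrable lborel (\<lambda>x::'a. indicator (cball 0 R) x *\<^sub>R c)" for R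
    by (intro integrable_scaleR_left integrable_indicator_cball)
  then show ?thesis by (simp add: Lp_loc_1_iff)
qed

lemma Lp_loc_1_bound:
  fixes f :: "'a::euclidean_space \<Rightarrow> 'b::euclidean_space"
  assumes g: "Lp_loc 1 g" and [measurable]: "f \<in> borel_measurable borel"
    and "AE x in lborel. norm (f x) \<le> norm (g x)"
  shows "Lp_loc 1 f"
  unfolding Lp_loc_1_iff
proof (intro conjI allI)
  fix R
  show "integrable lborel (\<lambda>x. indicator (cball 0 R) x *\<^sub>R f x)"
  proof (rule integrable_dominated_Lp_loc[OF g, where R=R and M=1])
    show "(\<lambda>x. indicator (cball 0 R) x *\<^sub>R f x) \<in> borel_measurable borel"
      using borel_closed[OF closed_cball, of 0 R] by measurable
  qed (use assms(3) in \<open>auto elim!: eventually_mono\<close>)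
qed simp

text \<open>Pointwise \<open>s powr q \<le> 1 + s powr p\<close>, and constants are locally
  integrable, so Hoelder's inequality is avoided.\<close>

lemma Lp_loc_mono:
  fixes f :: "'a::euclidean_space \<Rightarrow> 'b::euclidean_space"
  assumes f: "Lp_loc p f" and "0 < q" "q \<le> p"
  shows "Lp_loc q f"
proof (subst Lp_loc_iff_powr, rule conjI)
  show m [measurable]: "f \<in> borel_measurable borel" by (rule Lp_loc_measurable[OF f])
  have 1: "Lp_loc 1 (\<lambda>x. 1 + norm (f x) powr p)"
    using f by (intro Lp_loc_1_add Lp_loc_1_const) (simp add: Lp_loc_iff_powr[of p])
  have "norm (f x) powr q \<le> 1 + norm (f x) powr p" for x
  proof (cases "norm (f x) \<le> 1")
    case True
    then have "norm (f x) powr q \<le> 1" using \<open>0 < q\<close> by (simp add: powr_le1)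
    then show ?thesis using powr_ge_zero[of "norm (f x)" p] by linarith
  next
    case False
    then have "norm (f x) powr q \<le> norm (f x) powr p" using \<open>q \<le> p\<close> by (simp add: powr_mono)
    then show ?thesis by simp
  qed
  then show "Lp_loc 1 (\<lambda>x. norm (f x) powr q)"
    by (intro Lp_loc_1_bound[OF 1]) auto
qed

lemma Lp_loc_2_iff:
  "Lp_loc 2 f \<longleftrightarrow> f \<in> borel_measurable borel \<and> Lp_loc 1 (\<lambda>x. (norm (f x))\<^sup>2)"
  by (simp add: Lp_loc_iff_powr[of 2] powr_numeral)

lemma Lp_loc_2_imp_1: "Lp_loc 2 f \<Longrightarrow> Lp_loc 1 f"
  by (rule Lp_loc_mono) auto

lemma Lp_loc_1_norm: "Lp_loc 1 f \<Longrightarrow> Lp_loc 1 (\<lambda>x. norm (f x))"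
  by (rule Lp_loc_1_bound) (auto dest: Lp_loc_measurable)

lemma Lp_loc_2_diff:
  assumes "Lp_loc 2 f" "Lp_loc 2 g"
  shows "Lp_loc 2 (\<lambda>x. f x - g x)"
proof -
  have [measurable]: "f \<in> borel_measurable borel" "g \<in> borel_measurable borel"
    using assms Lp_loc_measurable by auto
  have sq: "Lp_loc 1 (\<lambda>x. (norm (f x))\<^sup>2)" "Lp_loc 1 (\<lambda>x. (norm (g x))\<^sup>2)"
    using assms by (auto simp: Lp_loc_2_iff)
  have "(norm (f x - g x))\<^sup>2 \<le> ((norm (f x))\<^sup>2 + (norm (f x))\<^sup>2) + ((norm (g x))\<^sup>2 + (norm (g x))\<^sup>2)" for x
  proof -
    have "(norm (f x - g x))\<^sup>2 \<le> (norm (f x) + norm (g x))\<^sup>2"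
      by (intro power_mono norm_triangle_ineq4) auto
    then show ?thesis
      using sum_squares_bound[of "norm (f x)" "norm (g x)"] by (simp add: power2_sum)
  qed
  then have "Lp_loc 1 (\<lambda>x. (norm (f x - g x))\<^sup>2)"
    by (intro Lp_loc_1_bound[OF Lp_loc_1_add[OF Lp_loc_1_add[OF sq(1) sq(1)] Lp_loc_1_add[OF sq(2) sq(2)]]]) auto
  then show ?thesis by (simp add: Lp_loc_2_iff)
qed

lemma Lp_loc_2_inner:
  assumes "Lp_loc 2 f" "Lp_loc 2 g"
  shows "Lp_loc 1 (\<lambda>x. f x \<bullet> g x)"
proof -
  have [measurable]: "f \<in> borel_measurable borel" "g \<in> borel_measurable borel"
    using assms Lp_loc_measurable by auto
  have sq: "Lp_loc 1 (\<lambda>x. (norm (f x))\<^sup>2)" "Lp_loc 1 (\<lambda>x. (norm (g x))\<^sup>2)"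
    using assms by (auto simp: Lp_loc_2_iff)
  have "\<bar>f x \<bullet> g x\<bar> \<le> (norm (f x))\<^sup>2 + (norm (g x))\<^sup>2" for x
    using Cauchy_Schwarz_ineq2[of "f x" "g x"] sum_squares_bound[of "norm (f x)" "norm (g x)"]
      mult_nonneg_nonneg[OF norm_ge_zero norm_ge_zero, of "f x" "g x"] by linarith
  then show ?thesis
    by (intro Lp_loc_1_bound[OF Lp_loc_1_add[OF sq]]) auto
qed

lemma Lp_loc_2_scaleR:
  assumes f: "Lp_loc 2 f" and [measurable]: "w \<in> borel_measurable borel"
    and bound: "\<And>R. \<exists>M. AE x in lborel. norm x \<le> R \<longrightarrow> \<bar>w x\<bar> \<le> M"
  shows "Lp_loc 2 (\<lambda>x. w x *\<^sub>R f x)"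
proof -
  have [measurable]: "f \<in> borel_measurable borel" by (rule Lp_loc_measurable[OF f])
  have "Lp_loc 1 (\<lambda>x. (w x)\<^sup>2 *\<^sub>R (norm (f x))\<^sup>2)"
  proof (rule Lp_loc_1_scaleR)
    show "\<exists>M. AE x in lborel. norm x \<le> R \<longrightarrow> \<bar>(w x)\<^sup>2\<bar> \<le> M" for R
    proof -
      obtain M where "AE x in lborel. norm x \<le> R \<longrightarrow> \<bar>w x\<bar> \<le> M" using bound by blast
      then have "AE x in lborel. norm x \<le> R \<longrightarrow> \<bar>(w x)\<^sup>2\<bar> \<le> M\<^sup>2"
        by eventually_elim (metis abs_ge_zero power_abs power_mono)
      then show ?thesis by blast
    qed
  qed (use f in \<open>auto simp: Lp_loc_2_iff\<close>)
  then show ?thesis by (simp add: Lp_loc_2_iff power_mult_distrib)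
qed

section \<open>Testing divergence-free fields against exponential weights\<close>

lemma Linf_loc_bound:
  "Linf_loc \<Phi> \<Longrightarrow> \<exists>C. AE x in lborel. norm x \<le> R \<longrightarrow> \<bar>\<Phi> x\<bar> \<le> C"
  unfolding Linf_loc_def using compact_cball[of 0 R] by (metis (no_types, lifting) AE_cong mem_cball_0)

lemma Linf_locI:
  assumes "\<Phi> \<in> borel_measurable borel"
    and "\<And>R. \<exists>C. AE x in lborel. norm x \<le> R \<longrightarrow> \<bar>\<Phi> x\<bar> \<le> C"
  shows "Linf_loc \<Phi>"
  unfolding Linf_loc_def
proof (intro conjI allI impI)
  fix K :: "'a set" assume "compact K"
  then have "bounded K" by (rule compact_imp_bounded)
  then obtain R where R: "\<And>x. x \<in> K \<Longrightarrow> norm x \<le> R" unfolding bounded_iff by blast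
  obtain C where "AE x in lborel. norm x \<le> R \<longrightarrow> \<bar>\<Phi> x\<bar> \<le> C" using assms(2) by blast
  then have "AE x in lborel. x \<in> K \<longrightarrow> \<bar>\<Phi> x\<bar> \<le> C" by eventually_elim (use R in auto)
  then show "\<exists>C. AE x in lborel. x \<in> K \<longrightarrow> \<bar>\<Phi> x\<bar> \<le> C" by blast
qed (use assms in simp)

lemma Linf_loc_measurable: "Linf_loc \<Phi> \<Longrightarrow> \<Phi> \<in> borel_measurable borel"
  by (simp add: Linf_loc_def)

lemma Linf_loc_exp_bound:
  assumes "Linf_loc \<Phi>"
  shows "\<exists>C. AE x in lborel. norm x \<le> R \<longrightarrow> \<bar>exp (c * \<Phi> x)\<bar> \<le> C"
proof -
  obtain C where "AE x in lborel. norm x \<le> R \<longrightarrow> \<bar>\<Phi> x\<bar> \<le> C" using Linf_loc_bound[OF assms] by blast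
  then have "AE x in lborel. norm x \<le> R \<longrightarrow> \<bar>exp (c * \<Phi> x)\<bar> \<le> exp (\<bar>c\<bar> * C)"
  proof eventually_elim
    case (elim x)
    have "c * \<Phi> x \<le> \<bar>c\<bar> * \<bar>\<Phi> x\<bar>" by (simp flip: abs_mult)
    with elim show ?case using mult_left_mono[of "\<bar>\<Phi> x\<bar>" C "\<bar>c\<bar>"] by auto
  qed
  then show ?thesis by blast
qed

text \<open>A variant for bounds that hold only almost everywhere, as they do for a locally bounded
  potential; the conclusion is nevertheless pointwise.\<close>

lemma norm_conv_mollifier_le:
  fixes h :: "'a::euclidean_space \<Rightarrow> real"
  assumes t: "t > 0" and h: "Lp_loc 1 h"
    and bound: "AE y in lborel. norm (x - y) < t \<longrightarrow> \<bar>h y\<bar> \<le> C"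
  shows "\<bar>conv (mollifier t) h x\<bar> \<le> C"
proof -
  let ?k = "mollifier t :: 'a \<Rightarrow> real"
  have tf: "test_fun ?k" by (rule test_fun_mollifier[OF t])
  note I = conv_integrable[OF tf h, of x] integrable_reflect[OF tf, of x]
  have "\<bar>conv ?k h x\<bar> \<le> (\<integral>y. \<bar>?k (x - y) *\<^sub>R h y\<bar> \<partial>lborel)"
    unfolding conv_def by (rule integral_abs_bound)
  also have "\<dots> \<le> (\<integral>y. ?k (x - y) * C \<partial>lborel)"
  proof (rule integral_mono_AE)
    show "AE y in lborel. \<bar>?k (x - y) *\<^sub>R h y\<bar> \<le> ?k (x - y) * C"
      using bound
    proof eventually_elim
      case (elim y)
      then show ?case
        using mollifier_eq_0[OF t, of "x - y"] mollifier_nonneg[OF t, of "x - y"]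
        by (cases "norm (x - y) < t") (auto simp: abs_mult intro!: mult_left_mono)
    qed
  qed (use I in auto)
  also have "\<dots> = C" using I by (simp add: integral_mollifier_reflect[OF t])
  finally show ?thesis .
qed

text \<open>Expand \<open>0 \<le> \<integral> k(x - y) |g(y) - a|\<^sup>2 dy\<close>, where \<open>a\<close> is the mean of \<open>g\<close>.\<close>

lemma norm_conv_mollifier_square_le:
  fixes g :: "'a::euclidean_space \<Rightarrow> 'b::euclidean_space"
  assumes t: "t > 0" and g: "Lp_loc 2 g"
  shows "(norm (conv (mollifier t) g x))\<^sup>2 \<le> conv (mollifier t) (\<lambda>y. (norm (g y))\<^sup>2) x"
proof -
  let ?k = "mollifier t :: 'a \<Rightarrow> real"
  define a where "a = conv ?k g x"
  have tf: "test_fun ?k" by (rule test_fun_mollifier[OF t])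
  have L: "Lp_loc 1 g" "Lp_loc 1 (\<lambda>y. (norm (g y))\<^sup>2)"
    using Lp_loc_2_imp_1[OF g] g by (auto simp: Lp_loc_2_iff)
  note I = conv_integrable[OF tf L(1), of x] conv_integrable[OF tf L(2), of x] integrable_reflect[OF tf, of x]
  have "0 \<le> (\<integral>y. ?k (x - y) * (norm (g y - a))\<^sup>2 \<partial>lborel)"
    by (intro integral_nonneg_AE AE_I2 mult_nonneg_nonneg mollifier_nonneg t) simp
  also have "\<dots> = (\<integral>y. ?k (x - y) *\<^sub>R (norm (g y))\<^sup>2 - 2 * ((?k (x - y) *\<^sub>R g y) \<bullet> a) + ?k (x - y) * (norm a)\<^sup>2 \<partial>lborel)"
    by (intro Bochner_Integration.integral_cong refl)
      (simp add: power2_norm_eq_inner inner_diff inner_commute algebra_simps)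
  also have "\<dots> = (\<integral>y. ?k (x - y) *\<^sub>R (norm (g y))\<^sup>2 \<partial>lborel) - 2 * ((\<integral>y. ?k (x - y) *\<^sub>R g y \<partial>lborel) \<bullet> a)
      + (\<integral>y. ?k (x - y) \<partial>lborel) * (norm a)\<^sup>2"
    using I integrable_inner_left[OF I(1), of a] inner_integral_right[OF I(1), of a]
    by (simp del: inner_scaleR_left)
  also have "(\<integral>y. ?k (x - y) *\<^sub>R g y \<partial>lborel) = a"
    by (simp add: a_def conv_def)
  also have "(\<integral>y. ?k (x - y) *\<^sub>R (norm (g y))\<^sup>2 \<partial>lborel) - 2 * (a \<bullet> a) + (\<integral>y. ?k (x - y) \<partial>lborel) * (norm a)\<^sup>2
      = conv ?k (\<lambda>y. (norm (g y))\<^sup>2) x - (norm a)\<^sup>2"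
    by (simp add: conv_def integral_mollifier_reflect[OF t] power2_norm_eq_inner)
  finally show ?thesis by (simp add: a_def)
qed

lemma grad_mult_exp:
  assumes "smooth_fun f" "smooth_fun u"
  shows "grad (\<lambda>x. f x * exp (c * u x)) x = exp (c * u x) *\<^sub>R (grad f x + (c * f x) *\<^sub>R grad u x)"
proof (rule grad_eqI)
  show "((\<lambda>x. f x * exp (c * u x)) has_derivative
      (\<lambda>v. exp (c * u x) *\<^sub>R (grad f x + (c * f x) *\<^sub>R grad u x) \<bullet> v)) (at x)"
    using smooth_has_derivative_grad[OF assms(1), of x] smooth_has_derivative_grad[OF assms(2), of x]
    by (auto intro!: derivative_eq_intros simp: inner_add_left algebra_simps)
qed

lemma grad_measurable: "smooth_fun f \<Longrightarrow> grad f \<in> borel_measurable borel"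
  by (rule borel_measurable_continuous_onI[OF continuous_grad])

text \<open>The product \<open>norm b * norm w\<close> is split into a sum of squares so that
  \<open>w\<close> enters only through its square. With a mollified gradient for \<open>w\<close>,
  that square can then be replaced by the mollification of \<open>|g|^2\<close>.\<close>

lemma weighted_bound:
  fixes b v w :: "'a::real_inner"
  assumes "\<bar>s\<bar> \<le> M" "norm v \<le> M" "\<bar>u\<bar> \<le> C"
  shows "\<bar>exp (c * u) * (b \<bullet> (v + (c * s) *\<^sub>R w))\<bar>
    \<le> exp (\<bar>c\<bar> * C) * (M * (1 + \<bar>c\<bar>)) * (norm b + (norm b)\<^sup>2 + (norm w)\<^sup>2)"
proof -
  have M: "M \<ge> 0" using assms(1) by linarith
  have "c * u \<le> \<bar>c\<bar> * \<bar>u\<bar>" by (simp flip: abs_mult)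
  also have "\<dots> \<le> \<bar>c\<bar> * C" using assms(3) by (intro mult_left_mono) auto
  finally have e: "exp (c * u) \<le> exp (\<bar>c\<bar> * C)" by simp
  have bw: "norm b * norm w \<le> (norm b)\<^sup>2 + (norm w)\<^sup>2"
    using sum_squares_bound[of "norm b" "norm w"] mult_nonneg_nonneg[OF norm_ge_zero norm_ge_zero, of b w]
    by linarith
  have "norm (v + (c * s) *\<^sub>R w) \<le> norm v + \<bar>c\<bar> * \<bar>s\<bar> * norm w"
    using norm_triangle_ineq[of v "(c * s) *\<^sub>R w"] by (simp add: abs_mult)
  also have "\<dots> \<le> M + \<bar>c\<bar> * M * norm w"
    using assms by (intro add_mono mult_right_mono mult_left_mono) auto
  finally have v: "norm (v + (c * s) *\<^sub>R w) \<le> M + \<bar>c\<bar> * M * norm w" .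
  have "\<bar>b \<bullet> (v + (c * s) *\<^sub>R w)\<bar> \<le> norm b * norm (v + (c * s) *\<^sub>R w)" by (rule Cauchy_Schwarz_ineq2)
  also have "\<dots> \<le> norm b * (M + \<bar>c\<bar> * M * norm w)" using v by (rule mult_left_mono) simp
  also have "\<dots> = M * norm b + \<bar>c\<bar> * M * (norm b * norm w)" by (simp add: algebra_simps)
  also have "\<dots> \<le> M * norm b + \<bar>c\<bar> * M * ((norm b)\<^sup>2 + (norm w)\<^sup>2)"
    using bw M by (intro add_left_mono mult_left_mono) auto
  also have "\<dots> \<le> (M * (1 + \<bar>c\<bar>)) * (norm b + (norm b)\<^sup>2 + (norm w)\<^sup>2)"
    using M by (simp add: algebra_simps)
  finally have "\<bar>b \<bullet> (v + (c * s) *\<^sub>R w)\<bar> \<le> (M * (1 + \<bar>c\<bar>)) * (norm b + (norm b)\<^sup>2 + (norm w)\<^sup>2)" .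
  then show ?thesis
    using e by (simp only: abs_mult abs_exp_cancel mult.assoc) (intro mult_mono, auto)
qed

lemma div_free_weighted:
  fixes B g :: "'a::euclidean_space \<Rightarrow> 'a"
  assumes B: "div_free lborel B" "Lp_loc 2 B" and \<Phi>: "H1p_loc 2 \<Phi> g" "Linf_loc \<Phi>" and f: "test_fun f"
  shows "(\<integral>x. exp (c * \<Phi> x) * (B x \<bullet> (grad f x + (c * f x) *\<^sub>R g x)) \<partial>lborel) = 0"
proof -
  obtain R M where R: "R > 0" "M \<ge> 0" "\<And>x. norm x > R \<Longrightarrow> f x = 0" "\<And>x. norm x > R \<Longrightarrow> grad f x = 0"
    "\<And>x. \<bar>f x\<bar> \<le> M" "\<And>x. norm (grad f x) \<le> M"
    using test_fun_bounds[OF f] by blast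
  have sf: "smooth_fun f" using f by (simp add: test_fun_def)
  have w: "weak_grad \<Phi> g" and L2: "Lp_loc 2 g" using \<Phi>(1) by (auto simp: H1p_loc_def)
  have L: "Lp_loc 1 \<Phi>" "Lp_loc 1 g" "Lp_loc 1 (\<lambda>x. (norm (g x))\<^sup>2)" "Lp_loc 1 B" "Lp_loc 1 (\<lambda>x. (norm (B x))\<^sup>2)"
    using w L2 B(2) by (auto simp: weak_grad_def Lp_loc_2_iff intro: Lp_loc_2_imp_1)
  obtain C where C: "AE x in lborel. norm x \<le> R + 1 \<longrightarrow> \<bar>\<Phi> x\<bar> \<le> C"
    using Linf_loc_bound[OF \<Phi>(2)] by blast
  let ?u = "\<lambda>n. conv (moll n) \<Phi>" and ?g = "\<lambda>n. conv (moll n) g" and ?G = "\<lambda>x. (norm (g x))\<^sup>2"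
  let ?i = "indicator (cball 0 R) :: 'a \<Rightarrow> real"
  \<comment> \<open>Both errors are added so that a single subsequence gives almost everywhere
    convergence of the potentials and of the gradients.\<close>
  define E where "E n x = ?i x * norm (?u n x - \<Phi> x) + ?i x * norm (?g n x - g x)" for n x
  note conv1 = conv_moll_tendsto_L1_loc[OF L(1), of R] and conv2 = conv_moll_tendsto_L1_loc[OF L(2), of R]
    and conv3 = conv_moll_tendsto_L1_loc[OF L(3), of R]
  have iE: "integrable lborel (E n)" for n
    unfolding E_def by (intro Bochner_Integration.integrable_add conv1 conv2)
  have nE: "norm (E n x) = E n x" for n x by (simp add: E_def)
  have "(\<lambda>n. \<integral>x. norm (E n x) \<partial>lborel) \<longlonglongrightarrow> 0"
  proof -
    have "(\<lambda>n. (\<integral>x. ?i x * norm (?u n x - \<Phi> x) \<partial>lborel) + (\<integral>x. ?i x * norm (?g n x - g x) \<partial>lborel)) \<longlonglongrightarrow> 0 + 0"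
      by (intro tendsto_add conv1 conv2)
    then show ?thesis
      unfolding nE unfolding E_def by (subst Bochner_Integration.integral_add[OF conv1(1) conv2(1)]) simp
  qed
  from tendsto_L1_AE_subseq[OF iE this] obtain r where r: "strict_mono r"
    "AE x in lborel. (\<lambda>n. E (r n) x) \<longlonglongrightarrow> 0" by blast
  define K where "K = exp (\<bar>c\<bar> * C) * (M * (1 + \<bar>c\<bar>))"
  have K: "K \<ge> 0" using R by (simp add: K_def)
  let ?X = "\<lambda>u g x. exp (c * u x) * (B x \<bullet> (grad f x + (c * f x) *\<^sub>R g x))"
  \<comment> \<open>The majorant is a function of \<open>G\<close>: the mollified
    \<open>|g|^2\<close> is inserted along the sequence and \<open>|g|^2\<close> itself in the
    limit.\<close>
  let ?D = "\<lambda>G x. K * (?i x * (norm (B x) + (norm (B x))\<^sup>2 + G x))"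
  have [measurable]: "B \<in> borel_measurable borel" "g \<in> borel_measurable borel" "\<Phi> \<in> borel_measurable borel"
    "f \<in> borel_measurable borel" "grad f \<in> borel_measurable borel"
    using L Lp_loc_measurable test_fun_measurable[OF f] grad_measurable[OF sf] by auto
  have [measurable]: "?u n \<in> borel_measurable borel" "?g n \<in> borel_measurable borel" for n
    by (auto intro: conv_measurable)
  \<comment> \<open>The alternatives \<open>norm x > R\<close> are harmless because \<open>f\<close>
    and its gradient vanish there, so bounds on the potential and the gradient matter only inside
    the ball.\<close>
  have bound: "\<bar>?X u v x\<bar> \<le> ?D G x" if "\<bar>u x\<bar> \<le> C \<or> norm x > R" "(norm (v x))\<^sup>2 \<le> G x \<or> norm x > R"
    for u x and v :: "'a \<Rightarrow> 'a" and G :: "'a \<Rightarrow> real"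
  proof (cases "norm x > R")
    case True
    then show ?thesis using R by simp
  next
    case False
    have "\<bar>?X u v x\<bar> \<le> K * (norm (B x) + (norm (B x))\<^sup>2 + (norm (v x))\<^sup>2)"
      unfolding K_def by (rule weighted_bound) (use R that False in auto)
    also have "\<dots> \<le> K * (norm (B x) + (norm (B x))\<^sup>2 + G x)"
      using that False K by (intro mult_left_mono add_left_mono) auto
    finally show ?thesis using False by simp
  qed
  have u_bound: "\<bar>?u n x\<bar> \<le> C \<or> norm x > R" for n x
  proof (cases "norm x > R")
    case False
    have "\<bar>?u n x\<bar> \<le> C"
    proof (rule norm_conv_mollifier_le[OF unit_seq(1) L(1)])
      show "AE y in lborel. norm (x - y) < unit_seq n \<longrightarrow> \<bar>\<Phi> y\<bar> \<le> C"
        using C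
      proof eventually_elim
        case (elim y)
        show ?case
        proof
          assume "norm (x - y) < unit_seq n"
          then have "norm y \<le> R + 1"
            using unit_seq(2)[of n] False norm_triangle_ineq2[of y x] by (simp add: norm_minus_commute)
          then show "\<bar>\<Phi> y\<bar> \<le> C" using elim by simp
        qed
      qed
    qed
    then show ?thesis ..
  qed simp
  \<comment> \<open>For a mollified potential \<open>f * exp (c * u)\<close> is a genuine test
    function, and its gradient is exactly the field paired with \<open>B\<close> in
    \<open>?X\<close>.\<close>
  have zero: "(\<integral>x. ?X (?u n) (?g n) x \<partial>lborel) = 0" for n
  proof -
    have su: "smooth_fun (?u n)" by (rule conv_smooth[OF test_fun_moll L(1)])
    have "test_fun (\<lambda>x. f x * exp (c * ?u n x))"
      by (rule test_fun_mult_smooth[OF f smooth_exp[OF su]])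
    from B(1)[unfolded div_free_def, rule_format, OF this] show ?thesis
      by (simp add: grad_mult_exp[OF sf su] grad_conv[OF test_fun_moll w])
  qed
  have ind: "integrable lborel (\<lambda>x. ?i x * h x)" if "Lp_loc 1 h" for h :: "'a \<Rightarrow> real"
    using Lp_loc_1_integrable[OF that, of R] by simp
  have iD0: "integrable lborel (\<lambda>x. ?i x * norm (B x))" "integrable lborel (\<lambda>x. ?i x * (norm (B x))\<^sup>2)"
     "integrable lborel (\<lambda>x. ?i x * ?G x)"
    by (intro ind L Lp_loc_1_norm)+
  have iDn: "integrable lborel (\<lambda>x. ?i x * conv (moll n) ?G x)" for n
  proof (rule Bochner_Integration.integrable_bound)
    show "integrable lborel (\<lambda>x. ?i x * norm (conv (moll n) ?G x - ?G x) + ?i x * ?G x)"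
      by (intro Bochner_Integration.integrable_add conv3(1) iD0)
    show "(\<lambda>x. ?i x * conv (moll n) ?G x) \<in> borel_measurable lborel"
      using conv_measurable[of "moll n" ?G] borel_closed[OF closed_cball, of 0 R] by measurable
    have "norm (?i x * conv (moll n) ?G x) \<le> norm (?i x * norm (conv (moll n) ?G x - ?G x) + ?i x * ?G x)" for x
    proof -
      have "\<bar>s\<bar> \<le> \<bar>s - z\<bar> + z" if "z \<ge> 0" for s z :: real using that by linarith
      then show ?thesis by (auto simp: indicator_def)
    qed
    then show "AE x in lborel. norm (?i x * conv (moll n) ?G x) \<le> norm (?i x * norm (conv (moll n) ?G x - ?G x) + ?i x * ?G x)"
      by simp
  qed
  have "(\<lambda>n. \<integral>x. ?X (?u (r n)) (?g (r n)) x \<partial>lborel) \<longlonglongrightarrow> (\<integral>x. ?X \<Phi> g x \<partial>lborel)"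
  proof (rule integral_tendsto_dominated_L1[where D="\<lambda>n. ?D (conv (moll (r n)) ?G)" and E="?D ?G"])
    show "(\<lambda>x. ?X (?u (r n)) (?g (r n)) x) \<in> borel_measurable lborel" for n by measurable
    show "(\<lambda>x. ?X \<Phi> g x) \<in> borel_measurable lborel" by measurable
    show "AE x in lborel. \<bar>?X (?u (r n)) (?g (r n)) x\<bar> \<le> ?D (conv (moll (r n)) ?G) x" for n
      by (intro AE_I2 bound u_bound disjI1 norm_conv_mollifier_square_le[OF unit_seq(1) L2])
    show "AE x in lborel. \<bar>?X \<Phi> g x\<bar> \<le> ?D ?G x"
      using C by eventually_elim (rule bound, auto)
    show "integrable lborel (?D (conv (moll (r n)) ?G))" for n
      using iD0 iDn[of "r n"] by (simp add: distrib_left)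
    show "integrable lborel (?D ?G)"
      using iD0 by (simp add: distrib_left)
    show "(\<lambda>n. \<integral>x. \<bar>?D (conv (moll (r n)) ?G) x - ?D ?G x\<bar> \<partial>lborel) \<longlonglongrightarrow> 0"
    proof -
      have "\<bar>?D (conv (moll (r n)) ?G) x - ?D ?G x\<bar> = K * (?i x * norm (conv (moll (r n)) ?G x - ?G x))" for n x
        using K by (auto simp: indicator_def abs_mult simp flip: right_diff_distrib)
      moreover have "(\<lambda>n. K * (\<integral>x. ?i x * norm (conv (moll (r n)) ?G x - ?G x) \<partial>lborel)) \<longlonglongrightarrow> K * 0"
        using LIMSEQ_subseq_LIMSEQ[OF conv3(2) r(1)] by (intro tendsto_mult tendsto_const) (simp add: o_def)
      ultimately show ?thesis by simp
    qed
    show "AE x in lborel. (\<lambda>n. ?X (?u (r n)) (?g (r n)) x) \<longlonglongrightarrow> ?X \<Phi> g x"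
      using r(2)
    proof eventually_elim
      case (elim x)
      show ?case
      proof (cases "norm x > R")
        case True
        then show ?thesis using R by simp
      next
        case False
        then have e: "E n x = norm (?u n x - \<Phi> x) + norm (?g n x - g x)" for n by (simp add: E_def)
        have "(\<lambda>n. ?u (r n) x - \<Phi> x) \<longlonglongrightarrow> 0" "(\<lambda>n. ?g (r n) x - g x) \<longlonglongrightarrow> 0"
          by (rule Lim_null_comparison[OF _ elim]; simp add: e)+
        then have "(\<lambda>n. ?u (r n) x) \<longlonglongrightarrow> \<Phi> x" "(\<lambda>n. ?g (r n) x) \<longlonglongrightarrow> g x"
          by (auto dest: LIM_zero_cancel)
        then show ?thesis by (intro tendsto_intros)
      qed
    qed
  qed
  then show ?thesis by (simp add: zero LIMSEQ_const_iff)
qed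

section \<open>Local boundedness for \<open>p > d\<close>\<close>

lemma smooth_bump: "smooth_fun bump"
  using test_fun_bump unfolding test_fun_def by (rule conjunct1)

definition mollifier_dt :: "real \<Rightarrow> 'a::euclidean_space \<Rightarrow> real" where
  "mollifier_dt t w = - (grad bump (w /\<^sub>R t) \<bullet> (w /\<^sub>R t) + real DIM('a) * bump (w /\<^sub>R t))
     / (t ^ Suc DIM('a) * bump_mass TYPE('a))"

lemma mollifier_dt:
  fixes w :: "'a::euclidean_space"
  assumes t: "t > 0"
  shows "((\<lambda>t. mollifier t w) has_real_derivative mollifier_dt t w) (at t)"
proof -
  let ?z = "w /\<^sub>R t" and ?c = "bump_mass TYPE('a)" and ?d = "DIM('a)"
  have sb: "smooth_fun (bump :: 'a \<Rightarrow> real)" by (rule smooth_bump)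
  have c: "?c > 0" by (rule bump_mass_pos)
  have "((\<lambda>t. w /\<^sub>R t) has_derivative (\<lambda>h. (- h / t\<^sup>2) *\<^sub>R w)) (at t)"
    using t by (auto intro!: derivative_eq_intros simp: power2_eq_square field_simps)
  from has_derivative_compose[OF this smooth_has_derivative_grad[OF sb]]
  have "((\<lambda>t. bump (w /\<^sub>R t)) has_derivative (\<lambda>h. grad bump ?z \<bullet> ((- h / t\<^sup>2) *\<^sub>R w))) (at t)" .
  then have b: "((\<lambda>t. bump (w /\<^sub>R t)) has_real_derivative - (grad bump ?z \<bullet> ?z) / t) (at t)"
    by (rule has_derivative_imp_has_field_derivative) (use t in \<open>simp add: power2_eq_square field_simps\<close>)
  have "((\<lambda>t. bump (w /\<^sub>R t) / (t ^ ?d * ?c)) has_real_derivative mollifier_dt t w) (at t)"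
  proof (rule DERIV_cong[OF DERIV_divide[OF b DERIV_cmult_right[OF DERIV_pow]]])
    have d: "t ^ ?d = t ^ (?d - 1) * t"
      using DIM_positive[where 'a='a] by (metis power_minus_mult)
    show "t ^ ?d * ?c \<noteq> 0" using t c by simp
    show "(- (grad bump ?z \<bullet> ?z) / t * (t ^ ?d * ?c) - bump ?z * (real ?d * t ^ (?d - Suc 0) * ?c)) / (t ^ ?d * ?c * (t ^ ?d * ?c))
        = mollifier_dt t w"
      using t c unfolding mollifier_dt_def by (simp add: d divide_simps) (simp add: algebra_simps)
  qed
  then show ?thesis by (simp add: mollifier_def[abs_def])
qed

text \<open>These are the two quantities in the numerator of \<open>mollifier_dt\<close>; both are
  bounded because the bump has compact support.\<close>

lemma bump_bounds:
  obtains N where "N > 0" "\<And>z::'a::euclidean_space. bump z \<le> N" "\<And>z::'a. \<bar>grad bump z \<bullet> z\<bar> \<le> N"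
proof -
  obtain R M where M: "R > 0" "M \<ge> 0" "\<And>x::'a. norm x > R \<Longrightarrow> bump x = 0" "\<And>x::'a. norm x > R \<Longrightarrow> grad bump x = 0"
    "\<And>x::'a. \<bar>bump x\<bar> \<le> M" "\<And>x::'a. norm (grad bump x) \<le> M"
    using test_fun_bounds[OF test_fun_bump] by blast
  have 1: "\<bar>grad bump z \<bullet> z\<bar> \<le> M * R" for z :: 'a
  proof (cases "norm z \<le> R")
    case True
    have "\<bar>grad bump z \<bullet> z\<bar> \<le> norm (grad bump z) * norm z" by (rule Cauchy_Schwarz_ineq2)
    also have "\<dots> \<le> M * R" using M True by (intro mult_mono) auto
    finally show ?thesis .
  qed (use M in auto)
  have "\<bar>grad bump z \<bullet> z\<bar> \<le> M + M * R + 1" for z :: 'a using 1[of z] M(2) by linarith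
  moreover have "bump z \<le> M + M * R + 1" for z :: 'a
    using M(5)[of z] mult_nonneg_nonneg[OF M(2) less_imp_le[OF M(1)]] by linarith
  moreover have "M + M * R + 1 > 0" using M(1,2) by (simp add: add_nonneg_pos)
  ultimately show ?thesis by (intro that) auto
qed

lemma mollifier_dt_eq_0: 
  fixes w :: "'a::euclidean_space"
  assumes "t > 0" "norm w > t" shows "mollifier_dt t w = 0"
proof -
  have "norm (w /\<^sub>R t) > 1" using assms by (simp add: field_simps)
  then have "bump (w /\<^sub>R t) = 0" "grad bump (w /\<^sub>R t) = 0"
    by (auto intro!: bump_eq_0 grad_eq_0_outside[where R=1])
  then show ?thesis
    by (simp only: mollifier_dt_def) simp
qed

text \<open>The heart of the Morrey estimate: since the kernel is homogeneous under scaling, its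
  derivative in the scale is a divergence in \<open>y\<close>. Integration by parts can therefore
  move it onto the weak gradient of the potential.\<close>

lemma mollifier_dt_divergence:
  fixes x y :: "'a::euclidean_space"
  assumes t: "t > 0"
  shows "(\<Sum>i\<in>Basis. pderiv_dir i (\<lambda>y. mollifier t (x - y) * ((1 / t) * ((x - y) \<bullet> i))) y) = mollifier_dt t (x - y)"
proof -
  let ?c = "t ^ DIM('a) * bump_mass TYPE('a)" and ?z = "(x - y) /\<^sub>R t"
  have c: "?c > 0" using t bump_mass_pos[where 'a='a] by simp
  have sb: "smooth_fun (bump :: 'a \<Rightarrow> real)" by (rule smooth_bump)
  have *: "pderiv_dir i (\<lambda>y. mollifier t (x - y) * ((1 / t) * ((x - y) \<bullet> i))) y
     = - ((grad bump ?z \<bullet> i) * (?z \<bullet> i) + bump ?z) / (t * ?c)" if i: "i \<in> Basis" for i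
  proof -
    have "((\<lambda>y. (x - y) /\<^sub>R t) has_derivative (\<lambda>v. (- v) /\<^sub>R t)) (at y)"
      by (auto intro!: derivative_eq_intros)
    from has_derivative_compose[OF this smooth_has_derivative_grad[OF sb]]
    have b: "((\<lambda>y. bump ((x - y) /\<^sub>R t)) has_derivative (\<lambda>v. grad bump ?z \<bullet> ((- v) /\<^sub>R t))) (at y)" .
    have "((\<lambda>y. (q * bump ((x - y) /\<^sub>R t)) * (s * ((x - y) \<bullet> i))) has_derivative
       (\<lambda>v. (q * bump ?z) * (s * (- v \<bullet> i)) + (q * (grad bump ?z \<bullet> ((- v) /\<^sub>R t))) * (s * ((x - y) \<bullet> i)))) (at y)" for q s
      by (auto intro!: derivative_eq_intros b)
    from this[of "1 / ?c" "1 / t"]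
    have "((\<lambda>y. mollifier t (x - y) * ((1 / t) * ((x - y) \<bullet> i))) has_derivative
       (\<lambda>v. (1 / ?c * bump ?z) * ((1 / t) * (- v \<bullet> i)) + (1 / ?c * (grad bump ?z \<bullet> ((- v) /\<^sub>R t))) * ((1 / t) * ((x - y) \<bullet> i)))) (at y)"
      by (simp add: mollifier_def)
    note fd = frechet_derivative_at[OF this, symmetric]
    have zi: "?z \<bullet> i = ((x - y) \<bullet> i) * inverse t" by (simp add: mult.commute)
    have gi: "grad bump ?z \<bullet> ((- i) /\<^sub>R t) = - (inverse t * (grad bump ?z \<bullet> i))" by simp
    have ii: "- i \<bullet> i = -1" using i by simp
    have alg: "(1 / C * A) * ((1 / t) * (-1)) + (1 / C * (- (inverse t * D))) * ((1 / t) * X)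
      = - (D * (X * inverse t) + A) / (t * C)" if "C \<noteq> 0" for A D X C :: real
      using t that by (simp add: field_simps)
    show ?thesis
      unfolding pderiv_dir_def fd zi gi ii by (rule alg[OF less_imp_neq[OF c, symmetric]])
  qed
  have "(\<Sum>i\<in>Basis. pderiv_dir i (\<lambda>y. mollifier t (x - y) * ((1 / t) * ((x - y) \<bullet> i))) y)
     = (\<Sum>i\<in>Basis. - ((grad bump ?z \<bullet> i) * (?z \<bullet> i) + bump ?z) / (t * ?c))"
    by (rule sum.cong[OF refl *])
  also have "\<dots> = - (grad bump ?z \<bullet> ?z + real DIM('a) * bump ?z) / (t * ?c)"
    unfolding euclidean_inner[of "grad bump ?z" ?z]
    by (simp only: sum_divide_distrib[symmetric] sum_negf sum.distrib sum_constant)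
  also have "\<dots> = mollifier_dt t (x - y)"
    by (simp add: mollifier_dt_def mult.assoc)
  finally show ?thesis .
qed

lemma test_fun_mollifier_component:
  assumes t: "t > 0"
  shows "test_fun (\<lambda>y. mollifier t (x - y) * ((1 / t) * ((x - y) \<bullet> i)))"
proof -
  have "Ck k (\<lambda>y. (1 / t) * ((x \<bullet> i) + (-1) * (y \<bullet> i)))" for k
    by (intro Ck_mult Ck_add Ck_const Ck_linear bounded_linear_inner_left)
  then have "smooth_fun (\<lambda>y. (1 / t) * ((x - y) \<bullet> i))"
    by (simp add: smooth_fun_def inner_diff_left)
  then show ?thesis
    by (rule test_fun_mult_smooth[OF test_fun_reflect[OF test_fun_mollifier[OF t]]])
qed

lemma conv_mollifier_dt:
  fixes \<Phi> :: "'a::euclidean_space \<Rightarrow> real"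
  assumes t: "t > 0" and w: "weak_grad \<Phi> g"
  shows "((\<lambda>t. conv (mollifier t) \<Phi> x) has_real_derivative
      - (\<integral>y. mollifier t (x - y) * (g y \<bullet> ((x - y) /\<^sub>R t)) \<partial>lborel)) (at t)"
proof -
  have L: "Lp_loc 1 \<Phi>" "Lp_loc 1 g"
    and wk: "\<And>f i. test_fun f \<Longrightarrow> i \<in> Basis \<Longrightarrow>
        (\<integral>x. \<Phi> x * pderiv_dir i f x \<partial>lborel) = - (\<integral>x. (g x \<bullet> i) * f x \<partial>lborel)"
    using w by (auto simp: weak_grad_def)
  have [measurable]: "\<Phi> \<in> borel_measurable borel" by (rule Lp_loc_measurable[OF L(1)])
  obtain N where N: "N > 0" "\<And>z::'a. bump z \<le> N" "\<And>z::'a. \<bar>grad bump z \<bullet> z\<bar> \<le> N"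
    using bump_bounds by blast
  let ?d = "DIM('a)" and ?c = "bump_mass TYPE('a)"
  have c: "?c > 0" by (rule bump_mass_pos)
  \<comment> \<open>This bounds the scale derivative of the kernel for every scale at least
    \<open>t / 2\<close>, so it is a Lipschitz constant in the scale near \<open>t\<close>.\<close>
  define K where "K = (N + real ?d * N) / ((t / 2) ^ Suc ?d * ?c)"
  have K0: "K \<ge> 0" using N t c by (simp add: K_def)
  have K: "\<bar>mollifier_dt s z\<bar> \<le> K" if "s \<ge> t / 2" for s and z :: 'a
  proof -
    have s: "s > 0" using that t by simp
    have "\<bar>grad bump (z /\<^sub>R s) \<bullet> (z /\<^sub>R s) + real ?d * bump (z /\<^sub>R s)\<bar> \<le> N + real ?d * N"
      using N(3)[of "z /\<^sub>R s"] mult_left_mono[OF N(2)[of "z /\<^sub>R s"], of "real ?d"]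
        mult_nonneg_nonneg[OF of_nat_0_le_iff[of ?d] bump_nonneg[of "z /\<^sub>R s"]] by linarith
    moreover have "(t / 2) ^ Suc ?d * ?c \<le> s ^ Suc ?d * ?c"
      using that t c by (intro mult_right_mono power_mono) auto
    moreover have "(t / 2) ^ Suc ?d * ?c > 0" using t c by simp
    ultimately have le: "\<bar>grad bump (z /\<^sub>R s) \<bullet> (z /\<^sub>R s) + real ?d * bump (z /\<^sub>R s)\<bar> / (s ^ Suc ?d * ?c) \<le> K"
      unfolding K_def using N by (intro frac_le) auto
    have pos: "s ^ Suc ?d * ?c > 0" using s c by simp
    show ?thesis
      using le unfolding mollifier_dt_def abs_divide abs_minus_cancel abs_of_pos[OF pos] .
  qed
  have near: "t / 2 < s \<and> s < 2 * t" if "s \<in> ball t (t / 2)" for s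
    using that t unfolding mem_ball dist_real_def by arith
  have lip: "\<bar>mollifier s z - mollifier t z\<bar> \<le> K * \<bar>s - t\<bar>" if "s \<in> ball t (t / 2)" for s and z :: 'a
  proof -
    have "norm (mollifier s z - mollifier t z) \<le> K * norm (s - t)"
    proof (rule field_differentiable_bound[where S="ball t (t / 2)" and f'="\<lambda>s. mollifier_dt s z"])
      fix r assume r: "r \<in> ball t (t / 2)"
      then have r2: "r \<ge> t / 2" using near by force
      have "r > 0" using r2 t by linarith
      then show "((\<lambda>s. mollifier s z) has_field_derivative mollifier_dt r z) (at r within ball t (t / 2))"
        by (rule has_field_derivative_at_within[OF mollifier_dt])
      show "norm (mollifier_dt r z) \<le> K" using K[OF r2] by simp
    qed (use that t in \<open>simp_all add: convex_ball\<close>)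
    then show ?thesis by simp
  qed
  \<comment> \<open>Scales within \<open>t / 2\<close> of \<open>t\<close> stay below
    \<open>2 * t\<close>, so outside this ball all kernels concerned vanish.\<close>
  let ?H = "\<lambda>y. K * (indicator (cball 0 (norm x + 2 * t)) y *\<^sub>R \<bar>\<Phi> y\<bar>)"
  have far: "norm (x - y) > 2 * t" if "norm y > norm x + 2 * t" for y
    using that norm_triangle_ineq2[of y x] by (simp add: norm_minus_commute)
  have D: "((\<lambda>s. \<integral>y. mollifier s (x - y) *\<^sub>R \<Phi> y \<partial>lborel) has_derivative
      (\<lambda>v. \<integral>y. v * (mollifier_dt t (x - y) * \<Phi> y) \<partial>lborel)) (at t)"
  proof (rule has_derivative_integral[where r="t / 2" and H="?H"])
    show "t / 2 > 0" using t by simp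
    show "integrable lborel (\<lambda>y. mollifier s (x - y) *\<^sub>R \<Phi> y)" if "s \<in> ball t (t / 2)" for s
      using near[OF that] t by (intro conv_integrable test_fun_mollifier L) auto
    show "((\<lambda>s. mollifier s (x - y) *\<^sub>R \<Phi> y) has_derivative (\<lambda>v. v * (mollifier_dt t (x - y) * \<Phi> y))) (at t)" for y
      using mollifier_dt[OF t, of "x - y"] unfolding has_field_derivative_def
      by (auto intro!: derivative_eq_intros)
    show "\<bar>mollifier s (x - y) *\<^sub>R \<Phi> y - mollifier t (x - y) *\<^sub>R \<Phi> y\<bar> \<le> ?H y * norm (s - t)"
      if s: "s \<in> ball t (t / 2)" for s y
    proof (cases "norm y \<le> norm x + 2 * t")
      case True
      have "\<bar>mollifier s (x - y) *\<^sub>R \<Phi> y - mollifier t (x - y) *\<^sub>R \<Phi> y\<bar>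
          = \<bar>mollifier s (x - y) - mollifier t (x - y)\<bar> * \<bar>\<Phi> y\<bar>"
        by (simp add: abs_mult flip: left_diff_distrib)
      also have "\<dots> \<le> (K * \<bar>s - t\<bar>) * \<bar>\<Phi> y\<bar>"
        using lip[OF s] by (rule mult_right_mono) simp
      finally show ?thesis using True by (simp add: mult_ac)
    next
      case False
      have "mollifier s (x - y) = 0" "mollifier t (x - y) = 0"
        using far[of y] False near[OF s] t by (auto intro!: mollifier_eq_0)
      then show ?thesis using K0 by simp
    qed
    show "\<bar>v * (mollifier_dt t (x - y) * \<Phi> y)\<bar> \<le> ?H y * norm v" for v y
    proof (cases "norm y \<le> norm x + 2 * t")
      case True
      have "\<bar>mollifier_dt t (x - y)\<bar> * (\<bar>v\<bar> * \<bar>\<Phi> y\<bar>) \<le> K * (\<bar>v\<bar> * \<bar>\<Phi> y\<bar>)"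
        using t by (intro mult_right_mono K) auto
      then show ?thesis using True by (simp add: abs_mult mult_ac)
    next
      case False
      then have "mollifier_dt t (x - y) = 0"
        using far[of y] t by (intro mollifier_dt_eq_0) auto
      then show ?thesis using K0 by simp
    qed
    show "(\<lambda>y. v * (mollifier_dt t (x - y) * \<Phi> y)) \<in> borel_measurable lborel" for v
    proof -
      \<comment> \<open>Measurability is read off from the divergence form, a finite sum of
        derivatives of test functions.\<close>
      have "(\<lambda>y. \<Sum>i\<in>Basis. pderiv_dir i (\<lambda>y. mollifier t (x - y) * ((1 / t) * ((x - y) \<bullet> i))) y) \<in> borel_measurable borel"
        by (intro borel_measurable_sum test_fun_measurable test_fun_pderiv test_fun_mollifier_component t)
      then have "(\<lambda>y. mollifier_dt t (x - y)) \<in> borel_measurable borel"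
        by (simp only: mollifier_dt_divergence[OF t])
      then show ?thesis by measurable
    qed
    show "integrable lborel ?H"
      using integrable_norm[OF Lp_loc_1_integrable[OF L(1)]] by (simp add: abs_mult)
  qed
  have int: "integrable lborel (\<lambda>y. \<Phi> y * pderiv_dir i (\<lambda>y. mollifier t (x - y) * ((1 / t) * ((x - y) \<bullet> i))) y)" for i
    using integrable_test_fun_scaleR[OF L(1) test_fun_pderiv[OF test_fun_mollifier_component[OF t]]]
    by (simp add: mult.commute)
  have int2: "integrable lborel (\<lambda>y. (g y \<bullet> i) * (mollifier t (x - y) * ((1 / t) * ((x - y) \<bullet> i))))" for i
    using integrable_inner_left[OF integrable_test_fun_scaleR[OF L(2) test_fun_mollifier_component[OF t, of x i]], of i]
    by (simp add: mult_ac)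
  have "(\<integral>y. mollifier_dt t (x - y) * \<Phi> y \<partial>lborel)
      = (\<integral>y. (\<Sum>i\<in>Basis. \<Phi> y * pderiv_dir i (\<lambda>y. mollifier t (x - y) * ((1 / t) * ((x - y) \<bullet> i))) y) \<partial>lborel)"
    by (simp only: mollifier_dt_divergence[OF t, symmetric] sum_distrib_left mult.commute)
  also have "\<dots> = (\<Sum>i\<in>Basis. \<integral>y. \<Phi> y * pderiv_dir i (\<lambda>y. mollifier t (x - y) * ((1 / t) * ((x - y) \<bullet> i))) y \<partial>lborel)"
    by (rule Bochner_Integration.integral_sum[OF int])
  also have "\<dots> = (\<Sum>i\<in>Basis. - (\<integral>y. (g y \<bullet> i) * (mollifier t (x - y) * ((1 / t) * ((x - y) \<bullet> i))) \<partial>lborel))"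
    by (intro sum.cong refl wk test_fun_mollifier_component t)
  also have "\<dots> = - (\<integral>y. (\<Sum>i\<in>Basis. (g y \<bullet> i) * (mollifier t (x - y) * ((1 / t) * ((x - y) \<bullet> i)))) \<partial>lborel)"
    unfolding sum_negf by (simp only: Bochner_Integration.integral_sum[OF int2])
  also have "\<dots> = - (\<integral>y. mollifier t (x - y) * (g y \<bullet> ((x - y) /\<^sub>R t)) \<partial>lborel)"
  proof -
    have "(\<Sum>i\<in>Basis. (g y \<bullet> i) * (mollifier t (x - y) * ((1 / t) * ((x - y) \<bullet> i))))
        = mollifier t (x - y) * (g y \<bullet> ((x - y) /\<^sub>R t))" for y
      by (subst euclidean_inner) (simp add: sum_distrib_left divide_inverse mult_ac)
    then show ?thesis by (simp only:)
  qed
  finally have eq: "(\<integral>y. mollifier_dt t (x - y) * \<Phi> y \<partial>lborel)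
      = - (\<integral>y. mollifier t (x - y) * (g y \<bullet> ((x - y) /\<^sub>R t)) \<partial>lborel)" .
  have "((\<lambda>s. \<integral>y. mollifier s (x - y) *\<^sub>R \<Phi> y \<partial>lborel) has_real_derivative
      (\<integral>y. mollifier_dt t (x - y) * \<Phi> y \<partial>lborel)) (at t)"
    by (rule has_derivative_imp_has_field_derivative[OF D]) simp
  then show ?thesis
    unfolding eq by (simp only: conv_def)
qed

lemma mollifier_le:
  fixes z :: "'a::euclidean_space"
  assumes "t > 0" "\<And>z::'a. bump z \<le> N"
  shows "mollifier t z \<le> N / (t ^ DIM('a) * bump_mass TYPE('a))"
  unfolding mollifier_def using assms bump_mass_pos[where 'a='a] by (intro divide_right_mono) auto

text \<open>A substitute for Hoelder: \<open>s \<le> l + l powr (1 - p) * s powr p\<close> for every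
  threshold \<open>l > 0\<close>. The kernel averages the first term to \<open>l\<close>; in the
  second it is bounded by its maximum, of order \<open>t powr (-d)\<close>.\<close>

lemma conv_mollifier_dt_bound:
  fixes g :: "'a::euclidean_space \<Rightarrow> 'a"
  assumes t: "t > 0" "t \<le> 1" and p: "p > 1" and g: "Lp_loc p g" and x: "norm x \<le> R"
    and N: "\<And>z::'a. bump z \<le> N"
  shows "\<bar>\<integral>y. mollifier t (x - y) * (g y \<bullet> ((x - y) /\<^sub>R t)) \<partial>lborel\<bar>
    \<le> (1 + N / bump_mass TYPE('a) * (\<integral>y. indicator (cball 0 (R + 1)) y * norm (g y) powr p \<partial>lborel))
       * t powr (- (real DIM('a) / p))"
proof -
  let ?d = "DIM('a)" and ?c = "bump_mass TYPE('a)" and ?k = "mollifier t :: 'a \<Rightarrow> real"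
  let ?J = "\<lambda>y. indicator (cball 0 (R + 1)) y * norm (g y) powr p"
  \<comment> \<open>The threshold is chosen with \<open>l powr (-p) = t powr d\<close>, which makes
    \<open>l powr (1 - p) / t powr d\<close> equal to \<open>l\<close>, so both terms have the same
    order.\<close>
  define l where "l = t powr (- (real ?d / p))"
  have l: "l > 0" using t by (simp add: l_def)
  have c: "?c > 0" by (rule bump_mass_pos)
  have N0: "N \<ge> 0" using N[of 0] bump_nonneg[of "0::'a"] by linarith
  have tf: "test_fun ?k" by (rule test_fun_mollifier[OF t(1)])
  have g1: "Lp_loc 1 g" using Lp_loc_mono[OF g] p by simp
  have gp: "Lp_loc 1 (\<lambda>y. norm (g y) powr p)" using g by (subst (asm) Lp_loc_iff_powr) simp
  have J: "integrable lborel ?J" using Lp_loc_1_integrable[OF gp, of "R + 1"] by simp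
  have [measurable]: "g \<in> borel_measurable borel" "?k \<in> borel_measurable borel"
    using Lp_loc_measurable[OF g] test_fun_measurable[OF tf] by auto
  have young: "s \<le> l + l powr (1 - p) * s powr p" if "s \<ge> 0" for s
  proof (cases "s \<le> l")
    case True
    then show ?thesis by (simp add: add_increasing2)
  next
    case False
    then have "s powr (1 - p) \<le> l powr (1 - p)" using p l by (intro powr_mono2') auto
    then have "s powr (1 - p) * s powr p \<le> l powr (1 - p) * s powr p" by (rule mult_right_mono) simp
    moreover have "s powr (1 - p) * s powr p = s" using False l by (simp flip: powr_add)
    ultimately show ?thesis using l by linarith
  qed
  let ?w = "\<lambda>y. l * ?k (x - y) + l powr (1 - p) * (N / (t ^ ?d * ?c)) * ?J y"
  have I: "integrable lborel (\<lambda>y. ?k (x - y))" by (rule integrable_reflect[OF tf])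
  have le: "\<bar>?k (x - y) * (g y \<bullet> ((x - y) /\<^sub>R t))\<bar> \<le> ?w y" for y
  proof (cases "norm (x - y) < t")
    case True
    have k0: "?k (x - y) \<ge> 0" by (rule mollifier_nonneg[OF t(1)])
    have y: "norm y \<le> R + 1" using True x t(2) norm_triangle_ineq2[of y x] by (simp add: norm_minus_commute)
    have "\<bar>g y \<bullet> ((x - y) /\<^sub>R t)\<bar> \<le> norm (g y) * norm ((x - y) /\<^sub>R t)" by (rule Cauchy_Schwarz_ineq2)
    also have "norm ((x - y) /\<^sub>R t) \<le> 1"
      unfolding norm_scaleR using True t by (simp add: inverse_eq_divide)
    then have "norm (g y) * norm ((x - y) /\<^sub>R t) \<le> norm (g y) * 1" by (rule mult_left_mono) simp
    also have "\<dots> \<le> l + l powr (1 - p) * norm (g y) powr p" using young[of "norm (g y)"] by simp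
    finally have "\<bar>?k (x - y) * (g y \<bullet> ((x - y) /\<^sub>R t))\<bar> \<le> ?k (x - y) * (l + l powr (1 - p) * norm (g y) powr p)"
      using k0 by (simp add: abs_mult mult_left_mono)
    also have "\<dots> = l * ?k (x - y) + ?k (x - y) * (l powr (1 - p) * norm (g y) powr p)" by (simp add: algebra_simps)
    also have "\<dots> \<le> l * ?k (x - y) + (N / (t ^ ?d * ?c)) * (l powr (1 - p) * norm (g y) powr p)"
      by (intro add_left_mono mult_right_mono mollifier_le t N) simp
    finally show ?thesis using y by (simp add: mult_ac)
  next
    case False
    then have "?k (x - y) = 0" using t by (intro mollifier_eq_0) auto
    then show ?thesis using N0 t c by simp
  qed
  have "\<bar>\<integral>y. ?k (x - y) * (g y \<bullet> ((x - y) /\<^sub>R t)) \<partial>lborel\<bar> \<le> (\<integral>y. \<bar>?k (x - y) * (g y \<bullet> ((x - y) /\<^sub>R t))\<bar> \<partial>lborel)"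
    by (rule integral_abs_bound)
  also have "\<dots> \<le> (\<integral>y. ?w y \<partial>lborel)"
  proof (rule integral_mono[OF _ _ le])
    show w: "integrable lborel ?w" using I J by simp
    show "integrable lborel (\<lambda>y. \<bar>?k (x - y) * (g y \<bullet> ((x - y) /\<^sub>R t))\<bar>)"
      by (rule Bochner_Integration.integrable_bound[OF w]) (use le in \<open>auto intro: order_trans[OF _ abs_ge_self]\<close>)
  qed
  also have "\<dots> = l + l powr (1 - p) * (N / (t ^ ?d * ?c)) * (\<integral>y. ?J y \<partial>lborel)"
    using I J by (simp add: integral_mollifier_reflect[OF t(1)])
  also have "l powr (1 - p) * (N / (t ^ ?d * ?c)) = (l powr (1 - p) / t powr real ?d) * (N / ?c)"
    using t by (simp add: powr_realpow)
  also have "l powr (1 - p) / t powr real ?d = l"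
  proof -
    have "l powr (1 - p) / t powr real ?d = t powr (- (real ?d / p) * (1 - p) - real ?d)"
      unfolding l_def powr_powr by (simp only: powr_diff)
    also have "- (real ?d / p) * (1 - p) - real ?d = - (real ?d / p)"
      using p by (simp add: field_simps)
    finally show ?thesis by (simp add: l_def)
  qed
  also have "l + l * (N / ?c) * (\<integral>y. ?J y \<partial>lborel) = (1 + N / ?c * (\<integral>y. ?J y \<partial>lborel)) * l"
    by (simp add: algebra_simps)
  finally show ?thesis by (simp only: l_def)
qed

text \<open>The scale derivative of the mollification is of order \<open>t powr (-d/p)\<close>, which is integrable
  at \<open>0\<close> since \<open>p > d\<close>.\<close>

lemma conv_mollifier_bounded:
  fixes \<Phi> :: "'a::euclidean_space \<Rightarrow> real"
  assumes p: "real DIM('a) < p" and H: "H1p_loc p \<Phi> g"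
  obtains C where "\<And>t x. 0 < t \<Longrightarrow> t \<le> 1 \<Longrightarrow> norm x \<le> R \<Longrightarrow> \<bar>conv (mollifier t) \<Phi> x\<bar> \<le> C"
proof -
  have w: "weak_grad \<Phi> g" and g: "Lp_loc p g" using H by (auto simp: H1p_loc_def)
  have L: "Lp_loc 1 \<Phi>" using w by (simp add: weak_grad_def)
  let ?d = "DIM('a)" and ?c = "bump_mass TYPE('a)"
  have d1: "real ?d \<ge> 1" using DIM_positive[where 'a='a] by simp
  have p1: "p > 1" using p d1 by linarith
  have c: "?c > 0" by (rule bump_mass_pos)
  obtain N where N: "N > 0" "\<And>z::'a. bump z \<le> N" "\<And>z::'a. \<bar>grad bump z \<bullet> z\<bar> \<le> N"
    using bump_bounds by blast
  define K where "K = 1 + N / ?c * (\<integral>y. indicator (cball 0 (R + 1)) y * norm (g y) powr p \<partial>lborel)"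
  \<comment> \<open>The scale derivative is of order \<open>t powr (a - 1)\<close>; this is
    integrable at 0 exactly because \<open>p > d\<close> makes \<open>a\<close> positive.\<close>
  define a where "a = 1 - real ?d / p"
  have a: "a > 0" using p p1 by (simp add: a_def field_simps)
  have K: "K > 0" using N c by (simp add: K_def add_pos_nonneg)
  \<comment> \<open>A bound for the mollification at scale 1, from the maximum \<open>N / ?c\<close>
    of that kernel. The change from scale \<open>t\<close> to scale 1 is then at most
    \<open>K / a\<close>.\<close>
  define C0 where "C0 = N / ?c * (\<integral>y. indicator (cball 0 (R + 1)) y * \<bar>\<Phi> y\<bar> \<partial>lborel)"
  have "\<bar>conv (mollifier t) \<Phi> x\<bar> \<le> C0 + K / a" if t: "0 < t" "t \<le> 1" and x: "norm x \<le> R" for t x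
  proof -
    define m where "m t = conv (mollifier t) \<Phi> x" for t
    define m' where "m' t = - (\<integral>y. mollifier t (x - y) * (g y \<bullet> ((x - y) /\<^sub>R t)) \<partial>lborel)" for t
    have m: "(m has_real_derivative m' s) (at s)" if "s > 0" for s
      unfolding m_def m'_def by (rule conv_mollifier_dt[OF that w])
    have m'_le: "\<bar>m' s\<bar> \<le> K * s powr (a - 1)" if "s > 0" "s \<le> 1" for s
      using conv_mollifier_dt_bound[OF that p1 g x N(2)] by (simp add: m'_def K_def a_def)
    have q: "((\<lambda>s. K / a * s powr a) has_real_derivative K * s powr (a - 1)) (at s)" if "s > 0" for s
      using has_real_derivative_powr[OF that, of a] a that by (auto intro!: derivative_eq_intros)
    \<comment> \<open>The derivative bound is integrated by monotonicity:
      \<open>K / a * s powr a\<close> plus or minus \<open>m s\<close> has nonnegative derivative on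
      the interval from \<open>t\<close> to 1.\<close>
    have "m t + K / a * t powr a \<le> m 1 + K / a * 1 powr a"
    proof (rule DERIV_nonneg_imp_nondecreasing[OF t(2)])
      fix s assume "t \<le> s" "s \<le> 1"
      then show "\<exists>y. ((\<lambda>s. m s + K / a * s powr a) has_real_derivative y) (at s) \<and> 0 \<le> y"
        using t m'_le[of s] by (intro exI[of _ "m' s + K * s powr (a - 1)"] conjI DERIV_add m q) auto
    qed
    moreover have "K / a * t powr a - m t \<le> K / a * 1 powr a - m 1"
    proof (rule DERIV_nonneg_imp_nondecreasing[OF t(2)])
      fix s assume "t \<le> s" "s \<le> 1"
      then show "\<exists>y. ((\<lambda>s. K / a * s powr a - m s) has_real_derivative y) (at s) \<and> 0 \<le> y"
        using t m'_le[of s] by (intro exI[of _ "K * s powr (a - 1) - m' s"] conjI DERIV_diff m q) auto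
    qed
    moreover have "K / a * t powr a \<ge> 0" using K a by simp
    ultimately have 1: "\<bar>m t - m 1\<bar> \<le> K / a" by simp
    have "\<bar>m 1\<bar> \<le> (\<integral>y. \<bar>mollifier 1 (x - y) *\<^sub>R \<Phi> y\<bar> \<partial>lborel)"
      unfolding m_def conv_def by (rule integral_abs_bound)
    also have "\<dots> \<le> (\<integral>y. N / ?c * (indicator (cball 0 (R + 1)) y * \<bar>\<Phi> y\<bar>) \<partial>lborel)"
    proof (rule integral_mono)
      show "integrable lborel (\<lambda>y. \<bar>mollifier 1 (x - y) *\<^sub>R \<Phi> y\<bar>)"
        by (intro integrable_abs conv_integrable test_fun_mollifier L) simp
      show "integrable lborel (\<lambda>y. N / ?c * (indicator (cball 0 (R + 1)) y * \<bar>\<Phi> y\<bar>))"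
        using integrable_norm[OF Lp_loc_1_integrable[OF L, of "R + 1"]] by (simp add: abs_mult)
      fix y
      show "\<bar>mollifier 1 (x - y) *\<^sub>R \<Phi> y\<bar> \<le> N / ?c * (indicator (cball 0 (R + 1)) y * \<bar>\<Phi> y\<bar>)"
      proof (cases "norm y \<le> R + 1")
        case True
        then show ?thesis
          using mult_right_mono[OF mollifier_le[of 1 N "x - y"], of "\<bar>\<Phi> y\<bar>"] N(2) mollifier_nonneg[of 1 "x - y"]
          by (simp add: abs_mult)
      next
        case False
        then have "mollifier 1 (x - y) = 0"
          using x norm_triangle_ineq2[of y x] by (intro mollifier_eq_0) (auto simp: norm_minus_commute)
        then show ?thesis using N c by simp
      qed
    qed
    also have "\<dots> = C0" by (simp add: C0_def)
    finally show ?thesis using 1 by (simp add: m_def)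
  qed
  then show ?thesis by (rule that)
qed

text \<open>The bound on the mollifications is uniform in the scale, so it passes to the almost
  everywhere limit along a subsequence.\<close>

lemma H1p_loc_imp_Linf_loc:
  fixes \<Phi> :: "'a::euclidean_space \<Rightarrow> real"
  assumes p: "real DIM('a) < p" and H: "H1p_loc p \<Phi> g"
  shows "Linf_loc \<Phi>"
proof (rule Linf_locI)
  have L: "Lp_loc 1 \<Phi>" using H by (simp add: H1p_loc_def weak_grad_def)
  show "\<Phi> \<in> borel_measurable borel" by (rule Lp_loc_measurable[OF L])
  fix R :: real
  obtain C where C: "\<And>t x. 0 < t \<Longrightarrow> t \<le> 1 \<Longrightarrow> norm x \<le> R \<Longrightarrow> \<bar>conv (mollifier t) \<Phi> x\<bar> \<le> C"
    using conv_mollifier_bounded[OF p H] by blast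
  have "(\<lambda>n. \<integral>x. norm (indicator (cball 0 R) x * norm (conv (moll n) \<Phi> x - \<Phi> x)) \<partial>lborel) \<longlonglongrightarrow> 0"
    using conv_moll_tendsto_L1_loc(2)[OF L, of R] by (simp add: abs_mult)
  from tendsto_L1_AE_subseq[OF conv_moll_tendsto_L1_loc(1)[OF L] this] obtain r :: "nat \<Rightarrow> nat" where
    "AE x in lborel. (\<lambda>n. indicator (cball 0 R) x * norm (conv (moll (r n)) \<Phi> x - \<Phi> x)) \<longlonglongrightarrow> 0" by blast
  then have "AE x in lborel. norm x \<le> R \<longrightarrow> \<bar>\<Phi> x\<bar> \<le> C"
  proof eventually_elim
    case (elim x)
    show ?case
    proof
      assume x: "norm x \<le> R"
      then have "(\<lambda>n. conv (moll (r n)) \<Phi> x - \<Phi> x) \<longlonglongrightarrow> 0"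
        using elim by (simp add: tendsto_rabs_zero_iff)
      then have "(\<lambda>n. conv (moll (r n)) \<Phi> x) \<longlonglongrightarrow> \<Phi> x" by (rule LIM_zero_cancel)
      then have "(\<lambda>n. \<bar>conv (moll (r n)) \<Phi> x\<bar>) \<longlonglongrightarrow> \<bar>\<Phi> x\<bar>" by (rule tendsto_rabs)
      then show "\<bar>\<Phi> x\<bar> \<le> C"
        by (rule LIMSEQ_le_const2) (use C unit_seq x in auto)
    qed
  qed
  then show "\<exists>C. AE x in lborel. norm x \<le> R \<longrightarrow> \<bar>\<Phi> x\<bar> \<le> C" by blast
qed

section \<open>Weighted decompositions and invariant measures\<close>

lemma integral_reflect:
  fixes f :: "'a::euclidean_space \<Rightarrow> real"
  assumes [measurable]: "f \<in> borel_measurable borel"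
  shows "(\<integral>y. f (x - y) \<partial>lborel) = (\<integral>y. f y \<partial>lborel)"
proof -
  have "lborel = distr lborel borel (\<lambda>y. x - y)"
    using lborel_affine[of "-1" x] by (simp add: density_1)
  then have "(\<integral>y. f y \<partial>lborel) = (\<integral>y. f y \<partial>distr lborel borel (\<lambda>y. x - y))" by metis
  also have "\<dots> = (\<integral>y. f (x - y) \<partial>lborel)" by (rule integral_distr) measurable
  finally show ?thesis ..
qed

text \<open>The convolution with the constant \<open>1\<close> is constant.\<close>

lemma integral_frechet_derivative_eq_0:
  assumes k: "test_fun k"
  shows "(\<integral>z. frechet_derivative k (at z) v \<partial>lborel) = 0"
proof -
  have 1: "conv f (\<lambda>_. 1::real) = (\<lambda>x. \<integral>z. f z \<partial>lborel)" if "test_fun f" for f :: "'a \<Rightarrow> real"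
    by (rule ext) (simp add: conv_def integral_reflect[OF test_fun_measurable[OF that]])
  have "((\<lambda>x::'a. \<integral>z. k z \<partial>lborel) has_derivative (\<lambda>v. \<integral>z. frechet_derivative k (at z) v \<partial>lborel)) (at 0)"
    using conv_has_derivative[OF k Lp_loc_1_const[of "1::real"], of 0]
    by (simp only: 1[OF k] 1[OF test_fun_frechet_derivative[OF k]])
  from has_derivative_unique[OF this has_derivative_const] show ?thesis by metis
qed

lemma div_free_const: "div_free lborel (\<lambda>x. v)"
  unfolding div_free_def
proof (intro allI impI)
  fix f :: "'a \<Rightarrow> real" assume f: "test_fun f"
  then have "smooth_fun f" by (simp add: test_fun_def)
  then show "(\<integral>x. v \<bullet> grad f x \<partial>lborel) = 0"
    using integral_frechet_derivative_eq_0[OF f, of v]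
    by (simp add: inner_commute[of v] smooth_grad_inner)
qed

lemma integrable_inner_grad:
  fixes B :: "'a::euclidean_space \<Rightarrow> 'a"
  assumes "Lp_loc 1 B" "test_fun f"
  shows "integrable lborel (\<lambda>x. B x \<bullet> grad f x)"
proof -
  have "integrable lborel (\<lambda>x. (pderiv_dir i f x *\<^sub>R B x) \<bullet> i)" for i
    by (intro integrable_inner_left integrable_test_fun_scaleR assms test_fun_pderiv)
  then have "integrable lborel (\<lambda>x. \<Sum>i\<in>Basis. (pderiv_dir i f x *\<^sub>R B x) \<bullet> i)" by simp
  then show ?thesis by (simp add: grad_def inner_sum_right)
qed

lemma Lp_loc_2_const: "Lp_loc 2 (\<lambda>x. c)"
  by (simp add: Lp_loc_2_iff Lp_loc_1_const)

lemma Lp_loc_exp: "Linf_loc \<Phi> \<Longrightarrow> Lp_loc 2 B \<Longrightarrow> Lp_loc 2 (\<lambda>x. exp (c * \<Phi> x) *\<^sub>R B x)"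
  using Linf_loc_measurable[of \<Phi>] by (intro Lp_loc_2_scaleR Linf_loc_exp_bound) auto

lemma Lp_loc_1_exp: "Linf_loc \<Phi> \<Longrightarrow> Lp_loc 1 B \<Longrightarrow> Lp_loc 1 (\<lambda>x. exp (c * \<Phi> x) *\<^sub>R B x)"
  using Linf_loc_measurable[of \<Phi>] by (intro Lp_loc_1_scaleR Linf_loc_exp_bound) auto

lemma integrable_exp_inner_grad:
  fixes B :: "'a::euclidean_space \<Rightarrow> 'a"
  assumes "Linf_loc \<Phi>" "Lp_loc 2 B" "test_fun f"
  shows "integrable lborel (\<lambda>x. exp (c * \<Phi> x) * (B x \<bullet> grad f x))"
  using integrable_inner_grad[OF Lp_loc_1_exp[OF assms(1) Lp_loc_2_imp_1[OF assms(2)]] assms(3), of c] by simp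

text \<open>The weighted identity is applied to each constant field \<open>i\<close> in the basis
  with test function \<open>pderiv_dir i f\<close> and \<open>c = 2\<close>. Summing over
  \<open>i\<close> gives the Laplacian plus twice the drift term, and half of that is the integrand
  here.\<close>

lemma exp_laplacian:
  assumes H: "H1p_loc 2 \<Phi> g" and \<Phi>: "Linf_loc \<Phi>" and f: "test_fun f"
  shows "integrable lborel (\<lambda>x. exp (2 * \<Phi> x) * (laplacian f x / 2 + g x \<bullet> grad f x))"
    and "(\<integral>x. exp (2 * \<Phi> x) * (laplacian f x / 2 + g x \<bullet> grad f x) \<partial>lborel) = 0"
proof -
  have g: "Lp_loc 2 g" using H by (simp add: H1p_loc_def)
  let ?h = "\<lambda>i x. exp (2 * \<Phi> x) * (i \<bullet> (grad (pderiv_dir i f) x + (2 * pderiv_dir i f x) *\<^sub>R g x))"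
  have p: "test_fun (pderiv_dir i f)" for i by (rule test_fun_pderiv[OF f])
  have zero: "(\<integral>x. ?h i x \<partial>lborel) = 0" for i
    by (rule div_free_weighted[OF div_free_const Lp_loc_2_const H \<Phi> p])
  have int: "integrable lborel (?h i)" for i
  proof -
    have "integrable lborel (\<lambda>x. (2 * pderiv_dir i f x) *\<^sub>R (exp (2 * \<Phi> x) * (i \<bullet> g x)))"
    proof (rule integrable_test_fun_scaleR)
      show "Lp_loc 1 (\<lambda>x. exp (2 * \<Phi> x) * (i \<bullet> g x))"
        using Lp_loc_1_exp[OF \<Phi> Lp_loc_2_inner[OF Lp_loc_2_const g]] by simp
      show "test_fun (\<lambda>x. 2 * pderiv_dir i f x)"
        using test_fun_mult_smooth[OF p, of "\<lambda>x. 2"] by (simp add: smooth_fun_def mult.commute)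
    qed
    moreover have "integrable lborel (\<lambda>x. exp (2 * \<Phi> x) * (i \<bullet> grad (pderiv_dir i f) x))"
      by (rule integrable_exp_inner_grad[OF \<Phi> Lp_loc_2_const p])
    ultimately have "integrable lborel (\<lambda>x. exp (2 * \<Phi> x) * (i \<bullet> grad (pderiv_dir i f) x)
        + (2 * pderiv_dir i f x) *\<^sub>R (exp (2 * \<Phi> x) * (i \<bullet> g x)))"
      by (rule Bochner_Integration.integrable_add[rotated])
    then show ?thesis by (simp add: inner_add_right algebra_simps)
  qed
  have eq: "exp (2 * \<Phi> x) * (laplacian f x / 2 + g x \<bullet> grad f x) = (1 / 2) * (\<Sum>i\<in>Basis. ?h i x)" for x
  proof -
    have "i \<bullet> grad (pderiv_dir i f) x = pderiv_dir i (pderiv_dir i f) x" if "i \<in> Basis" for i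
      using smooth_grad_inner[of "pderiv_dir i f" x i] p[of i]
      by (simp add: test_fun_def inner_commute) (simp add: pderiv_dir_def)
    then have "(\<Sum>i\<in>Basis. ?h i x) = exp (2 * \<Phi> x) * (\<Sum>i\<in>Basis. pderiv_dir i (pderiv_dir i f) x + 2 * (pderiv_dir i f x * (g x \<bullet> i)))"
      unfolding sum_distrib_left by (intro sum.cong refl) (simp add: inner_add_right inner_commute)
    also have "\<dots> = exp (2 * \<Phi> x) * (laplacian f x + 2 * (g x \<bullet> grad f x))"
      by (simp add: sum.distrib laplacian_def grad_def inner_sum_right sum_distrib_left[symmetric])
    finally show ?thesis by (simp add: algebra_simps)
  qed
  show "integrable lborel (\<lambda>x. exp (2 * \<Phi> x) * (laplacian f x / 2 + g x \<bullet> grad f x))"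
    unfolding eq by (intro integrable_mult_right Bochner_Integration.integrable_sum int)
  show "(\<integral>x. exp (2 * \<Phi> x) * (laplacian f x / 2 + g x \<bullet> grad f x) \<partial>lborel) = 0"
    unfolding eq integral_mult_right_zero by (subst Bochner_Integration.integral_sum[OF int]) (simp only: zero sum.neutral_const mult_zero_right)
qed

lemma laplacian_measurable: "test_fun f \<Longrightarrow> laplacian f \<in> borel_measurable borel"
  unfolding laplacian_def[abs_def] by (intro borel_measurable_sum test_fun_measurable test_fun_pderiv)

lemma gen_L_measurable:
  assumes [measurable]: "G \<in> borel_measurable borel" and f: "test_fun f"
  shows "gen_L G f \<in> borel_measurable borel"
proof -
  have [measurable]: "grad f \<in> borel_measurable borel"
    using f by (intro grad_measurable) (simp add: test_fun_def)
  show ?thesis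
    unfolding gen_L_def[abs_def] using laplacian_measurable[OF f] by measurable
qed

lemma decompD:
  assumes "decomp G \<Phi> g B"
  shows "H1p_loc 2 \<Phi> g" "Linf_loc \<Phi>" "Lp_loc 2 B" "Lp_loc 2 g" "AE x in lborel. G x = g x + B x"
  using assms by (auto simp: decomp_def H1p_loc_def)

lemma exp_gen_L:
  assumes D: "decomp G \<Phi> g B" and [measurable]: "G \<in> borel_measurable borel" and f: "test_fun f"
  shows "integrable lborel (\<lambda>x. exp (2 * \<Phi> x) * gen_L G f x)"
    and "(\<integral>x. exp (2 * \<Phi> x) * gen_L G f x \<partial>lborel) = (\<integral>x. exp (2 * \<Phi> x) * (B x \<bullet> grad f x) \<partial>lborel)"
proof -
  note D = decompD[OF D]
  let ?A = "\<lambda>x. exp (2 * \<Phi> x) * (laplacian f x / 2 + g x \<bullet> grad f x)"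
  let ?B = "\<lambda>x. exp (2 * \<Phi> x) * (B x \<bullet> grad f x)"
  note A = exp_laplacian[OF D(1,2) f]
  have iB: "integrable lborel ?B" by (rule integrable_exp_inner_grad[OF D(2,3) f])
  have AE: "AE x in lborel. exp (2 * \<Phi> x) * gen_L G f x = ?A x + ?B x"
    using D(5) by eventually_elim (simp add: gen_L_def inner_add_left algebra_simps)
  have [measurable]: "gen_L G f \<in> borel_measurable borel" "\<Phi> \<in> borel_measurable borel"
    by (intro gen_L_measurable f) (auto intro: Linf_loc_measurable D)
  have m: "(\<lambda>x. exp (2 * \<Phi> x) * gen_L G f x) \<in> borel_measurable lborel" by measurable
  have AB: "integrable lborel (\<lambda>x. ?A x + ?B x)"
    by (rule Bochner_Integration.integrable_add[OF A(1) iB])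
  show "integrable lborel (\<lambda>x. exp (2 * \<Phi> x) * gen_L G f x)"
    using integrable_cong_AE[OF m borel_measurable_integrable[OF AB] AE] AB by blast
  show "(\<integral>x. exp (2 * \<Phi> x) * gen_L G f x \<partial>lborel) = (\<integral>x. ?B x \<partial>lborel)"
    unfolding integral_cong_AE[OF m borel_measurable_integrable[OF AB] AE]
      Bochner_Integration.integral_add[OF A(1) iB] A(2) by simp
qed

abbreviation (input) exp_measure :: "('a::euclidean_space \<Rightarrow> real) \<Rightarrow> 'a measure" where
  "exp_measure \<Phi> \<equiv> density lborel (\<lambda>x. ennreal (exp (2 * \<Phi> x)))"

lemma integral_exp_measure:
  fixes h :: "'a::euclidean_space \<Rightarrow> real"
  assumes "\<Phi> \<in> borel_measurable borel" "h \<in> borel_measurable borel"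
  shows "(\<integral>x. h x \<partial>exp_measure \<Phi>) = (\<integral>x. exp (2 * \<Phi> x) * h x \<partial>lborel)"
    and "integrable (exp_measure \<Phi>) h \<longleftrightarrow> integrable lborel (\<lambda>x. exp (2 * \<Phi> x) * h x)"
  using assms by (auto simp: integral_density integrable_density)

lemma div_free_exp_measure_iff:
  assumes \<Phi>: "\<Phi> \<in> borel_measurable borel" and [measurable]: "B \<in> borel_measurable borel"
  shows "div_free (exp_measure \<Phi>) B \<longleftrightarrow>
    (\<forall>f. test_fun f \<longrightarrow> (\<integral>x. exp (2 * \<Phi> x) * (B x \<bullet> grad f x) \<partial>lborel) = 0)"
proof -
  have "(\<integral>x. B x \<bullet> grad f x \<partial>exp_measure \<Phi>) = (\<integral>x. exp (2 * \<Phi> x) * (B x \<bullet> grad f x) \<partial>lborel)" if "test_fun f" for f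
  proof (rule integral_exp_measure[OF \<Phi>])
    have [measurable]: "grad f \<in> borel_measurable borel"
      using that by (intro grad_measurable) (simp add: test_fun_def)
    show "(\<lambda>x. B x \<bullet> grad f x) \<in> borel_measurable borel" by measurable
  qed
  then show ?thesis by (simp add: div_free_def)
qed

lemma WHHD_iff:
  "WHHD G \<Phi> g B \<longleftrightarrow> decomp G \<Phi> g B \<and>
    (\<forall>f. test_fun f \<longrightarrow> (\<integral>x. exp (2 * \<Phi> x) * (B x \<bullet> grad f x) \<partial>lborel) = 0)"
  unfolding WHHD_def
  by (intro conj_cong refl div_free_exp_measure_iff) (auto intro: Linf_loc_measurable Lp_loc_measurable decompD)

text \<open>The density is positive and locally bounded, so nontriviality and local finiteness of
  the measure are automatic. The invariance integral reduces to the \<open>B\<close> term by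
  \<open>exp_gen_L\<close>.\<close>

lemma WHHD_iff_inf_invariant:
  assumes D: "decomp G \<Phi> g B" and G: "G \<in> borel_measurable borel"
  shows "WHHD G \<Phi> g B \<longleftrightarrow> inf_invariant G (exp_measure \<Phi>)"
proof -
  note \<Phi> = decompD(2)[OF D]
  have [measurable]: "\<Phi> \<in> borel_measurable borel" by (rule Linf_loc_measurable[OF \<Phi>])
  have "emeasure (exp_measure \<Phi>) (space (exp_measure \<Phi>)) \<noteq> 0"
  proof
    assume "emeasure (exp_measure \<Phi>) (space (exp_measure \<Phi>)) = 0"
    then have "(\<integral>\<^sup>+x. ennreal (exp (2 * \<Phi> x)) \<partial>lborel) = 0"
      by (simp add: emeasure_density)
    then have "AE x :: 'a in lborel. False"
      by (subst (asm) nn_integral_0_iff_AE) auto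
    then have "emeasure lborel (UNIV :: 'a set) = 0"
      by (subst (asm) AE_iff_measurable[OF _ refl]) auto
    then show False by simp
  qed
  moreover have "emeasure (exp_measure \<Phi>) K < \<infinity>" if "compact K" for K
  proof -
    have "bounded K" using that by (rule compact_imp_bounded)
    then obtain R where R: "K \<subseteq> cball 0 R" unfolding bounded_iff by (auto simp: subset_iff)
    have K: "K \<in> sets borel" using that by (rule borel_compact)
    have "integrable lborel (\<lambda>x. indicator (cball 0 R) x *\<^sub>R (exp (2 * \<Phi> x) *\<^sub>R (1::real)))"
      by (intro Lp_loc_1_integrable Lp_loc_1_exp \<Phi> Lp_loc_1_const)
    then have "(\<integral>\<^sup>+x. ennreal (norm (indicator (cball 0 R) x *\<^sub>R (exp (2 * \<Phi> x) *\<^sub>R (1::real)))) \<partial>lborel) < \<infinity>"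
      by (simp add: integrable_iff_bounded)
    moreover have "emeasure (exp_measure \<Phi>) K \<le> (\<integral>\<^sup>+x. ennreal (norm (indicator (cball 0 R) x *\<^sub>R (exp (2 * \<Phi> x) *\<^sub>R (1::real)))) \<partial>lborel)"
      using R K by (subst emeasure_density) (auto intro!: nn_integral_mono simp: indicator_def)
    ultimately show ?thesis by simp
  qed
  moreover have "integrable (exp_measure \<Phi>) (gen_L G f) \<and>
     (\<integral>x. gen_L G f x \<partial>exp_measure \<Phi>) = (\<integral>x. exp (2 * \<Phi> x) * (B x \<bullet> grad f x) \<partial>lborel)" if "test_fun f" for f
    using exp_gen_L[OF D G that] gen_L_measurable[OF G that] by (simp add: integral_exp_measure)
  ultimately show ?thesis
    using D by (auto simp: WHHD_iff inf_invariant_def)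
qed

text \<open>The constant drops out because derivatives of test functions integrate to 0; the
  fundamental lemma is then applied to each component of the difference.\<close>

lemma weak_grad_shift:
  fixes \<Phi> \<Phi>' :: "'a::euclidean_space \<Rightarrow> real"
  assumes w: "weak_grad \<Phi> g" "weak_grad \<Phi>' g'" and AE: "AE x in lborel. \<Phi>' x = \<Phi> x + \<kappa>"
  shows "AE x in lborel. g' x = g x"
proof -
  have L: "Lp_loc 1 \<Phi>" "Lp_loc 1 g" "Lp_loc 1 \<Phi>'" "Lp_loc 1 g'"
    using w by (auto simp: weak_grad_def)
  have "AE x in lborel. (g' x - g x) \<bullet> i = 0" if i: "i \<in> Basis" for i
  proof (rule fundamental_lemma)
    have comp: "Lp_loc 1 (\<lambda>x. h x \<bullet> i)" if "Lp_loc 1 h" for h :: "'a \<Rightarrow> 'a"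
      using i Lp_loc_measurable[OF that] by (intro Lp_loc_1_bound[OF that]) (auto simp: Basis_le_norm)
    have meas: "g \<in> borel_measurable borel" "g' \<in> borel_measurable borel"
      using L Lp_loc_measurable by auto
    have L': "Lp_loc 1 (\<lambda>x. g' x \<bullet> i)" "Lp_loc 1 (\<lambda>x. g x \<bullet> i)" by (intro comp L)+
    show "Lp_loc 1 (\<lambda>x. (g' x - g x) \<bullet> i)"
      using L' meas unfolding Lp_loc_1_iff by (auto simp: inner_diff_left right_diff_distrib)
    fix f :: "'a \<Rightarrow> real" assume f: "test_fun f"
    have int: "integrable lborel (\<lambda>x. h x * k x)" if "Lp_loc 1 h" "test_fun k" for h k :: "'a \<Rightarrow> real"
      using integrable_test_fun_scaleR[OF that] by (simp add: mult.commute)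
    note p = test_fun_pderiv[OF f, of i]
    have [measurable]: "\<Phi> \<in> borel_measurable borel" "\<Phi>' \<in> borel_measurable borel" "pderiv_dir i f \<in> borel_measurable borel"
      using L Lp_loc_measurable test_fun_measurable[OF p] by auto
    have "(\<integral>x. \<Phi>' x * pderiv_dir i f x \<partial>lborel) = (\<integral>x. \<Phi> x * pderiv_dir i f x + \<kappa> * pderiv_dir i f x \<partial>lborel)"
      by (rule integral_cong_AE) (use AE in \<open>auto elim!: eventually_mono simp: algebra_simps\<close>)
    also have "\<dots> = (\<integral>x. \<Phi> x * pderiv_dir i f x \<partial>lborel) + \<kappa> * (\<integral>x. pderiv_dir i f x \<partial>lborel)"
      using int[OF L(1) p] integrable_test_fun[OF p] by simp
    also have "(\<integral>x. pderiv_dir i f x \<partial>lborel) = 0"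
      unfolding pderiv_dir_def by (rule integral_frechet_derivative_eq_0[OF f])
    finally have "(\<integral>x. (g' x \<bullet> i) * f x \<partial>lborel) = (\<integral>x. (g x \<bullet> i) * f x \<partial>lborel)"
      using w f i by (simp add: weak_grad_def)
    then show "(\<integral>x. (g' x - g x) \<bullet> i * f x \<partial>lborel) = 0"
      using int[OF L'(1) f] int[OF L'(2) f] by (simp add: inner_diff_left left_diff_distrib)
  qed
  then have "AE x in lborel. \<forall>i\<in>Basis. (g' x - g x) \<bullet> i = 0"
    by (intro AE_finite_allI) auto
  then show ?thesis
  proof eventually_elim
    case (elim x)
    show ?case
      by (rule euclidean_eqI) (use elim in \<open>simp add: inner_diff_left\<close>)
  qed
qed

text \<open>Densities with respect to a sigma-finite measure are unique almost everywhere, so a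
  factor \<open>c\<close> between the measures becomes an additive constant after taking
  logarithms.\<close>

lemma exp_measure_proportional:
  assumes [measurable]: "\<Phi> \<in> borel_measurable borel" "\<Phi>' \<in> borel_measurable borel" and "c > 0"
    and eq: "exp_measure \<Phi>' = density (exp_measure \<Phi>) (\<lambda>_. ennreal c)"
  shows "AE x in lborel. \<Phi>' x = \<Phi> x + ln c / 2"
proof -
  have "exp_measure \<Phi>' = density lborel (\<lambda>x. ennreal (exp (2 * \<Phi> x)) * ennreal c)"
    unfolding eq by (rule density_density_eq) measurable
  then have "AE x in lborel. ennreal (exp (2 * \<Phi>' x)) = ennreal (exp (2 * \<Phi> x)) * ennreal c"
    by (intro sigma_finite_measure.density_unique[OF sigma_finite_lborel]) measurable
  then show ?thesis
  proof eventually_elim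
    case (elim x)
    then have "exp (2 * \<Phi>' x) = exp (2 * \<Phi> x) * c"
      using \<open>c > 0\<close> by (simp flip: ennreal_mult)
    then have "exp (2 * \<Phi>' x) = exp (2 * \<Phi> x + ln c)"
      using \<open>c > 0\<close> by (simp add: exp_add)
    then show ?case by simp
  qed
qed

section \<open>Relations between orthogonal and weighted decompositions\<close>

lemma OHHD_imp_WHHD:
  assumes O: "OHHD G \<Phi> g B"
  shows "WHHD G \<Phi> g B"
  unfolding WHHD_iff
proof (intro conjI allI impI)
  from O show D: "decomp G \<Phi> g B" by (simp add: OHHD_def HHD_def)
  note D = decompD[OF D]
  have div: "div_free lborel B" and orth: "AE x in lborel. g x \<bullet> B x = 0"
    using O by (auto simp: OHHD_def HHD_def)
  fix f :: "'a \<Rightarrow> real" assume f: "test_fun f"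
  have [measurable]: "\<Phi> \<in> borel_measurable borel" "g \<in> borel_measurable borel" "B \<in> borel_measurable borel"
    "f \<in> borel_measurable borel" "grad f \<in> borel_measurable borel"
    using D Linf_loc_measurable Lp_loc_measurable test_fun_measurable[OF f] grad_measurable[of f] f
    by (auto simp: test_fun_def)
  \<comment> \<open>Orthogonality allows the term \<open>2 * f * g\<close> to be inserted for free,
    which completes the integrand to the one in the weighted identity.\<close>
  have "(\<integral>x. exp (2 * \<Phi> x) * (B x \<bullet> grad f x) \<partial>lborel)
      = (\<integral>x. exp (2 * \<Phi> x) * (B x \<bullet> (grad f x + (2 * f x) *\<^sub>R g x)) \<partial>lborel)"
    by (rule integral_cong_AE) (use orth in \<open>auto elim!: eventually_mono simp: inner_add_right inner_commute\<close>)
  also have "\<dots> = 0" by (rule div_free_weighted[OF div D(3,1,2) f])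
  finally show "(\<integral>x. exp (2 * \<Phi> x) * (B x \<bullet> grad f x) \<partial>lborel) = 0" .
qed

text \<open>In the weighted identity with \<open>c = 2\<close>, the term with \<open>grad f\<close>
  integrates to 0 by the WHHD property. What remains is the pairing of
  \<open>exp (2 * \<Phi>) (B \<bullet> g)\<close> with an arbitrary test function.\<close>

lemma WHHD_div_free_imp_orthogonal:
  assumes W: "WHHD G \<Phi> g B" and div: "div_free lborel B"
  shows "AE x in lborel. g x \<bullet> B x = 0"
proof -
  have D: "decomp G \<Phi> g B" using W by (simp add: WHHD_def)
  note D = decompD[OF D]
  have L: "Lp_loc 1 (\<lambda>x. exp (2 * \<Phi> x) * (B x \<bullet> g x))"
    using Lp_loc_1_exp[OF D(2) Lp_loc_2_inner[OF D(3,4)]] by simp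
  have "AE x in lborel. exp (2 * \<Phi> x) * (B x \<bullet> g x) = 0"
  proof (rule fundamental_lemma[OF L])
    fix f :: "'a \<Rightarrow> real" assume f: "test_fun f"
    have i1: "integrable lborel (\<lambda>x. exp (2 * \<Phi> x) * (B x \<bullet> grad f x))"
      by (rule integrable_exp_inner_grad[OF D(2,3) f])
    have i2: "integrable lborel (\<lambda>x. exp (2 * \<Phi> x) * (B x \<bullet> g x) * f x)"
      using integrable_test_fun_scaleR[OF L f] by (simp add: mult.commute)
    have "0 = (\<integral>x. exp (2 * \<Phi> x) * (B x \<bullet> (grad f x + (2 * f x) *\<^sub>R g x)) \<partial>lborel)"
      by (rule div_free_weighted[OF div D(3,1,2) f, symmetric])
    also have "\<dots> = (\<integral>x. exp (2 * \<Phi> x) * (B x \<bullet> grad f x) + 2 * (exp (2 * \<Phi> x) * (B x \<bullet> g x) * f x) \<partial>lborel)"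
      by (simp add: inner_add_right algebra_simps)
    also have "\<dots> = 2 * (\<integral>x. exp (2 * \<Phi> x) * (B x \<bullet> g x) * f x \<partial>lborel)"
      using i1 i2 W f by (simp add: WHHD_iff)
    finally show "(\<integral>x. exp (2 * \<Phi> x) * (B x \<bullet> g x) * f x \<partial>lborel) = 0" by simp
  qed
  then show ?thesis by eventually_elim (simp add: inner_commute)
qed

lemma WHHD_orthogonal_imp_div_free:
  assumes W: "WHHD G \<Phi> g B" and orth: "AE x in lborel. g x \<bullet> B x = 0"
  shows "div_free lborel B"
  unfolding div_free_def
proof (intro allI impI)
  have D: "decomp G \<Phi> g B" using W by (simp add: WHHD_def)
  note D = decompD[OF D]
  fix f :: "'a \<Rightarrow> real" assume f: "test_fun f"
  have [measurable]: "\<Phi> \<in> borel_measurable borel" "g \<in> borel_measurable borel" "B \<in> borel_measurable borel"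
    "f \<in> borel_measurable borel" "grad f \<in> borel_measurable borel"
    using D Linf_loc_measurable Lp_loc_measurable test_fun_measurable[OF f] grad_measurable[of f] f
    by (auto simp: test_fun_def)
  \<comment> \<open>Moving the density into the field turns weighted into Lebesgue
    divergence-freeness, so the key identity can be used for this new field.\<close>
  have div: "div_free lborel (\<lambda>x. exp (2 * \<Phi> x) *\<^sub>R B x)"
    using W by (simp add: WHHD_iff div_free_def)
  \<comment> \<open>The two exponentials cancel, and the inserted gradient term vanishes by
    orthogonality.\<close>
  have "(\<integral>x. B x \<bullet> grad f x \<partial>lborel)
      = (\<integral>x. exp (-2 * \<Phi> x) * ((exp (2 * \<Phi> x) *\<^sub>R B x) \<bullet> (grad f x + (-2 * f x) *\<^sub>R g x)) \<partial>lborel)"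
  proof (rule integral_cong_AE)
    show "AE x in lborel. B x \<bullet> grad f x
      = exp (-2 * \<Phi> x) * ((exp (2 * \<Phi> x) *\<^sub>R B x) \<bullet> (grad f x + (-2 * f x) *\<^sub>R g x))"
      using orth
    proof eventually_elim
      case (elim x)
      have "exp (-2 * \<Phi> x) * exp (2 * \<Phi> x) = 1" by (simp flip: exp_add)
      with elim show ?case
        by (simp add: inner_diff_right inner_add_right inner_commute mult.assoc[symmetric])
    qed
  qed measurable
  also have "\<dots> = 0"
    by (rule div_free_weighted[OF div Lp_loc_exp[OF D(2,3)] D(1,2) f])
  finally show "(\<integral>x. B x \<bullet> grad f x \<partial>lborel) = 0" .
qed

theorem theorem2p7:
  fixes G :: "'a::euclidean_space \<Rightarrow> 'a"
    and \<mu> :: "'a measure"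
    and \<Phi> :: "'a \<Rightarrow> real"
    and g\<Phi> :: "'a \<Rightarrow> 'a"
    and p :: real
  assumes dim: "DIM('a) \<ge> 2"
    and p: "real DIM('a) < p"
    and G: "Lp_loc p G"
    and inv: "inf_invariant G \<mu>"
    and uniq: "\<And>\<nu>. inf_invariant G \<nu> \<Longrightarrow> \<exists>c>0. \<nu> = density \<mu> (\<lambda>_. ennreal c)"
    and Phi: "H1p_loc p \<Phi> g\<Phi>"
    and rep: "\<mu> = density lborel (\<lambda>x. ennreal (exp (2 * \<Phi> x)))"
  defines "B \<equiv> (\<lambda>x. G x - g\<Phi> x)"
  shows
    "(WHHD G \<Phi> g\<Phi> B \<and>
        (\<forall>\<Phi>' g' B'. WHHD G \<Phi>' g' B' \<longrightarrow> (AE x in lborel. g' x = g\<Phi> x)))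
     \<and> ((\<exists>\<Phi>' g' B'. OHHD G \<Phi>' g' B') \<longrightarrow>
          OHHD G \<Phi> g\<Phi> B \<and>
          (\<forall>\<Phi>' g' B'. OHHD G \<Phi>' g' B' \<longrightarrow> (AE x in lborel. g' x = g\<Phi> x)))
     \<and> ((\<exists>\<Phi>' g' B'. OHHD G \<Phi>' g' B') \<longleftrightarrow>
          (div_free lborel B \<or> (AE x in lborel. g\<Phi> x \<bullet> B x = 0)))
     \<and> ((\<not> (AE x in lborel. g\<Phi> x \<bullet> B x = 0) \<or> \<not> div_free lborel B) \<longrightarrow>
          \<not> (\<exists>\<Phi>' g' B'. OHHD G \<Phi>' g' B'))"
proof -
  \<comment> \<open>From \<open>2 \<le> d < p\<close> all local Lp data are locally square
    integrable, as the notion of a decomposition demands.\<close>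
  have p2: "2 \<le> p" using dim p by linarith
  have mG: "G \<in> borel_measurable borel" by (rule Lp_loc_measurable[OF G])
  have L2: "Lp_loc 2 G" "H1p_loc 2 \<Phi> g\<Phi>"
    using G Phi p2 by (auto simp: H1p_loc_def intro: Lp_loc_mono)
  have "Lp_loc 2 B"
    unfolding B_def using L2 by (intro Lp_loc_2_diff) (auto simp: H1p_loc_def)
  then have D: "decomp G \<Phi> g\<Phi> B"
    using L2 H1p_loc_imp_Linf_loc[OF p Phi] by (simp add: decomp_def B_def)
  have W: "WHHD G \<Phi> g\<Phi> B"
    using inv unfolding rep WHHD_iff_inf_invariant[OF D mG] .
  have unique: "AE x in lborel. g' x = g\<Phi> x" if W': "WHHD G \<Phi>' g' B'" for \<Phi>' g' B'
  proof -
    have D': "decomp G \<Phi>' g' B'" using W' by (simp add: WHHD_def)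
    have "inf_invariant G (exp_measure \<Phi>')"
      using W' unfolding WHHD_iff_inf_invariant[OF D' mG] .
    from uniq[OF this] obtain c where "c > 0" "exp_measure \<Phi>' = density (exp_measure \<Phi>) (\<lambda>_. ennreal c)"
      unfolding rep by blast
    then have "AE x in lborel. \<Phi>' x = \<Phi> x + ln c / 2"
      by (intro exp_measure_proportional Linf_loc_measurable decompD(2)[OF D] decompD(2)[OF D'])
    then show ?thesis
      using decompD(1)[OF D] decompD(1)[OF D'] by (intro weak_grad_shift) (auto simp: H1p_loc_def)
  qed
  \<comment> \<open>Equal gradients force equal remainders almost everywhere, so orthogonality
    passes to \<open>B\<close>. Divergence-freeness then follows from the WHHD property rather than
    from \<open>B'\<close>.\<close>
  have transfer: "OHHD G \<Phi> g\<Phi> B" if O: "OHHD G \<Phi>' g' B'" for \<Phi>' g' B'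
  proof -
    have g: "AE x in lborel. g' x = g\<Phi> x" by (rule unique[OF OHHD_imp_WHHD[OF O]])
    have D': "decomp G \<Phi>' g' B'" using O by (simp add: OHHD_def HHD_def)
    have orth': "AE x in lborel. g' x \<bullet> B' x = 0" using O by (simp add: OHHD_def)
    have "AE x in lborel. g\<Phi> x \<bullet> B x = 0"
      using g decompD(5)[OF D'] orth' by eventually_elim (simp add: B_def)
    then show ?thesis
      using WHHD_orthogonal_imp_div_free[OF W] D by (simp add: OHHD_def HHD_def)
  qed
  \<comment> \<open>For a WHHD each of the two conditions implies the other, which is why a
    disjunction already characterises the OHHD.\<close>
  have iff: "OHHD G \<Phi> g\<Phi> B \<longleftrightarrow> div_free lborel B \<or> (AE x in lborel. g\<Phi> x \<bullet> B x = 0)"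
    using WHHD_orthogonal_imp_div_free[OF W] WHHD_div_free_imp_orthogonal[OF W] D
    by (auto simp: OHHD_def HHD_def)
  have both: "OHHD G \<Phi> g\<Phi> B \<Longrightarrow> div_free lborel B \<and> (AE x in lborel. g\<Phi> x \<bullet> B x = 0)"
    by (simp add: OHHD_def HHD_def)
  show ?thesis
    using W unique transfer iff both OHHD_imp_WHHD by blast
qed

end
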